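(* Let $X=X(\mathbb T)$ be a Banach lattice on $\mathbb T$ satisfying Assumption A, and let $r,s\in\mathbb N$. Let $K_{n,r}$, $n\in\mathbb N$, be the Kantorovich-type operators described in the context, and suppose that there exist constants $C_1,C_2>0$ such that $$\|K_{n,r}f\|_X\le C_1\|f\|_X\quad\text{for all } f\in X,\ n\in\mathbb N,$$ $$\|T-K_{n,r}T\|_X\le C_2\,n^{-s}\|T^{(s)}\|_X\quad\text{for all } T\in\mathcal T_n,\ n\in\mathbb N.$$ Then there is a constant $C>0$, independent of $f$ and $n$, such that for all $f\in X$ and all $n\in\mathbb N$ $$\|f-K_{n,r}f\|_X\le C\,\|(I-\dot A_{\gamma/n})^s f\|_X .$$
   Context: **Banach lattice.** $\mathbb T$ is the unit circle, identified with $[-\pi,\pi)$ (functions are $2\pi$-periodic), and $\mu$ is the normalized Lebesgue measure on $\mathbb T$. A Banach lattice $X$ on $\mathbb T$ is a Banach space of measurable functions on $\mathbb T$ with norm $\|\cdot\|_X$ such that: (1) if $f$ is measurable, $g\in X$ and $|f|\le|g|$, then $f\in X$ and $\|f\|_X\le\|g\|_X$; (2) if $f_n\in X$, $\sup_n\|f_n\|_X<\infty$ and $0\le f_n\uparrow f$, then $f\in X$ and $\|f_n\|_X\to\|f\|_X$; (3) if $E\subset\mathbb T$ is measurable with $\mu(E)<\infty$, then $\chi_E\in X$ and there is $c_E>0$ with $\int_E|f|\,d\mu\le c_E\|f\|_X$ for all $f\in X$. **Steklov averages.** For locally integrable $f$ and $h>0$: $A_hf(x)=\frac1h\int_{x-h/2}^{x+h/2}f(t)\,dt$,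 $\dot A_hf(x)=A_hf(x+h/2)=\frac1h\int_x^{x+h}f(t)\,dt$, and $A_{h,r}f=\sum_{k=1}^r(-1)^{k+1}\binom rk A_h^kf=f-(I-A_h)^rf$. **Assumption A.** For all $f\in X$ and $h>0$, $A_hf\in X$, and $\sup_{h>0}\sup_{\|f\|_X\le1}\|A_hf\|_X<\infty$. **Spaces $\Phi_n$.** $\mathcal T_n$ is the set of trigonometric polynomials of degree at most $n$. $(\Phi_n)_n$ is a nested family of linear subspaces of $X$ ($\Phi_m\subset\Phi_n$ for $m\le n$, $\Phi_0=\{0\}$) satisfying the Bernstein inequality: there is $B>0$ depending only on $X$ with $\|\varphi^{(k)}\|_X\le(Bn)^k\|\varphi\|_X$ for all $k\in\mathbb N$, $\varphi\in\Phi_n$ (in particular the derivatives exist and lie in $X$). **Operators.** For each $n\in\mathbb N$, $\varphi_{k,n}\in\Phi_n$, $k=1,\dots,m_n$, are $2\pi$-periodic functions and $(x_{k,n})_{k=1}^{m_n}\subset\mathbb T$ are points for which there are positive constants $\gamma,\gamma'$ (independent of $n,k$) with $\frac{\gamma}{n}\le x_{k+1,n}-x_{k,n}\le\frac{\gamma'}{n}$, $k=1,\dots,m_n$, where $x_{m_n+1,n}=2\pi+x_{1,n}$. Then $$K_{n,r}f(x)=\sum_{k=1}^{m_n}A_{\gamma/n,r}f(x_{k,n})\,\varphi_{k,n}(x).$$ *)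

theory Defs
  imports "HOL-Analysis.Analysis"
begin

(* The sort {real_normed_field, euclidean_space} of the values is inhabited by real and complex,
   so real-valued and complex-valued function spaces are treated at once. *)

definition circle :: "real measure" where
  "circle = uniform_measure lebesgue {-pi..<pi}"

definition circle_functions :: "(real \<Rightarrow> 'a::{real_normed_field, euclidean_space}) set" where
  "circle_functions = {f \<in> borel_measurable lebesgue. \<forall>x. f (x + 2 * pi) = f x}"

(* the 2 pi-periodic function that agrees with g on [-pi, pi) *)
definition periodize :: "(real \<Rightarrow> 'a) \<Rightarrow> real \<Rightarrow> 'a" where
  "periodize g x = g (x - 2 * pi * of_int \<lfloor>(x + pi) / (2 * pi)\<rfloor>)"

(* X consists of representatives rather than of classes modulo null sets: by lattice_ideal, X is
   closed under changing a function on a null set and N does not see the change.  N is only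
   meaningful on X.  In the Fatou property the limit is a finite-valued function; a monotone
   sequence bounded in norm is a.e. finite in the limit because of weight_bound for E = [-pi, pi). *)
locale banach_lattice =
  fixes X :: "(real \<Rightarrow> 'a::{real_normed_field, euclidean_space}) set"
    and N :: "(real \<Rightarrow> 'a) \<Rightarrow> real"
  assumes X_subset: "X \<subseteq> circle_functions"
    and X_add: "f \<in> X \<Longrightarrow> g \<in> X \<Longrightarrow> (\<lambda>x. f x + g x) \<in> X"
    and X_scale: "f \<in> X \<Longrightarrow> (\<lambda>x. c * f x) \<in> X"
    and N_triangle: "f \<in> X \<Longrightarrow> g \<in> X \<Longrightarrow> N (\<lambda>x. f x + g x) \<le> N f + N g"
    and N_scale: "f \<in> X \<Longrightarrow> N (\<lambda>x. c * f x) = norm c * N f"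
    and N_eq_0_iff: "f \<in> X \<Longrightarrow> N f = 0 \<longleftrightarrow> (AE x in circle. f x = 0)"
    and complete: "(\<And>n. F n \<in> X) \<Longrightarrow>
        (\<And>e. e > 0 \<Longrightarrow> \<exists>M. \<forall>i\<ge>M. \<forall>j\<ge>M. N (\<lambda>x. F i x - F j x) < e) \<Longrightarrow>
        \<exists>f\<in>X. (\<lambda>n. N (\<lambda>x. F n x - f x)) \<longlonglongrightarrow> 0"
    and lattice_ideal: "f \<in> circle_functions \<Longrightarrow> g \<in> X \<Longrightarrow>
        (AE x in circle. norm (f x) \<le> norm (g x)) \<Longrightarrow> f \<in> X \<and> N f \<le> N g"
    and fatou: "(\<And>n. (\<lambda>x. of_real (u n x)) \<in> X) \<Longrightarrow>
        bdd_above (range (\<lambda>n. N (\<lambda>x. of_real (u n x)))) \<Longrightarrow>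
        v \<in> circle_functions \<Longrightarrow>
        (AE x in circle. (\<forall>n. 0 \<le> u n x \<and> u n x \<le> u (Suc n) x) \<and> (\<lambda>n. u n x) \<longlonglongrightarrow> v x) \<Longrightarrow>
        (\<lambda>x. of_real (v x)) \<in> X \<and>
        (\<lambda>n. N (\<lambda>x. of_real (u n x))) \<longlonglongrightarrow> N (\<lambda>x. of_real (v x))"
    and indicator_in_X: "E \<in> sets lebesgue \<Longrightarrow> E \<subseteq> {-pi..<pi} \<Longrightarrow> emeasure circle E < \<infinity> \<Longrightarrow>
        periodize (indicator E) \<in> X"
    and weight_bound: "E \<in> sets lebesgue \<Longrightarrow> E \<subseteq> {-pi..<pi} \<Longrightarrow> emeasure circle E < \<infinity> \<Longrightarrow>
        \<exists>c>0. \<forall>f\<in>X. (\<integral>\<^sup>+x\<in>E. ennreal (norm (f x)) \<partial>circle) \<le> ennreal (c * N f)"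

definition steklov :: "real \<Rightarrow> (real \<Rightarrow> 'a::{real_normed_field, euclidean_space}) \<Rightarrow> real \<Rightarrow> 'a" where
  "steklov h f x = (1 / h) *\<^sub>R (LINT t:{x - h/2..x + h/2}|lebesgue. f t)"

definition steklov_fwd :: "real \<Rightarrow> (real \<Rightarrow> 'a::{real_normed_field, euclidean_space}) \<Rightarrow> real \<Rightarrow> 'a" where
  "steklov_fwd h f x = steklov h f (x + h/2)"

lemma steklov_fwd_eq: "steklov_fwd h f x = (1 / h) *\<^sub>R (LINT t:{x..x + h}|lebesgue. f t)"
  by (simp add: steklov_fwd_def steklov_def add.commute)

definition steklov_comb ::
    "real \<Rightarrow> nat \<Rightarrow> (real \<Rightarrow> 'a::{real_normed_field, euclidean_space}) \<Rightarrow> real \<Rightarrow> 'a" where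
  "steklov_comb h r f x = (\<Sum>k=1..r. (-1) ^ (k + 1) * of_nat (r choose k) * (steklov h ^^ k) f x)"

definition steklov_bounded ::
    "(real \<Rightarrow> 'a::{real_normed_field, euclidean_space}) set \<Rightarrow> ((real \<Rightarrow> 'a) \<Rightarrow> real) \<Rightarrow> bool" where
  "steklov_bounded X N \<longleftrightarrow>
     (\<forall>f\<in>X. \<forall>h>0. steklov h f \<in> X) \<and>
     bdd_above {N (steklov h f) | h f. h > 0 \<and> f \<in> X \<and> N f \<le> 1}"

definition vderiv :: "(real \<Rightarrow> 'a::real_normed_vector) \<Rightarrow> real \<Rightarrow> 'a" where
  "vderiv f x = vector_derivative f (at x)"

definition trig_polys :: "nat \<Rightarrow> (real \<Rightarrow> 'a::{real_normed_field, euclidean_space}) set" where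
  "trig_polys n =
     {T. \<exists>a b. T = (\<lambda>x. \<Sum>k\<le>n. a k * of_real (cos (real k * x)) + b k * of_real (sin (real k * x)))}"

(* vector_derivative is total, so the existence of the derivatives is a separate requirement *)
definition bernstein_family ::
    "(real \<Rightarrow> 'a::{real_normed_field, euclidean_space}) set \<Rightarrow> ((real \<Rightarrow> 'a) \<Rightarrow> real) \<Rightarrow>
     (nat \<Rightarrow> (real \<Rightarrow> 'a) set) \<Rightarrow> bool" where
  "bernstein_family X N \<Phi> \<longleftrightarrow>
     \<Phi> 0 = {\<lambda>x. 0} \<and>
     (\<forall>m n. m \<le> n \<longrightarrow> \<Phi> m \<subseteq> \<Phi> n) \<and>
     (\<forall>n. \<Phi> n \<subseteq> X) \<and>
     (\<forall>n. \<forall>\<phi>\<in>\<Phi> n. \<forall>\<psi>\<in>\<Phi> n. (\<lambda>x. \<phi> x + \<psi> x) \<in> \<Phi> n) \<and>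
     (\<forall>n c. \<forall>\<phi>\<in>\<Phi> n. (\<lambda>x. c * \<phi> x) \<in> \<Phi> n) \<and>
     (\<forall>n. \<forall>\<phi>\<in>\<Phi> n. \<forall>k x. (vderiv ^^ k) \<phi> differentiable (at x)) \<and>
     (\<exists>B>0. \<forall>n k. \<forall>\<phi>\<in>\<Phi> n. (vderiv ^^ k) \<phi> \<in> X \<and> N ((vderiv ^^ k) \<phi>) \<le> (B * real n) ^ k * N \<phi>)"

(* Points of the circle are their representatives in [-pi, pi), and the value of x n at
   m n + 1 encodes the wrap-around, hence lies outside [-pi, pi). *)
definition quasi_uniform_nodes :: "(nat \<Rightarrow> nat) \<Rightarrow> (nat \<Rightarrow> nat \<Rightarrow> real) \<Rightarrow> real \<Rightarrow> real \<Rightarrow> bool" where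
  "quasi_uniform_nodes m x \<gamma> \<gamma>' \<longleftrightarrow>
     \<gamma> > 0 \<and> \<gamma>' > 0 \<and>
     (\<forall>n\<ge>1. (\<forall>k\<in>{1..m n}. x n k \<in> {-pi..<pi}) \<and>
            x n (m n + 1) = 2 * pi + x n 1 \<and>
            (\<forall>k\<in>{1..m n}. \<gamma> / real n \<le> x n (k + 1) - x n k \<and> x n (k + 1) - x n k \<le> \<gamma>' / real n))"

definition kantorovich_op ::
    "(nat \<Rightarrow> nat) \<Rightarrow> (nat \<Rightarrow> nat \<Rightarrow> real) \<Rightarrow> (nat \<Rightarrow> nat \<Rightarrow> real \<Rightarrow> 'a) \<Rightarrow> real \<Rightarrow> nat \<Rightarrow> nat \<Rightarrow>
     (real \<Rightarrow> 'a::{real_normed_field, euclidean_space}) \<Rightarrow> real \<Rightarrow> 'a" where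
  "kantorovich_op m x \<phi> \<gamma> n r f t = (\<Sum>k=1..m n. steklov_comb (\<gamma> / real n) r f (x n k) * \<phi> n k t)"

end

theory Submission
  imports Defs "HOL-Complex_Analysis.Complex_Analysis"
begin

text \<open>Write \<open>h = \<gamma> / n\<close>, let \<open>U\<close> be the forward Steklov average over steps of length \<open>h\<close>, and \<open>D = I - U\<close>.
Since \<open>f - K f = (f - T) + (T - K T) - K (f - T)\<close>, the two hypotheses on \<open>K\<close> reduce the theorem to a
statement in which \<open>K\<close> does not occur (\<open>near_best_trig_approximation\<close>): some trigonometric polynomial \<open>T\<close> of
degree at most \<open>n\<close> satisfies \<open>N (f - T) \<le> C N (D\<^sup>s f)\<close> and \<open>N (T\<^sup>(\<^sup>s\<^sup>)) \<le> C n\<^sup>s N (D\<^sup>s f)\<close>.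
The polynomial is \<open>T = V\<^sub>n f\<close>, where \<open>V\<^sub>m\<close> multiplies the \<open>k\<close>-th Fourier coefficient by a smooth cutoff that is \<open>1\<close> for
\<open>k \<le> m / 2\<close> and \<open>0\<close> for \<open>k \<ge> m\<close>.

Translations need not be bounded on \<open>X\<close>; only averages over symmetric intervals are. A convolution is therefore
bounded on \<open>X\<close> as soon as its kernel is dominated by a sum, with summable weights, of normalized indicators of
symmetric intervals. If a symbol \<open>g\<close> is three times continuously differentiable with compact support, threefold
summation by parts bounds the kernel of the multiplier \<open>g (k / n)\<close> by \<open>C n min 1 ((n \<bar>t\<bar>)\<^sup>-\<^sup>3)\<close>
(\<open>multiplier_kernel_decay\<close>), and splitting dyadically at the scales \<open>2\<^sup>j / n\<close> gives bounds that do not depend on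
\<open>n\<close> (\<open>multiplier_bounded\<close>). The cubic decay also leaves a finite first moment of order \<open>1 / n\<close>, hence the Favard-type
inequality \<open>N (u - V\<^sub>n u) \<le> (C / n) N u'\<close> (\<open>multiplier_approximation\<close>).

On the frequency \<open>k\<close> the operator \<open>D\<close> acts as \<open>1 - a (k h)\<close> with \<open>a v = (exp (\<i> v) - 1) / (\<i> v)\<close>, and on the real
line \<open>1 - a\<close> has a single zero, a simple one at the origin. The frequencies are treated in three ranges.

  \<^item> Low (\<open>low_frequency_estimate\<close>): as \<open>\<i> v / (1 - a v)\<close> is smooth, the \<open>s\<close>-th derivative of \<open>V\<^sub>m f\<close> with \<open>m = L n\<close> is
    \<open>h\<^sup>-\<^sup>s\<close> times a multiplier with an admissible symbol applied to \<open>D\<^sup>s f\<close>.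

  \<^item> High (\<open>high_frequency_estimate\<close>): for \<open>e = f - V\<^sub>m f\<close> one has \<open>e = D e + U D e + U\<^sup>2 e\<close>. The function \<open>U\<^sup>2 e\<close> has only
    frequencies above \<open>m / 2\<close> and a derivative of size \<open>1 / h\<close>, so by the Favard-type inequality it is at most
    \<open>N e / 2\<close> if \<open>L\<close> is large, and it can be absorbed.

  \<^item> Middle (\<open>middle_frequency_estimate\<close>): \<open>V\<^sub>m f - V\<^sub>n f\<close> has no frequencies below \<open>n / 2\<close>, so \<open>s\<close> applications of the Favard-type
    inequality bound it by \<open>n\<^sup>-\<^sup>s\<close> times its \<open>s\<close>-th derivative, which the low frequency estimate controls.\<close>


section \<open>Locally integrable and periodic functions\<close>

definition loc_int :: "(real \<Rightarrow> 'a::euclidean_space) \<Rightarrow> bool" where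
  "loc_int f \<longleftrightarrow> (\<forall>a b. f absolutely_integrable_on {a..b})"

definition periodic :: "(real \<Rightarrow> 'a) \<Rightarrow> bool" where
  "periodic f \<longleftrightarrow> (\<forall>x. f (x + 2 * pi) = f x)"

lemma loc_intD: "loc_int f \<Longrightarrow> f absolutely_integrable_on {a..b}"
  by (simp add: loc_int_def)

lemma loc_int_integrable: "loc_int f \<Longrightarrow> f integrable_on {a..b}"
  by (simp add: loc_int_def set_lebesgue_integral_eq_integral(1))

text \<open>Isometries of the line preserve Lebesgue measure. Reflections are needed for convolutions, shifts for averages.\<close>

lemma loc_int_affine:
  fixes f :: "real \<Rightarrow> 'a::euclidean_space"
  assumes "loc_int f" "\<bar>c\<bar> = 1"
  shows "loc_int (\<lambda>x. f (t + c * x))"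
  unfolding loc_int_def
proof (intro allI)
  fix a b
  \<comment> \<open>the image of \<open>{a..b}\<close> under \<open>x \<mapsto> t + c * x\<close>\<close>
  define A where "A = (if c = 1 then {t + a..t + b} else {t - b..t - a})"
  have c: "c = 1 \<or> c = -1" using assms(2) by linarith
  have "set_integrable lebesgue A f" using assms(1) by (auto simp: A_def loc_int_def)
  then have "integrable lebesgue (\<lambda>x. indicator A (t + c * x) *\<^sub>R f (t + c * x))"
    unfolding set_integrable_def using c
    by (intro lebesgue_integrable_real_affine[where c=c and t=t]) auto
  moreover have "indicator A (t + c * x) = (indicator {a..b} x :: real)" for x
    using c by (auto simp: A_def indicator_def)
  ultimately show "(\<lambda>x. f (t + c * x)) absolutely_integrable_on {a..b}"
    by (simp add: set_integrable_def)
qed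

lemma loc_int_shift:
  fixes f :: "real \<Rightarrow> 'a::euclidean_space"
  shows "loc_int f \<Longrightarrow> loc_int (\<lambda>x. f (x + c))"
  using loc_int_affine[of f 1 c] by (simp add: add.commute)

lemma loc_int_reflect:
  fixes f :: "real \<Rightarrow> 'a::euclidean_space"
  shows "loc_int f \<Longrightarrow> loc_int (\<lambda>x. f (c - x))"
  using loc_int_affine[of f "-1" c] by simp

lemma loc_int_continuous: "continuous_on UNIV f \<Longrightarrow> loc_int f"
  unfolding loc_int_def
  by (meson absolutely_integrable_continuous_real continuous_on_subset subset_UNIV)

lemma loc_int_norm: "loc_int f \<Longrightarrow> loc_int (\<lambda>x. norm (f x))"
  by (simp add: loc_int_def absolutely_integrable_norm[unfolded o_def])

lemma loc_int_diff: "loc_int f \<Longrightarrow> loc_int g \<Longrightarrow> loc_int (\<lambda>x. f x - g x)"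
  by (simp add: loc_int_def set_integral_diff)

lemma loc_int_cont_scale:
  fixes f :: "real \<Rightarrow> 'a::euclidean_space"
  assumes k: "continuous_on UNIV k" and f: "loc_int f"
  shows "loc_int (\<lambda>t. k t *\<^sub>R f t)"
  unfolding loc_int_def
proof (intro allI)
  fix a b :: real
  have ck: "continuous_on {a..b} k" using k continuous_on_subset by blast
  show "(\<lambda>t. k t *\<^sub>R f t) absolutely_integrable_on {a..b}"
  proof (rule absolutely_integrable_bounded_measurable_product[where h = "(*\<^sub>R)"])
    show "bilinear ((*\<^sub>R) :: real \<Rightarrow> 'a \<Rightarrow> 'a)"
      by (simp add: bilinear_conv_bounded_bilinear bounded_bilinear_scaleR)
    show "k \<in> borel_measurable (lebesgue_on {a..b})"
      by (intro continuous_imp_measurable_on_sets_lebesgue ck) auto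
    show "bounded (k ` {a..b})"
      by (intro compact_imp_bounded compact_continuous_image ck) auto
  qed (use f in \<open>auto simp: loc_int_def\<close>)
qed

lemma steklov_eq_integral:
  assumes "loc_int f"
  shows "steklov h f x = (1 / h) *\<^sub>R integral {x - h/2..x + h/2} f"
  using assms by (simp add: steklov_def loc_int_def set_lebesgue_integral_eq_integral(2))

lemma steklov_fwd_eq_integral:
  assumes "loc_int f"
  shows "steklov_fwd h f x = (1 / h) *\<^sub>R integral {x..x + h} f"
  using assms by (simp add: steklov_fwd_eq loc_int_def set_lebesgue_integral_eq_integral(2))

text \<open>Moving the left end from \<open>a\<close> to \<open>b\<close> removes the integral over \<open>[a, b]\<close> and adds the one over \<open>[a + 2\<pi>, b + 2\<pi>]\<close>,
and these agree.\<close>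

lemma integral_period:
  fixes f :: "real \<Rightarrow> 'a::euclidean_space"
  assumes f: "loc_int f" and p: "periodic f"
  shows "integral {a..a + 2*pi} f = integral {-pi..pi} f"
proof -
  have *: "integral {a..a + 2*pi} f = integral {b..b + 2*pi} f" if "a \<le> b" for a b
  proof -
    have "integral {a..a + 2*pi} f + integral {a + 2*pi..b + 2*pi} f = integral {a..b + 2*pi} f"
      using that by (intro Henstock_Kurzweil_Integration.integral_combine loc_int_integrable f) auto
    moreover have "integral {a..b} f + integral {b..b + 2*pi} f = integral {a..b + 2*pi} f"
      using that by (intro Henstock_Kurzweil_Integration.integral_combine loc_int_integrable f) auto
    moreover have "integral {a + 2*pi..b + 2*pi} f = integral {a..b} f"
      using integral_shift_real_ivl[where f=f and c="2*pi" and a="a+2*pi" and b="b+2*pi"] p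
      by (simp add: periodic_def)
    ultimately show ?thesis by (metis add.commute add_right_cancel)
  qed
  show ?thesis
    using *[of a "-pi"] *[of "-pi" a] by (cases "a \<le> -pi") auto
qed

lemma integral_period_shift:
  fixes f :: "real \<Rightarrow> 'a::euclidean_space"
  assumes f: "loc_int f" and p: "periodic f"
  shows "integral {-pi..pi} (\<lambda>t. f (t + s)) = integral {-pi..pi} f"
  using integral_shift_real_ivl[where f=f and c=s and a="-pi+s" and b="pi+s"]
    integral_period[OF assms, of "-pi+s"] by (simp add: add.commute)

lemma integral_period_reflect:
  fixes f :: "real \<Rightarrow> 'a::euclidean_space"
  assumes f: "loc_int f" and p: "periodic f"
  shows "integral {-pi..pi} (\<lambda>t. f (s - t)) = integral {-pi..pi} f"
proof -
  have "integral {-pi..pi} (\<lambda>t. f (s - t)) = integral {-pi..pi} (\<lambda>t. f (t + s))"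
    using Henstock_Kurzweil_Integration.integral_reflect_real[of "pi" "-pi" "\<lambda>t. f (t + s)"] by simp
  then show ?thesis using integral_period_shift[OF assms] by simp
qed

text \<open>The composition of a Lebesgue measurable function with addition need not be jointly measurable for the product of the
Borel algebras. Fubini's theorem is applied to a Borel representative instead.\<close>

lemma lebesgue_borel_version:
  fixes f :: "real \<Rightarrow> 'a::euclidean_space"
  assumes "f \<in> borel_measurable lebesgue"
  obtains g where "g \<in> borel_measurable borel" "negligible {x. f x \<noteq> g x}"
proof -
  have "\<exists>g. \<forall>b\<in>Basis. g b \<in> borel_measurable lborel \<and> (AE x in lborel. f x \<bullet> b = g b x)"
  proof (rule bchoice, intro ballI)
    fix b :: 'a assume "b \<in> Basis"
    have "(\<lambda>x. f x \<bullet> b) \<in> borel_measurable lebesgue" using assms by measurable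
    from completion_ex_borel_measurable_real[OF this]
    show "\<exists>g. g \<in> borel_measurable lborel \<and> (AE x in lborel. f x \<bullet> b = g x)" by auto
  qed
  then obtain g where g: "\<And>b. b \<in> Basis \<Longrightarrow> g b \<in> borel_measurable lborel"
    "\<And>b. b \<in> Basis \<Longrightarrow> AE x in lborel. f x \<bullet> b = g b x" by blast
  have "AE x in lborel. \<forall>b\<in>Basis. f x \<bullet> b = g b x"
    by (rule AE_finite_allI) (use g in auto)
  then have "AE x in lborel. f x = (\<Sum>b\<in>Basis. g b x *\<^sub>R b)"
    by eventually_elim (metis (no_types, lifting) euclidean_representation sum.cong)
  then have "AE x in lebesgue. f x = (\<Sum>b\<in>Basis. g b x *\<^sub>R b)" by (rule AE_completion)
  then have "negligible {x. f x \<noteq> (\<Sum>b\<in>Basis. g b x *\<^sub>R b)}"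
    by (simp add: AE_iff_null_sets completion.AE_iff_null_sets negligible_iff_null_sets
        eventually_ae_filter null_sets_subset) 
       (metis (mono_tags, lifting) completion.complete2 mem_Collect_eq subset_eq)
  moreover have "(\<lambda>x. \<Sum>b\<in>Basis. g b x *\<^sub>R b) \<in> borel_measurable borel"
    using g(1) by (intro borel_measurable_sum borel_measurable_scaleR) auto
  ultimately show thesis using that by blast
qed

lemma loc_int_measurable:
  fixes f :: "real \<Rightarrow> 'a::euclidean_space"
  assumes "loc_int f" shows "f \<in> borel_measurable lebesgue"
proof (rule borel_measurable_LIMSEQ_metric)
  fix n :: nat
  show "(\<lambda>x. indicator {-real n..real n} x *\<^sub>R f x) \<in> borel_measurable lebesgue"
    using loc_intD[OF assms, of "-real n" "real n"] unfolding set_integrable_def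
    by (rule borel_measurable_integrable)
next
  fix x :: real
  obtain m :: nat where m: "\<bar>x\<bar> \<le> real m" using real_arch_simple by blast
  have "\<forall>\<^sub>F n in sequentially. indicator {-real n..real n} x *\<^sub>R f x = f x"
    using eventually_ge_at_top[of m]
  proof eventually_elim
    case (elim n)
    then have "real m \<le> real n" by simp
    then have "\<bar>x\<bar> \<le> real n" using m by linarith
    then have "x \<in> {-real n..real n}" by (simp add: abs_le_iff)
    then show ?case by simp
  qed
  then show "(\<lambda>n. indicator {-real n..real n} x *\<^sub>R f x) \<longlonglongrightarrow> f x"
    by (rule tendsto_eventually)
qed

text \<open>Fubini's theorem in the one form that is used: it moves an average of \<open>f\<close> out of a Fourier coefficient. Exchanging \<open>f\<close> for
a Borel representative \<open>g\<close> changes no inner integral, because a translate of a null set is a null set.\<close>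

lemma integral_swap_shift:
  fixes f :: "real \<Rightarrow> 'a::euclidean_space" and k :: "real \<Rightarrow> real"
  assumes f: "loc_int f" and k: "continuous_on UNIV k"
  shows "integral {a..b} (\<lambda>t. k t *\<^sub>R integral {c..d} (\<lambda>s. f (t + s)))
       = integral {c..d} (\<lambda>s. integral {a..b} (\<lambda>t. k t *\<^sub>R f (t + s)))"
proof -
  obtain g where g [measurable]: "g \<in> borel_measurable borel" and N: "negligible {x. f x \<noteq> g x}"
    using lebesgue_borel_version[OF loc_int_measurable[OF f]] by blast
  have [measurable]: "k \<in> borel_measurable borel" using k by (simp add: borel_measurable_continuous_onI)
  have shiftN: "negligible {x. f (x + c) \<noteq> g (x + c)}" for c
  proof -
    have "{x. f (x + c) \<noteq> g (x + c)} = (+) (-c) ` {x. f x \<noteq> g x}"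
      by (auto simp: image_iff) (metis add.commute add_diff_cancel_left' diff_add_cancel uminus_add_conv_diff)
    then show ?thesis using negligible_translation[OF N, of "-c"] by simp
  qed
  have gl: "loc_int g"
    unfolding loc_int_def
  proof (intro allI)
    fix a b
    show "g absolutely_integrable_on {a..b}"
      by (rule absolutely_integrable_spike[OF loc_intD[OF f] N]) auto
  qed
  have e1: "integral {c..d} (\<lambda>s. f (t + s)) = integral {c..d} (\<lambda>s. g (t + s))" for t
    by (rule integral_spike[OF shiftN[of t]]) (auto simp: add.commute)
  have e2: "integral {a..b} (\<lambda>t. k t *\<^sub>R f (t + s)) = integral {a..b} (\<lambda>t. k t *\<^sub>R g (t + s))" for s
    by (rule integral_spike[OF shiftN[of s]]) auto
  \<comment> \<open>the integrand, cut off to the rectangle; the integral of its norm over \<open>s\<close> is at most \<open>K * I\<close>\<close>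
  define h where "h = (\<lambda>(t, s). (indicator {a..b} t * indicator {c..d} s * k t) *\<^sub>R g (t + s))"
  have [measurable]: "h \<in> borel_measurable (lborel \<Otimes>\<^sub>M lborel)"
    unfolding h_def by measurable
  obtain K where K: "\<And>t. t \<in> {a..b} \<Longrightarrow> \<bar>k t\<bar> \<le> K"
  proof -
    have "bounded (k ` {a..b})"
      by (intro compact_imp_bounded compact_continuous_image continuous_on_subset[OF k]) auto
    then show thesis using that unfolding bounded_real by (metis imageI)
  qed
  have lb: "integrable lborel (\<lambda>x. indicator A x *\<^sub>R u x)" 
    if "set_integrable lebesgue A u" "u \<in> borel_measurable borel" "A \<in> sets borel" for A and u :: "real \<Rightarrow> 'a"
    using that by (simp add: set_integrable_def integrable_completion)
  define I where "I = (LINT x|lborel. indicator {a + c..b + d} x *\<^sub>R norm (g x))"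
  have Iint: "integrable lborel (\<lambda>x. indicator {a + c..b + d} x *\<^sub>R norm (g x))"
    using loc_intD[OF loc_int_norm[OF gl], of "a+c" "b+d"]
    by (simp add: set_integrable_def integrable_completion)
  have sec: "integrable lborel (\<lambda>s. norm (h (t, s))) \<and> (LINT s|lborel. norm (h (t, s))) \<le> indicator {a..b} t * (K * I)" for t
  proof (cases "t \<in> {a..b}")
    case True
    have B: "integrable lborel (\<lambda>s. indicator {a + c..b + d} (t + 1 * s) *\<^sub>R norm (g (t + 1 * s)))"
      by (rule lborel_integrable_real_affine[OF Iint]) simp
    have Beq: "(LINT s|lborel. indicator {a + c..b + d} (t + 1 * s) *\<^sub>R norm (g (t + 1 * s))) = I"
      unfolding I_def by (subst lborel_integral_real_affine[where c=1 and t=t]) simp_all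
    have le: "norm (h (t, s)) \<le> K * (indicator {a + c..b + d} (t + 1 * s) *\<^sub>R norm (g (t + 1 * s)))" for s
    proof (cases "s \<in> {c..d}")
      case s: True
      then have "t + s \<in> {a + c..b + d}" using True by auto
      moreover have "\<bar>k t\<bar> * norm (g (t + s)) \<le> K * norm (g (t + s))"
        using K[OF True] by (intro mult_right_mono) auto
      ultimately show ?thesis using s True by (simp add: h_def)
    next
      case False
      have "0 \<le> K" using K[OF True] by (meson abs_ge_zero order_trans)
      then show ?thesis using False by (simp add: h_def)
    qed
    have B': "integrable lborel (\<lambda>s. K * (indicator {a + c..b + d} (t + 1 * s) *\<^sub>R norm (g (t + 1 * s))))"
      using B by (rule integrable_mult_right)
    have i: "integrable lborel (\<lambda>s. norm (h (t, s)))"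
      by (rule Bochner_Integration.integrable_bound[OF B']) (use le in \<open>auto intro: order_trans[OF _ abs_ge_self]\<close>)
    have "(LINT s|lborel. norm (h (t, s))) \<le> (LINT s|lborel. K * (indicator {a + c..b + d} (t + 1 * s) *\<^sub>R norm (g (t + 1 * s))))"
      using i B' le by (rule integral_mono)
    also have "\<dots> = K * I" by (subst integral_mult_right_zero) (simp only: Beq)
    finally show ?thesis using i True by simp
  qed (simp add: h_def)
  have hint: "integrable (lborel \<Otimes>\<^sub>M lborel) h"
  proof (rule lborel_pair.Fubini_integrable)
    have ib: "integrable lborel (\<lambda>t. indicator {a..b} t * (K * I))"
      using emeasure_lborel_cbox_finite[of a b]
      by (intro integrable_mult_left integrable_real_indicator) simp_all
    show "integrable lborel (\<lambda>x. LINT y|lborel. norm (h (x, y)))"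
      by (rule Bochner_Integration.integrable_bound[OF ib]) 
         (use sec in \<open>auto intro!: AE_I2 order_trans[OF _ abs_ge_self] simp: abs_of_nonneg\<close>)
    show "AE x in lborel. integrable lborel (\<lambda>y. h (x, y))"
    proof (rule AE_I2)
      fix t
      have "(\<lambda>s. h (t, s)) \<in> borel_measurable lborel" by measurable
      then show "integrable lborel (\<lambda>s. h (t, s))"
        using sec[of t] integrable_norm_iff[of "\<lambda>s. h (t, s)" lborel] by blast
    qed
  qed simp
  have lbe: "(LINT x|lborel. indicator {a..b} x *\<^sub>R u x) = integral {a..b} u"
    if "u absolutely_integrable_on {a..b}" "(\<lambda>x. indicator {a..b} x *\<^sub>R u x) \<in> borel_measurable borel" for a b and u :: "real \<Rightarrow> 'a"
  proof -
    have "(LINT x|lborel. indicator {a..b} x *\<^sub>R u x) = (LINT x:{a..b}|lebesgue. u x)"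
      unfolding set_lebesgue_integral_def using that(2) by (subst integral_completion) auto
    also have "\<dots> = integral {a..b} u" using that(1) by (rule set_lebesgue_integral_eq_integral(2))
    finally show ?thesis .
  qed
  have "(LINT t|lborel. LINT s|lborel. h (t, s)) = (LINT s|lborel. LINT t|lborel. h (t, s))"
    using lborel_pair.Fubini_integral[of "\<lambda>t s. h (t, s)"] hint by simp
  moreover have "(LINT t|lborel. LINT s|lborel. h (t, s)) = integral {a..b} (\<lambda>t. k t *\<^sub>R integral {c..d} (\<lambda>s. f (t + s)))"
  proof -
    have "(LINT s|lborel. h (t, s)) = indicator {a..b} t *\<^sub>R (k t *\<^sub>R integral {c..d} (\<lambda>s. g (t + s)))" for t
    proof -
      have "(LINT s|lborel. h (t, s)) = (LINT s|lborel. (indicator {a..b} t * k t) *\<^sub>R (indicator {c..d} s *\<^sub>R g (t + s)))"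
        by (rule Bochner_Integration.integral_cong) (auto simp: h_def)
      also have "\<dots> = (indicator {a..b} t * k t) *\<^sub>R (LINT s|lborel. indicator {c..d} s *\<^sub>R g (t + s))"
        by (rule integral_scaleR_right) 
      also have "(LINT s|lborel. indicator {c..d} s *\<^sub>R g (t + s)) = integral {c..d} (\<lambda>s. g (t + s))"
        using loc_int_shift[OF gl, of t] by (intro lbe) (auto simp: loc_int_def add.commute)
      finally show ?thesis by simp
    qed
    moreover have "(LINT t|lborel. indicator {a..b} t *\<^sub>R (k t *\<^sub>R integral {c..d} (\<lambda>s. g (t + s))))
       = integral {a..b} (\<lambda>t. k t *\<^sub>R integral {c..d} (\<lambda>s. g (t + s)))"
    proof (rule lbe)
      have i: "integrable lborel (\<lambda>t. LINT s|lborel. h (t, s))"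
        using lborel_pair.integrable_fst'[of h] hint by simp
      then have i': "integrable lborel (\<lambda>t. indicator {a..b} t *\<^sub>R (k t *\<^sub>R integral {c..d} (\<lambda>s. g (t + s))))"
        by (simp only: calculation)
      show "(\<lambda>x. indicator {a..b} x *\<^sub>R (k x *\<^sub>R integral {c..d} (\<lambda>s. g (x + s)))) \<in> borel_measurable borel"
        using i' by (auto dest: borel_measurable_integrable)
      show "(\<lambda>t. k t *\<^sub>R integral {c..d} (\<lambda>s. g (t + s))) absolutely_integrable_on {a..b}"
        unfolding set_integrable_def by (subst integrable_completion) (use i' in \<open>auto dest: borel_measurable_integrable\<close>)
    qed
    ultimately show ?thesis by (simp add: e1)
  qed
  moreover have "(LINT s|lborel. LINT t|lborel. h (t, s)) = integral {c..d} (\<lambda>s. integral {a..b} (\<lambda>t. k t *\<^sub>R f (t + s)))"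
  proof -
    have eq: "(LINT t|lborel. h (t, s)) = indicator {c..d} s *\<^sub>R (integral {a..b} (\<lambda>t. k t *\<^sub>R g (t + s)))" for s
    proof -
      have "(LINT t|lborel. h (t, s)) = (LINT t|lborel. indicator {c..d} s *\<^sub>R (indicator {a..b} t *\<^sub>R (k t *\<^sub>R g (t + s))))"
        by (rule Bochner_Integration.integral_cong) (auto simp: h_def ac_simps)
      also have "\<dots> = indicator {c..d} s *\<^sub>R (LINT t|lborel. indicator {a..b} t *\<^sub>R (k t *\<^sub>R g (t + s)))"
        by (rule integral_scaleR_right) 
      also have "(LINT t|lborel. indicator {a..b} t *\<^sub>R (k t *\<^sub>R g (t + s))) = integral {a..b} (\<lambda>t. k t *\<^sub>R g (t + s))"
        using loc_int_cont_scale[OF k loc_int_shift[OF gl, of s]] by (intro lbe) (auto simp: loc_int_def)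
      finally show ?thesis by simp
    qed
    moreover have "(LINT s|lborel. indicator {c..d} s *\<^sub>R (integral {a..b} (\<lambda>t. k t *\<^sub>R g (t + s))))
       = integral {c..d} (\<lambda>s. integral {a..b} (\<lambda>t. k t *\<^sub>R g (t + s)))"
    proof (rule lbe)
      have i: "integrable lborel (\<lambda>s. LINT t|lborel. h (t, s))"
        using lborel_pair.integrable_snd[of "\<lambda>t s. h (t, s)"] hint by simp
      then have i': "integrable lborel (\<lambda>s. indicator {c..d} s *\<^sub>R (integral {a..b} (\<lambda>t. k t *\<^sub>R g (t + s))))"
        by (simp only: eq)
      show "(\<lambda>s. indicator {c..d} s *\<^sub>R (integral {a..b} (\<lambda>t. k t *\<^sub>R g (t + s)))) \<in> borel_measurable borel"
        using i' by (auto dest: borel_measurable_integrable)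
      show "(\<lambda>s. (integral {a..b} (\<lambda>t. k t *\<^sub>R g (t + s)))) absolutely_integrable_on {c..d}"
        unfolding set_integrable_def by (subst integrable_completion) (use i' in \<open>auto dest: borel_measurable_integrable\<close>)
    qed
    ultimately show ?thesis by (simp add: e2)
  qed
  ultimately show ?thesis by simp
qed

section \<open>Symbols with finitely many derivatives and the decay of their kernels\<close>

text \<open>\<open>smooth_upto p f\<close> says that \<open>f\<close> is of class \<open>C\<^sup>p\<close>. The recursion on \<open>p\<close> makes every closure property a short induction.\<close>

primrec smooth_upto :: "nat \<Rightarrow> (real \<Rightarrow> 'b::real_normed_field) \<Rightarrow> bool" where
  "smooth_upto 0 f \<longleftrightarrow> continuous_on UNIV f"
| "smooth_upto (Suc p) f \<longleftrightarrow> (\<exists>f'. (\<forall>x. (f has_vector_derivative f' x) (at x)) \<and> smooth_upto p f')"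

lemma smooth_upto_continuous: "smooth_upto p f \<Longrightarrow> continuous_on UNIV f"
  by (cases p) (auto intro!: continuous_at_imp_continuous_on dest: has_vector_derivative_continuous)

lemma smooth_upto_Suc: "smooth_upto (Suc p) f \<Longrightarrow> smooth_upto p f"
proof (induction p arbitrary: f)
  case 0 then show ?case using smooth_upto_continuous[of "Suc 0" f] by simp
next
  case (Suc p)
  from Suc.prems obtain f' where f': "\<forall>x. (f has_vector_derivative f' x) (at x)" "smooth_upto (Suc p) f'"
    unfolding smooth_upto.simps(2)[of "Suc p"] by blast
  with Suc.IH show ?case unfolding smooth_upto.simps(2)[of p f] by blast
qed

lemma smooth_upto_const: "smooth_upto p (\<lambda>_. c)"
proof (induction p arbitrary: c)
  case (Suc p)
  then show ?case by (auto intro!: exI[of _ "\<lambda>_. 0"])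
qed simp

lemma smooth_upto_add: "smooth_upto p f \<Longrightarrow> smooth_upto p g \<Longrightarrow> smooth_upto p (\<lambda>x. f x + g x)"
proof (induction p arbitrary: f g)
  case (Suc p)
  then obtain f' g' where *: "\<And>x. (f has_vector_derivative f' x) (at x)" "smooth_upto p f'"
    "\<And>x. (g has_vector_derivative g' x) (at x)" "smooth_upto p g'" by auto
  have "((\<lambda>x. f x + g x) has_vector_derivative f' x + g' x) (at x)" for x
    by (intro has_vector_derivative_add *)
  moreover note Suc.IH[OF *(2,4)]
  ultimately show ?case unfolding smooth_upto.simps by (intro exI[of _ "\<lambda>x. f' x + g' x"]) auto
qed (auto intro: continuous_on_add)

lemma smooth_upto_mult: "smooth_upto p f \<Longrightarrow> smooth_upto p g \<Longrightarrow> smooth_upto p (\<lambda>x. f x * g x)"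
proof (induction p arbitrary: f g)
  case (Suc p)
  then obtain f' g' where *: "\<And>x. (f has_vector_derivative f' x) (at x)" "smooth_upto p f'"
    "\<And>x. (g has_vector_derivative g' x) (at x)" "smooth_upto p g'" by auto
  have "smooth_upto p (\<lambda>x. f x * g' x + f' x * g x)"
    using smooth_upto_add[OF Suc.IH[OF smooth_upto_Suc[OF Suc.prems(1)] *(4)]
        Suc.IH[OF *(2) smooth_upto_Suc[OF Suc.prems(2)]]] .
  moreover have "((\<lambda>x. f x * g x) has_vector_derivative f x * g' x + f' x * g x) (at x)" for x
    by (intro has_vector_derivative_mult *)
  ultimately show ?case
    unfolding smooth_upto.simps by (intro exI[of _ "\<lambda>x. f x * g' x + f' x * g x"]) auto
qed (auto intro: continuous_on_mult)

lemma smooth_upto_power: "smooth_upto p f \<Longrightarrow> smooth_upto p (\<lambda>x. f x ^ k)"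
  by (induction k) (auto intro: smooth_upto_const smooth_upto_mult)

lemma smooth_upto_cmult: "smooth_upto p f \<Longrightarrow> smooth_upto p (\<lambda>x. c * f x)"
  by (intro smooth_upto_mult smooth_upto_const)

lemma smooth_upto_scale:
  assumes "smooth_upto p f" shows "smooth_upto p (\<lambda>x. f (c * x))"
  using assms
proof (induction p arbitrary: f)
  case 0
  have "continuous_on UNIV ((*) c)" by (intro continuous_intros)
  then show ?case using 0 continuous_on_compose2[of UNIV f UNIV "(*) c"] by simp
next
  case (Suc p)
  then obtain f' where *: "\<And>x. (f has_vector_derivative f' x) (at x)" "smooth_upto p f'" by auto
  have "((\<lambda>x. f (c * x)) has_vector_derivative c *\<^sub>R f' (c * x)) (at x)" for x
    using vector_diff_chain_at[of "(*) c" c x f "f' (c * x)", OF _ *(1)]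
    by (simp add: o_def has_real_derivative_iff_has_vector_derivative[symmetric] DERIV_cmult_Id)
  moreover have "smooth_upto p (\<lambda>x. of_real c * f' (c * x))"
    by (intro smooth_upto_cmult Suc.IH *)
  ultimately show ?case
    unfolding smooth_upto.simps scaleR_conv_of_real by (intro exI[of _ "\<lambda>x. of_real c * f' (c * x)"]) auto
qed

lemma smooth_upto_of_real:
  assumes "smooth_upto p f" shows "smooth_upto p (\<lambda>x. of_real (f x) :: 'b::real_normed_field)"
  using assms
proof (induction p arbitrary: f)
  case (Suc p)
  then obtain f' where *: "\<And>x. (f has_vector_derivative f' x) (at x)" "smooth_upto p f'" by auto
  have "((\<lambda>x. of_real (f x) :: 'b) has_vector_derivative of_real (f' x)) (at x)" for x
    by (rule bounded_linear.has_vector_derivative[OF bounded_linear_of_real *(1)])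
  with Suc.IH[OF *(2)] show ?case
    unfolding smooth_upto.simps by (intro exI[of _ "\<lambda>x. of_real (f' x)"]) auto
qed (auto intro: continuous_intros)

lemma smooth_upto_ident: "smooth_upto p (\<lambda>x::real. x)"
  by (cases p) (auto intro!: exI[of _ "\<lambda>_. 1"] smooth_upto_const)

lemma positive_part_power_has_derivative:
  fixes x :: real
  shows "((\<lambda>x. max 0 x ^ Suc (Suc p)) has_real_derivative (real (Suc (Suc p)) * max 0 x ^ Suc p)) (at x)"
proof (cases "x = 0")
  case True
  \<comment> \<open>the difference quotient at the origin is at most \<open>\<bar>h\<bar> ^ Suc p\<close>\<close>
  have "((\<lambda>h::real. max 0 h ^ Suc (Suc p) / h) \<longlongrightarrow> 0) (at 0)"
  proof (rule Lim_null_comparison)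
    show "\<forall>\<^sub>F h in at (0::real). norm (max 0 h ^ Suc (Suc p) / h) \<le> \<bar>h\<bar> ^ Suc p"
    proof (intro always_eventually allI)
      fix h :: real
      show "norm (max 0 h ^ Suc (Suc p) / h) \<le> \<bar>h\<bar> ^ Suc p"
      proof (cases "h > 0")
        case False
        then have "max 0 h = 0" by simp
        then have "norm (max 0 h ^ Suc (Suc p) / h) = 0"
          by (simp only: power_Suc mult_zero_left div_0 norm_zero)
        then show ?thesis by (simp only: zero_le_power abs_ge_zero)
      qed (simp add: abs_mult power_abs)
    qed
    show "((\<lambda>h::real. \<bar>h\<bar> ^ Suc p) \<longlongrightarrow> 0) (at 0)"
      by (rule tendsto_eq_intros refl | simp)+
  qed
  then show ?thesis using True by (simp add: DERIV_def)
next
  case False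
  then consider "x > 0" | "x < 0" by linarith
  then show ?thesis
  proof cases
    case 1
    have "((\<lambda>x::real. x ^ Suc (Suc p)) has_real_derivative (real (Suc (Suc p)) * max 0 x ^ Suc p)) (at x)"
      by (rule DERIV_cong[OF DERIV_pow]) (use 1 in simp)
    then show ?thesis
      by (rule DERIV_cong_ev[THEN iffD1, rotated -1])
         (use 1 in \<open>auto intro!: eventually_mono[OF eventually_nhds_in_open[of "{0<..}" x]]\<close>)
  next
    case 2
    have "((\<lambda>x::real. 0) has_real_derivative (real (Suc (Suc p)) * max 0 x ^ Suc p)) (at x)"
      using 2 by simp
    then show ?thesis
      by (rule DERIV_cong_ev[THEN iffD1, rotated -1])
         (use 2 in \<open>auto intro!: eventually_mono[OF eventually_nhds_in_open[of "{..<0}" x]]\<close>)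
  qed
qed

text \<open>The truncated power \<open>x\<^sub>+\<^sup>p\<^sup>+\<^sup>1\<close> is of class \<open>C\<^sup>p\<close>; composed with smooth functions it yields smooth functions with compact
support.\<close>

lemma smooth_upto_positive_part_power:
  fixes f :: "real \<Rightarrow> real"
  assumes "smooth_upto p f" shows "smooth_upto p (\<lambda>x. max 0 (f x) ^ Suc p)"
  using assms
proof (induction p arbitrary: f)
  case (Suc p)
  then obtain f' where *: "\<And>x. (f has_vector_derivative f' x) (at x)" "smooth_upto p f'" by auto
  have "((\<lambda>x. max 0 (f x) ^ Suc (Suc p)) has_vector_derivative real (Suc (Suc p)) * max 0 (f x) ^ Suc p * f' x) (at x)" for x
    using DERIV_chain2[where f="\<lambda>x. max 0 x ^ Suc (Suc p)" and g=f,
        OF positive_part_power_has_derivative[of p "f x"]] *(1)[of x]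
    unfolding has_real_derivative_iff_has_vector_derivative by blast
  moreover have "smooth_upto p (\<lambda>x. real (Suc (Suc p)) * max 0 (f x) ^ Suc p * f' x)"
    by (rule smooth_upto_mult[OF smooth_upto_mult[OF smooth_upto_const Suc.IH[OF smooth_upto_Suc[OF Suc.prems]]] *(2)])
  ultimately show ?case
    unfolding smooth_upto.simps by (intro exI[of _ "\<lambda>x. real (Suc (Suc p)) * max 0 (f x) ^ Suc p * f' x"]) auto
qed (auto intro!: continuous_intros)

lemma smooth_upto_holomorphic:
  assumes "f holomorphic_on S" "open S" "\<And>v. \<i> * of_real v \<in> S"
  shows "smooth_upto p (\<lambda>v. f (\<i> * of_real v))"
  using assms(1)
proof (induction p arbitrary: f)
  case 0
  have "continuous_on UNIV (\<lambda>v. \<i> * complex_of_real v)" by (intro continuous_intros)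
  then show ?case
    using continuous_on_compose2[OF holomorphic_on_imp_continuous_on[OF 0], of UNIV "\<lambda>v. \<i> * of_real v"] assms(3)
    by auto
next
  case (Suc p)
  have "((\<lambda>v. f (\<i> * of_real v)) has_vector_derivative \<i> * deriv f (\<i> * of_real v)) (at v)" for v
  proof -
    have d: "(f has_field_derivative deriv f (\<i> * of_real v)) (at (\<i> * of_real v))"
      using holomorphic_derivI[OF Suc.prems assms(2) assms(3)] .
    have "((\<lambda>v. \<i> * complex_of_real v) has_vector_derivative \<i>) (at v)"
      by (auto intro!: derivative_eq_intros)
    from field_vector_diff_chain_at[OF this d] show ?thesis by (simp add: o_def)
  qed
  moreover have "smooth_upto p (\<lambda>v. \<i> * deriv f (\<i> * of_real v))"
    by (intro smooth_upto_cmult Suc.IH holomorphic_deriv Suc.prems assms)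
  ultimately show ?case
    unfolding smooth_upto.simps by (intro exI[of _ "\<lambda>x. \<i> * deriv f (\<i> * of_real x)"]) auto
qed

definition bwd_diff :: "real \<Rightarrow> (real \<Rightarrow> 'b) \<Rightarrow> real \<Rightarrow> 'b::real_normed_field" where
  "bwd_diff d f u = f u - f (u - d)"

text \<open>Taking differences commutes with differentiation, which lets the mean value theorem be applied once per difference.\<close>

lemma bwd_diff_pow_derivative:
  assumes "\<And>x. (f has_vector_derivative f' x) (at x)"
  shows "((bwd_diff d ^^ p) f has_vector_derivative (bwd_diff d ^^ p) f' x) (at x)"
  using assms
proof (induction p arbitrary: x)
  case (Suc p)
  have 1: "((bwd_diff d ^^ p) f has_vector_derivative (bwd_diff d ^^ p) f' y) (at y)" for y
    by (rule Suc.IH[OF Suc.prems])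
  have 2: "((\<lambda>x. (bwd_diff d ^^ p) f (x - d)) has_vector_derivative (bwd_diff d ^^ p) f' (x - d)) (at x)"
    using vector_diff_chain_at[of "\<lambda>x. x - d" 1 x "(bwd_diff d ^^ p) f", OF _ 1]
      has_vector_derivative_diff[OF has_vector_derivative_id has_vector_derivative_const]
    by (simp add: o_def)
  show ?case using has_vector_derivative_diff[OF 1[of x] 2]
    by (simp add: bwd_diff_def[abs_def])
qed simp

lemma bwd_diff_le:
  fixes f :: "real \<Rightarrow> 'b::real_normed_field"
  assumes "\<And>x. (f has_vector_derivative f' x) (at x)" "\<And>x. norm (f' x) \<le> B" "d \<ge> 0"
  shows "norm (bwd_diff d f u) \<le> B * d"
proof -
  have "norm (f u - f (u - d)) \<le> B * norm (u - (u - d))"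
  proof (rule differentiable_bound[of UNIV f "\<lambda>x h. h *\<^sub>R f' x"])
    fix x
    show "onorm (\<lambda>h. h *\<^sub>R f' x) \<le> B"
    proof (rule onorm_bound)
      show "0 \<le> B" using assms(2)[of x] norm_ge_zero order_trans by blast
      show "norm (h *\<^sub>R f' x) \<le> B * norm h" for h
        using mult_right_mono[OF assms(2)[of x], of "\<bar>h\<bar>"] by (simp add: mult.commute)
    qed
  qed (use assms(1) in \<open>auto simp: has_vector_derivative_def\<close>)
  then show ?thesis using assms(3) by (simp add: bwd_diff_def)
qed

text \<open>A compactly supported continuous function is bounded, and each difference gains a factor \<open>d\<close> at the cost of one
derivative. The constant does not depend on the step \<open>d\<close>; this is what later makes operator bounds uniform in \<open>n\<close>.\<close>

lemma smooth_upto_difference_bound: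
  assumes "smooth_upto p f" "\<And>u. \<bar>u\<bar> > R \<Longrightarrow> f u = 0"
  shows "\<exists>C\<ge>0. \<forall>d\<ge>0. \<forall>u. norm ((bwd_diff d ^^ p) f u) \<le> C * d ^ p"
  using assms
proof (induction p arbitrary: f)
  case 0
  have "compact (f ` {-R..R})"
    using 0 by (auto intro!: compact_continuous_image intro: continuous_on_subset)
  then obtain B where B: "B > 0" "\<And>y. y \<in> f ` {-R..R} \<Longrightarrow> norm y \<le> B"
    using compact_imp_bounded bounded_pos by metis
  have "norm (f u) \<le> B" for u
  proof (cases "\<bar>u\<bar> > R")
    case False
    then have "u \<in> {-R..R}" by (auto simp: abs_le_iff)
    then show ?thesis by (intro B(2) imageI)
  qed (use B 0 in auto)
  then show ?case using B(1) by (auto intro!: exI[of _ B])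
next
  case (Suc p)
  then obtain f' where f': "\<And>x. (f has_vector_derivative f' x) (at x)" "smooth_upto p f'" by auto
  have "f' u = 0" if "\<bar>u\<bar> > R" for u
  proof -
    have "((\<lambda>_. 0) has_vector_derivative f' u) (at u)"
    proof (rule has_vector_derivative_transform_within_open[OF f'(1)])
      show "open {u. R < \<bar>u\<bar>}" by (intro open_Collect_less continuous_intros)
    qed (use that Suc.prems(2) in auto)
    then show ?thesis using vector_derivative_unique_at[OF _ has_vector_derivative_const] by blast
  qed
  from Suc.IH[OF f'(2) this] obtain C where C: "C \<ge> 0"
    "\<And>d u. d \<ge> 0 \<Longrightarrow> norm ((bwd_diff d ^^ p) f' u) \<le> C * d ^ p" by blast
  have "norm ((bwd_diff d ^^ Suc p) f u) \<le> C * d ^ Suc p" if "d \<ge> 0" for d u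
    using bwd_diff_le[OF bwd_diff_pow_derivative[OF f'(1)] C(2), of d d u] that by (simp add: mult_ac)
  then show ?case using C(1) by blast
qed

lemma powi_sum_shift:
  fixes z :: complex and c :: "int \<Rightarrow> complex"
  assumes z: "z \<noteq> 0" and c: "\<And>k. \<bar>k\<bar> > M \<Longrightarrow> c k = 0" and M: "M \<ge> 0"
  shows "(1 - z) * (\<Sum>k=-M..M. c k * z powi k) = (\<Sum>k=-(M+1)..M+1. (c k - c (k - 1)) * z powi k)"
proof -
  have "(\<Sum>k=-M..M. c k * z powi k) = (\<Sum>k=-(M+1)..M+1. c k * z powi k)"
    by (rule sum.mono_neutral_left) (use c in auto)
  moreover have "z * (\<Sum>k=-M..M. c k * z powi k) = (\<Sum>k=-(M+1)..M+1. c (k - 1) * z powi k)"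
  proof -
    have "z * (\<Sum>k=-M..M. c k * z powi k) = (\<Sum>k=-M..M. c k * z powi (k + 1))"
      using z by (simp add: sum_distrib_left power_int_add mult_ac)
    also have "\<dots> = (\<Sum>k=-M+1..M+1. c (k - 1) * z powi k)"
      by (rule sum.reindex_bij_witness[of _ "\<lambda>k. k - 1" "\<lambda>k. k + 1"]) auto
    also have "\<dots> = (\<Sum>k=-(M+1)..M+1. c (k - 1) * z powi k)"
      by (rule sum.mono_neutral_left) (use c in auto)
    finally show ?thesis .
  qed
  ultimately show ?thesis by (simp add: left_diff_distrib sum_subtractf)
qed

text \<open>Summation by parts \<open>p\<close> times. The support of the coefficients grows by one index at each step, so it has to be carried
through the induction.\<close>

lemma powi_sum_bwd_diff:
  fixes z :: complex and g :: "real \<Rightarrow> complex"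
  assumes z: "z \<noteq> 0" and g: "\<And>u. \<bar>u\<bar> > d * real_of_int M \<Longrightarrow> g u = 0" and M: "M \<ge> 0" and d: "d > 0"
  shows "(1 - z) ^ p * (\<Sum>k=-M..M. g (d * of_int k) * z powi k)
       = (\<Sum>k=-(M+int p)..M+int p. (bwd_diff d ^^ p) g (d * of_int k) * z powi k)
       \<and> (\<forall>u. \<bar>u\<bar> > d * of_int (M + int p) \<longrightarrow> (bwd_diff d ^^ p) g u = 0)"
proof (induction p)
  case 0 then show ?case using g by simp
next
  case (Suc p)
  let ?g = "(bwd_diff d ^^ p) g"
  have IH: "(1 - z) ^ p * (\<Sum>k=-M..M. g (d * of_int k) * z powi k)
       = (\<Sum>k=-(M+int p)..M+int p. ?g (d * of_int k) * z powi k)"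
    and v: "\<And>u. \<bar>u\<bar> > d * of_int (M + int p) \<Longrightarrow> ?g u = 0" using Suc.IH by auto
  have "(1 - z) ^ Suc p * (\<Sum>k=-M..M. g (d * of_int k) * z powi k)
      = (1 - z) * (\<Sum>k=-(M+int p)..M+int p. ?g (d * of_int k) * z powi k)"
    using IH by (simp add: mult.assoc)
  also have "\<dots> = (\<Sum>k=-(M+int p+1)..M+int p+1. (?g (d * of_int k) - ?g (d * of_int (k - 1))) * z powi k)"
  proof (rule powi_sum_shift[OF z])
    fix k :: int assume "\<bar>k\<bar> > M + int p"
    then have "d * \<bar>real_of_int k\<bar> > d * of_int (M + int p)"
      using d by (metis mult_strict_left_mono of_int_abs of_int_less_iff)
    then show "?g (d * of_int k) = 0" using d by (intro v) (simp add: abs_mult)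
  qed (use M in auto)
  also have "\<dots> = (\<Sum>k=-(M+int (Suc p))..M+int (Suc p). (bwd_diff d ^^ Suc p) g (d * of_int k) * z powi k)"
    by (rule sum.cong) (auto simp: bwd_diff_def algebra_simps)
  finally have 1: "(1 - z) ^ Suc p * (\<Sum>k=-M..M. g (d * of_int k) * z powi k) = \<dots>" .
  have 2: "(bwd_diff d ^^ Suc p) g u = 0" if "\<bar>u\<bar> > d * of_int (M + int (Suc p))" for u
  proof -
    have "d * of_int (M + int p) + d < \<bar>u\<bar>" using that by (simp add: algebra_simps)
    then have "\<bar>u\<bar> > d * of_int (M + int p)" "\<bar>u - d\<bar> > d * of_int (M + int p)" using d by linarith+
    then show ?thesis using v by (simp add: bwd_diff_def)
  qed
  from 1 2 show ?case by blast
qed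

text \<open>Up to \<open>\<pi> / 3\<close> the derivative \<open>cos\<close> is at least \<open>1 / 2\<close>; beyond it, \<open>sin\<close> stays above \<open>sqrt 3 / 2\<close> while the argument stays
below \<open>2\<close>.\<close>

lemma sin_lower_linear:
  assumes "0 \<le> y" "y \<le> pi / 2" shows "2 / 5 * y \<le> sin (y::real)"
proof (cases "y \<le> pi / 3")
  case True
  have "sin 0 - 2 / 5 * 0 \<le> sin y - 2 / 5 * y"
  proof (rule DERIV_nonneg_imp_nondecreasing[OF assms(1)])
    fix x assume x: "0 \<le> x" "x \<le> y"
    have "cos (pi / 3) \<le> cos x" using x True by (intro cos_monotone_0_pi_le) auto
    then have "0 \<le> cos x - 2 / 5" by (simp add: cos_60)
    moreover have "((\<lambda>x. sin x - 2 / 5 * x) has_real_derivative cos x - 2 / 5) (at x)"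
      by (auto intro!: derivative_eq_intros)
    ultimately show "\<exists>d. ((\<lambda>x. sin x - 2 / 5 * x) has_real_derivative d) (at x) \<and> 0 \<le> d" by blast
  qed
  then show ?thesis by simp
next
  case False
  have "sin (pi / 3) \<le> sin y" using False assms by (intro sin_monotone_2pi_le) auto
  moreover have "8 / 5 \<le> sqrt 3" by (rule real_le_rsqrt) (simp add: power2_eq_square)
  ultimately have "4 / 5 \<le> sin y" by (simp add: sin_60)
  moreover have "y \<le> 2" using assms(2) pi_less_4 by linarith
  ultimately show ?thesis by linarith
qed

lemma one_minus_cis_lower:
  assumes "\<bar>t\<bar> \<le> pi"
  shows "2 / 5 * \<bar>t\<bar> \<le> norm (1 - cis t)"
proof -
  have "norm (1 - cis t) = 2 * \<bar>sin (t / 2)\<bar>"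
    using dist_exp_i_1[of t] by (simp add: cis_conv_exp norm_minus_commute)
  moreover have "2 / 5 * \<bar>t / 2\<bar> \<le> \<bar>sin (t / 2)\<bar>"
    using sin_lower_linear[of "\<bar>t / 2\<bar>"] assms by (cases "t \<ge> 0") auto
  ultimately show ?thesis by simp
qed

text \<open>The trivial estimate of the sum of about \<open>2 R n\<close> terms gives the first bound. For the second one, multiplication by
\<open>(1 - cis t)\<^sup>3\<close>, which is of size \<open>\<bar>t\<bar>\<^sup>3\<close>, turns the coefficients into third differences with step \<open>1 / n\<close>, of size \<open>n\<^sup>-\<^sup>3\<close>.\<close>

lemma multiplier_kernel_decay:
  assumes g: "smooth_upto 3 g" and R: "\<And>u. \<bar>u\<bar> > real R \<Longrightarrow> g u = 0"
  shows "\<exists>C\<ge>0. \<forall>n\<ge>1. \<forall>t. \<bar>t\<bar> \<le> pi \<longrightarrow>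
    (let K = norm (\<Sum>k=-int (R * n)..int (R * n). g (of_int k / real n) * cis t powi k)
     in K \<le> C * real n \<and> K * (real n * \<bar>t\<bar>) ^ 3 \<le> C * real n)"
proof -
  have g0: "smooth_upto 0 g" using g smooth_upto_continuous by simp
  obtain C0 where C0: "C0 \<ge> 0" "\<And>u. norm (g u) \<le> C0"
  proof -
    have "\<exists>C\<ge>0. \<forall>d\<ge>0. \<forall>u. norm ((bwd_diff d ^^ 0) g u) \<le> C * d ^ 0"
      by (rule smooth_upto_difference_bound[OF g0]) (rule R)
    then obtain C where C: "C \<ge> 0" "\<forall>d\<ge>0. \<forall>u. norm ((bwd_diff d ^^ 0) g u) \<le> C * d ^ 0" by (elim exE conjE)
    show thesis using that[OF C(1)] C(2)[rule_format, of 1] by simp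
  qed
  have "\<exists>C\<ge>0. \<forall>d\<ge>0. \<forall>u. norm ((bwd_diff d ^^ 3) g u) \<le> C * d ^ 3"
    by (rule smooth_upto_difference_bound[OF g]) (rule R)
  then obtain C3 where C3: "C3 \<ge> 0" and "\<forall>d\<ge>0. \<forall>u. norm ((bwd_diff d ^^ 3) g u) \<le> C3 * d ^ 3"
    by (elim exE conjE)
  then have C3': "norm ((bwd_diff d ^^ 3) g u) \<le> C3 * d ^ 3" if "d \<ge> 0" for d u using that by simp
  \<comment> \<open>at most \<open>2 * (R * n + 3) + 1\<close> terms occur, which is at most \<open>L * n\<close> as \<open>n \<ge> 1\<close>\<close>
  define L where "L = 2 * real R + 7"
  define C where "C = L * C0 + (5 / 2) ^ 3 * (L * C3)"
  have L: "L \<ge> 0" by (simp add: L_def)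
  have CC: "C \<ge> 0" "L * C0 \<le> C" "(5 / 2) ^ 3 * (L * C3) \<le> C"
    using L C0(1) C3 by (auto simp: C_def)
  have "let K = norm (\<Sum>k=-int (R * n)..int (R * n). g (of_int k / real n) * cis t powi k)
     in K \<le> C * real n \<and> K * (real n * \<bar>t\<bar>) ^ 3 \<le> C * real n" if n: "n \<ge> 1" and t: "\<bar>t\<bar> \<le> pi" for n t
  proof -
    define d where "d = 1 / real n"
    define M where "M = int (R * n)"
    have d: "d > 0" "real n * d = 1" using n by (auto simp: d_def)
    define K where "K = (\<Sum>k=-M..M. g (d * of_int k) * cis t powi k)"
    have Kn: "(\<Sum>k=-int (R * n)..int (R * n). g (of_int k / real n) * cis t powi k) = K"
      by (simp add: K_def M_def d_def)
    have np: "norm (cis t powi k) = 1" for k by (simp add: norm_power_int)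
    have card: "real (card {-(M + int p)..M + int p}) \<le> L * real n" if "p \<le> 3" for p
    proof -
      have "real (card {-(M + int p)..M + int p}) = 2 * (real R * real n + real p) + 1"
        by (simp add: M_def)
      also have "\<dots> \<le> 2 * (real R * real n + 3) + 1" using that by simp
      also have "\<dots> \<le> L * real n" using n by (simp add: L_def algebra_simps)
      finally show ?thesis .
    qed
    have "norm K \<le> (\<Sum>k=-M..M. C0)"
      unfolding K_def by (rule sum_norm_le) (simp add: norm_mult np C0(2))
    also have "\<dots> \<le> C0 * (L * real n)"
      using card[of 0] C0(1) by (simp add: mult.commute mult_left_mono)
    also have "\<dots> \<le> C * real n" using CC(2) n by (simp add: mult_ac mult_right_mono)
    finally have 1: "norm K \<le> C * real n" .
    have "(1 - cis t) ^ 3 * K = (\<Sum>k=-(M+int 3)..M+int 3. (bwd_diff d ^^ 3) g (d * of_int k) * cis t powi k)"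
    proof -
      have "g u = 0" if "\<bar>u\<bar> > d * real_of_int M" for u
        using that n by (intro R) (simp add: d_def M_def)
      then show ?thesis
        unfolding K_def using powi_sum_bwd_diff[of "cis t" d M g 3] d(1) by (auto simp: M_def)
    qed
    then have "norm (1 - cis t) ^ 3 * norm K
        = norm (\<Sum>k=-(M+int 3)..M+int 3. (bwd_diff d ^^ 3) g (d * of_int k) * cis t powi k)"
      by (simp only: norm_power[symmetric] norm_mult[symmetric])
    also have "\<dots> \<le> (\<Sum>k=-(M+int 3)..M+int 3. C3 * d ^ 3)"
      by (rule sum_norm_le) (simp add: norm_mult np C3' d less_imp_le)
    also have "\<dots> \<le> C3 * d ^ 3 * (L * real n)"
      using mult_left_mono[OF card[of 3], of "C3 * d ^ 3"] C3 d(1) by (simp add: mult.commute)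
    finally have "norm (1 - cis t) ^ 3 * norm K \<le> C3 * d ^ 3 * (L * real n)" .
    moreover have "(2 / 5 * \<bar>t\<bar>) ^ 3 * norm K \<le> norm (1 - cis t) ^ 3 * norm K"
      by (intro mult_right_mono power_mono one_minus_cis_lower t) auto
    ultimately have "(2 / 5 * \<bar>t\<bar>) ^ 3 * norm K \<le> C3 * d ^ 3 * (L * real n)" by linarith
    then have "(5 / 2 * real n) ^ 3 * ((2 / 5 * \<bar>t\<bar>) ^ 3 * norm K) \<le> (5 / 2 * real n) ^ 3 * (C3 * d ^ 3 * (L * real n))"
      by (intro mult_left_mono) auto
    also have "\<dots> = (real n * d) ^ 3 * ((5 / 2) ^ 3 * (L * C3)) * real n"
      by (simp only: power_mult_distrib mult_ac)
    also have "\<dots> \<le> C * real n" using CC(3) by (simp only: d(2)) (simp add: mult_right_mono)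
    also have "(5 / 2 * real n) ^ 3 * ((2 / 5 * \<bar>t\<bar>) ^ 3 * norm K) = norm K * (real n * \<bar>t\<bar>) ^ 3"
      by (simp add: power_mult_distrib power_divide)
    finally have 2: "norm K * (real n * \<bar>t\<bar>) ^ 3 \<le> C * real n" .
    from 1 2 show ?thesis by (simp only: Kn Let_def) 
  qed
  with CC(1) show ?thesis by blast
qed

text \<open>The fourth powers of positive parts make this even function of class \<open>C\<^sup>3\<close>; the inner argument is chosen so that the
function is \<open>1\<close> on \<open>[-1/2, 1/2]\<close> and \<open>0\<close> outside \<open>[-1, 1]\<close>.\<close>

definition cutoff :: "real \<Rightarrow> real" where
  "cutoff u = max 0 (1 - max 0 ((4 * u\<^sup>2 - 1) / 3) ^ 4) ^ 4"

lemma cutoff_eq_1: "\<bar>u\<bar> \<le> 1 / 2 \<Longrightarrow> cutoff u = 1"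
proof -
  assume "\<bar>u\<bar> \<le> 1 / 2"
  then have "\<bar>u\<bar>\<^sup>2 \<le> (1 / 2)\<^sup>2" by (intro power_mono) auto
  then have "max 0 ((4 * u\<^sup>2 - 1) / 3) = 0" by (simp add: power2_eq_square)
  then show ?thesis by (simp add: cutoff_def)
qed

lemma cutoff_eq_0: "\<bar>u\<bar> \<ge> 1 \<Longrightarrow> cutoff u = 0"
proof -
  assume "\<bar>u\<bar> \<ge> 1"
  then have "1 \<le> \<bar>u\<bar>\<^sup>2" using one_le_power by blast
  then have "1 \<le> max 0 ((4 * u\<^sup>2 - 1) / 3)" by simp
  then have "1 \<le> max 0 ((4 * u\<^sup>2 - 1) / 3) ^ 4" by (rule one_le_power)
  then show ?thesis by (simp add: cutoff_def)
qed

lemma cutoff_even: "cutoff (- u) = cutoff u" by (simp add: cutoff_def)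

lemma cutoff_smooth: "smooth_upto 3 cutoff"
proof -
  have 4: "4 = Suc 3" by simp
  have "smooth_upto 3 (\<lambda>u::real. 4 / 3 * u\<^sup>2 + (- (1 / 3)))"
    by (intro smooth_upto_add smooth_upto_cmult smooth_upto_power smooth_upto_ident smooth_upto_const)
  then have "smooth_upto 3 (\<lambda>u::real. max 0 (4 / 3 * u\<^sup>2 + (- (1 / 3))) ^ Suc 3)"
    by (rule smooth_upto_positive_part_power)
  then have "smooth_upto 3 (\<lambda>u::real. 1 + (-1) * max 0 (4 / 3 * u\<^sup>2 + (- (1 / 3))) ^ Suc 3)"
    by (intro smooth_upto_add smooth_upto_cmult smooth_upto_const)
  then have "smooth_upto 3 (\<lambda>u::real. max 0 (1 + (-1) * max 0 (4 / 3 * u\<^sup>2 + (- (1 / 3))) ^ Suc 3) ^ Suc 3)"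
    by (rule smooth_upto_positive_part_power)
  moreover have "(\<lambda>u::real. max 0 (1 + (-1) * max 0 (4 / 3 * u\<^sup>2 + (- (1 / 3))) ^ Suc 3) ^ Suc 3) = cutoff"
    by (auto simp: cutoff_def 4[symmetric] diff_divide_distrib fun_eq_iff simp del: power_Suc)
  ultimately show ?thesis by simp
qed

section \<open>Domination of kernels by averages over dyadic intervals\<close>

definition avg :: "real \<Rightarrow> (real \<Rightarrow> 'a::real_normed_vector) \<Rightarrow> real \<Rightarrow> real" where
  "avg h f x = (1 / h) * integral {x - h/2..x + h/2} (\<lambda>t. norm (f t))"

text \<open>The size of the kernel of a multiplier at scale \<open>n\<close>: \<open>\<bar>k t\<bar> \<le> C n min 1 ((n \<bar>t\<bar>)\<^sup>-\<^sup>3)\<close> on one period.\<close>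

definition decaying :: "real \<Rightarrow> nat \<Rightarrow> (real \<Rightarrow> real) \<Rightarrow> bool" where
  "decaying C n k \<longleftrightarrow> C \<ge> 0 \<and> n \<ge> 1 \<and> continuous_on UNIV k \<and>
     (\<forall>t. \<bar>t\<bar> \<le> pi \<longrightarrow> \<bar>k t\<bar> \<le> C * real n \<and> \<bar>k t\<bar> * (real n * \<bar>t\<bar>) ^ 3 \<le> C * real n)"

text \<open>At \<open>t\<close> the summand of the least index \<open>j\<close> with \<open>n \<bar>t\<bar> \<le> 2\<^sup>j\<close> alone suffices: if \<open>j > 0\<close>, then \<open>n \<bar>t\<bar> > 2\<^sup>j\<^sup>-\<^sup>1\<close>, and the
cubic decay gives \<open>8 \<cdot> 8\<^sup>-\<^sup>j\<close>. Since \<open>\<bar>t\<bar> \<le> \<pi>\<close>, finitely many scales are enough, and no limit in \<open>X\<close> has to be taken.\<close>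

lemma dyadic_majorant:
  assumes k: "decaying C n k" and t: "\<bar>t\<bar> \<le> pi" and J: "pi * real n \<le> 2 ^ J"
  shows "\<bar>k t\<bar> \<le> (\<Sum>j\<le>J. 8 * C * real n * (1 / 8) ^ j * indicator {-(2 ^ j / real n)..2 ^ j / real n} t)"
proof -
  have C: "C \<ge> 0" and n: "n \<ge> 1" and k1: "\<bar>k t\<bar> \<le> C * real n"
    and k3: "\<bar>k t\<bar> * (real n * \<bar>t\<bar>) ^ 3 \<le> C * real n"
    using k t by (auto simp: decaying_def)
  define P where "P j \<longleftrightarrow> real n * \<bar>t\<bar> \<le> 2 ^ j" for j :: nat
  have PJ: "P J"
    using mult_left_mono[OF t, of "real n"] J by (simp add: P_def mult.commute)
  define i where "i = (LEAST j. P j)"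
  have i: "P i" "i \<le> J" unfolding i_def using PJ by (auto intro: LeastI Least_le)
  have "\<bar>k t\<bar> \<le> 8 * C * real n * (1 / 8) ^ i"
  proof (cases i)
    case 0
    have "C * real n \<le> 8 * C * real n" using C by simp
    then show ?thesis using k1 0 by simp
  next
    case (Suc j)
    then have "\<not> P j" unfolding i_def using not_less_Least[of j P] by simp
    then have "2 ^ j \<le> real n * \<bar>t\<bar>" by (simp add: P_def)
    then have "(2 ^ j) ^ 3 \<le> (real n * \<bar>t\<bar>) ^ 3" by (intro power_mono) auto
    then have "\<bar>k t\<bar> * (2 ^ j) ^ 3 \<le> \<bar>k t\<bar> * (real n * \<bar>t\<bar>) ^ 3" by (intro mult_left_mono) auto
    moreover have "(2 ^ j) ^ 3 = (8 ^ j :: real)"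
      by (simp add: power_mult[symmetric] mult.commute[of j] power_mult)
    ultimately have "\<bar>k t\<bar> * 8 ^ j \<le> C * real n" using k3 by simp
    then show ?thesis using Suc by (simp add: field_simps power_one_over)
  qed
  also have "\<dots> = 8 * C * real n * (1 / 8) ^ i * indicator {-(2 ^ i / real n)..2 ^ i / real n} t"
  proof -
    have "\<bar>t\<bar> \<le> 2 ^ i / real n" using i(1) n by (simp add: P_def field_simps)
    then have "t \<in> {-(2 ^ i / real n)..2 ^ i / real n}" by (auto simp: abs_le_iff)
    then show ?thesis by simp
  qed
  also have "\<dots> \<le> (\<Sum>j\<le>J. 8 * C * real n * (1 / 8) ^ j * indicator {-(2 ^ j / real n)..2 ^ j / real n} t)"
    using C i(2) by (intro member_le_sum) auto
  finally show ?thesis .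
qed

lemma decaying_integral_bound:
  assumes k: "decaying C n k" and w: "loc_int w" "\<And>t. 0 \<le> w t" and J: "pi * real n \<le> 2 ^ J"
  shows "integral {-pi..pi} (\<lambda>t. \<bar>k t\<bar> * w t)
       \<le> (\<Sum>j\<le>J. 8 * C * real n * (1 / 8) ^ j * integral {-(2 ^ j / real n)..2 ^ j / real n} w)"
proof -
  have C: "C \<ge> 0" and n: "n \<ge> 1" and kc: "continuous_on UNIV k" using k by (auto simp: decaying_def)
  define I where "I j = {-(2 ^ j / real n)..2 ^ j / real n}" for j :: nat
  have eqI: "(\<lambda>t. indicator (I j) t * w t) = (\<lambda>t. if t \<in> I j then w t else 0)" for j
    by (auto simp: indicator_def)
  have Icap: "\<exists>a b. {-pi..pi} \<inter> I j = {a..b}" for j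
    unfolding I_def by (metis Int_atLeastAtMost)
  have wI: "(\<lambda>t. indicator (I j) t * w t) integrable_on {-pi..pi}" for j
    unfolding eqI integrable_restrict_Int
  proof -
    obtain a b where "{-pi..pi} \<inter> I j = {a..b}" using Icap by blast
    then show "w integrable_on I j \<inter> {-pi..pi}" using loc_int_integrable[OF w(1), of a b]
      by (simp add: Int_commute)
  qed
  have kw: "(\<lambda>t. \<bar>k t\<bar> * w t) integrable_on {-pi..pi}"
    using loc_int_integrable[OF loc_int_cont_scale[OF continuous_on_rabs[OF kc] w(1)]] by simp
  have "integral {-pi..pi} (\<lambda>t. \<bar>k t\<bar> * w t)
      \<le> integral {-pi..pi} (\<lambda>t. \<Sum>j\<le>J. 8 * C * real n * (1 / 8) ^ j * (indicator (I j) t * w t))"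
  proof (rule integral_le[OF kw])
    show "(\<lambda>t. \<Sum>j\<le>J. 8 * C * real n * (1 / 8) ^ j * (indicator (I j) t * w t)) integrable_on {-pi..pi}"
      by (intro integrable_sum integrable_on_mult_right wI) auto
    fix t :: real assume "t \<in> {-pi..pi}"
    then have "\<bar>t\<bar> \<le> pi" by (auto simp: abs_le_iff)
    from mult_right_mono[OF dyadic_majorant[OF k this J] w(2)[of t]]
    show "\<bar>k t\<bar> * w t \<le> (\<Sum>j\<le>J. 8 * C * real n * (1 / 8) ^ j * (indicator (I j) t * w t))"
      by (simp add: sum_distrib_right mult.assoc I_def)
  qed
  also have "\<dots> = (\<Sum>j\<le>J. 8 * C * real n * (1 / 8) ^ j * integral {-pi..pi} (\<lambda>t. indicator (I j) t * w t))"
    by (subst integral_sum) (auto intro!: integrable_on_mult_right wI)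
  also have "\<dots> \<le> (\<Sum>j\<le>J. 8 * C * real n * (1 / 8) ^ j * integral (I j) w)"
  proof (intro sum_mono mult_left_mono)
    fix j
    have "integral {-pi..pi} (\<lambda>t. indicator (I j) t * w t) = integral (I j \<inter> {-pi..pi}) w"
      unfolding eqI by (rule integral_restrict_Int)
    also have "\<dots> \<le> integral (I j) w"
    proof (rule integral_subset_le)
      obtain a b where "{-pi..pi} \<inter> I j = {a..b}" using Icap by blast
      then show "w integrable_on I j \<inter> {-pi..pi}" using loc_int_integrable[OF w(1), of a b]
        by (simp add: Int_commute)
    qed (auto simp: I_def loc_int_integrable w)
    finally show "integral {-pi..pi} (\<lambda>t. indicator (I j) t * w t) \<le> integral (I j) w" .
  qed (use C in auto)
  finally show ?thesis by (simp add: I_def)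
qed

lemma integral_reflect_avg:
  fixes f :: "real \<Rightarrow> 'a::real_normed_vector"
  assumes "d > 0"
  shows "integral {-d..d} (\<lambda>t. norm (f (x - t))) = 2 * d * avg (2 * d) f x"
proof -
  have "integral {-d..d} (\<lambda>t. norm (f (x - t))) = integral {-d..d} (\<lambda>t. norm (f (t + x)))"
    using Henstock_Kurzweil_Integration.integral_reflect_real[of d "-d" "\<lambda>t. norm (f (t + x))"]
    by (simp add: add.commute)
  also have "\<dots> = integral {x - d..x + d} (\<lambda>t. norm (f t))"
    using integral_shift_real_ivl[where f="\<lambda>t. norm (f t)" and c=x and a="x-d" and b="x+d"] by simp
  finally show ?thesis using assms by (simp add: avg_def)
qed

text \<open>An interval of length \<open>2\<^sup>j\<^sup>+\<^sup>1 / n\<close> turns the weight \<open>n 8\<^sup>-\<^sup>j\<close> of the dyadic majorant into \<open>4\<^sup>-\<^sup>j\<close>, so the weights of the averages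
are summable with a sum that depends on neither \<open>n\<close> nor \<open>J\<close>.\<close>

lemma decaying_convolution_bound:
  fixes f :: "real \<Rightarrow> 'a::euclidean_space"
  assumes k: "decaying C n k" and f: "loc_int f" and J: "pi * real n \<le> 2 ^ J"
  shows "norm (integral {-pi..pi} (\<lambda>t. k t *\<^sub>R f (x - t)))
       \<le> (\<Sum>j\<le>J. 16 * C * (1 / 4) ^ j * avg (2 ^ (j + 1) / real n) f x)"
proof -
  have n: "n \<ge> 1" and kc: "continuous_on UNIV k" using k by (auto simp: decaying_def)
  have fx: "loc_int (\<lambda>t. f (x - t))" using f by (rule loc_int_reflect)
  have "norm (integral {-pi..pi} (\<lambda>t. k t *\<^sub>R f (x - t))) \<le> integral {-pi..pi} (\<lambda>t. \<bar>k t\<bar> * norm (f (x - t)))"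
  proof (rule integral_norm_bound_integral)
    show "(\<lambda>t. k t *\<^sub>R f (x - t)) integrable_on {-pi..pi}"
      by (rule loc_int_integrable[OF loc_int_cont_scale[OF kc fx]])
    show "(\<lambda>t. \<bar>k t\<bar> * norm (f (x - t))) integrable_on {-pi..pi}"
      using loc_int_integrable[OF loc_int_norm[OF loc_int_cont_scale[OF kc fx]]] by simp
  qed simp
  also have "\<dots> \<le> (\<Sum>j\<le>J. 8 * C * real n * (1 / 8) ^ j * integral {-(2 ^ j / real n)..2 ^ j / real n} (\<lambda>t. norm (f (x - t))))"
    by (rule decaying_integral_bound[OF k loc_int_norm[OF fx] _ J]) simp
  also have "\<dots> = (\<Sum>j\<le>J. 16 * C * (1 / 4) ^ j * avg (2 ^ (j + 1) / real n) f x)"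
  proof (rule sum.cong[OF refl])
    fix j
    have "integral {-(2 ^ j / real n)..2 ^ j / real n} (\<lambda>t. norm (f (x - t))) = 2 * (2 ^ j / real n) * avg (2 * (2 ^ j / real n)) f x"
      using n by (intro integral_reflect_avg) auto
    then have "integral {-(2 ^ j / real n)..2 ^ j / real n} (\<lambda>t. norm (f (x - t))) = 2 * (2 ^ j / real n) * avg (2 ^ (j + 1) / real n) f x"
      by simp
    moreover have "8 * C * real n * (1 / 8) ^ j * (2 * (2 ^ j / real n)) = 16 * C * (1 / 4) ^ j"
    proof -
      have "(1 / 8) ^ j * 2 ^ j = (1 / 4 :: real) ^ j" by (simp add: power_mult_distrib[symmetric])
      then show ?thesis using n by (simp add: field_simps)
    qed
    ultimately show "8 * C * real n * (1 / 8) ^ j * integral {-(2 ^ j / real n)..2 ^ j / real n} (\<lambda>t. norm (f (x - t)))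
       = 16 * C * (1 / 4) ^ j * avg (2 ^ (j + 1) / real n) f x" by (metis mult.assoc)
  qed
  finally show ?thesis .
qed

text \<open>For \<open>\<bar>t\<bar> \<le> 2\<^sup>j / n\<close> the difference \<open>u x - u (x - t)\<close> is at most the integral of \<open>\<bar>G\<bar>\<close> over the interval of radius \<open>2\<^sup>j / n\<close>
around \<open>x\<close>. This costs a second factor \<open>2\<^sup>j / n\<close> compared with the plain convolution, and the weights \<open>2\<^sup>-\<^sup>j / n\<close> that remain
are still summable. A kernel with only quadratic decay would lose a logarithm here.\<close>

lemma decaying_approximation_bound:
  fixes u :: "real \<Rightarrow> 'a::euclidean_space" and G :: "real \<Rightarrow> 'b::euclidean_space"
  assumes k: "decaying C n k" and J: "pi * real n \<le> 2 ^ J"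
    and u: "\<And>y. (u has_vector_derivative u' y) (at y)" "continuous_on UNIV u'"
    and G: "loc_int G" "\<And>y. norm (u' y) \<le> norm (G y)"
  shows "norm (integral {-pi..pi} (\<lambda>t. k t *\<^sub>R (u x - u (x - t))))
       \<le> (\<Sum>j\<le>J. 32 * C / real n * (1 / 2) ^ j * avg (2 ^ (j + 1) / real n) G x)"
proof -
  have n: "n \<ge> 1" and C: "C \<ge> 0" and kc: "continuous_on UNIV k" using k by (auto simp: decaying_def)
  have uc: "continuous_on UNIV u"
    using u(1) has_vector_derivative_continuous by (intro continuous_at_imp_continuous_on) blast
  have vc: "continuous_on UNIV (\<lambda>t. u x - u (x - t))"
    by (intro continuous_intros continuous_on_compose2[OF uc]) auto
  define w where "w t = norm (u x - u (x - t))" for t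
  have w: "loc_int w" unfolding w_def by (intro loc_int_norm loc_int_continuous vc)
  have "norm (integral {-pi..pi} (\<lambda>t. k t *\<^sub>R (u x - u (x - t)))) \<le> integral {-pi..pi} (\<lambda>t. \<bar>k t\<bar> * w t)"
  proof (rule integral_norm_bound_integral)
    show "(\<lambda>t. k t *\<^sub>R (u x - u (x - t))) integrable_on {-pi..pi}"
      by (intro loc_int_integrable[OF loc_int_cont_scale[OF kc]] loc_int_continuous vc)
    show "(\<lambda>t. \<bar>k t\<bar> * w t) integrable_on {-pi..pi}"
      using loc_int_integrable[OF loc_int_cont_scale[OF continuous_on_rabs[OF kc] w]] by simp
  qed (simp add: w_def)
  also have "\<dots> \<le> (\<Sum>j\<le>J. 8 * C * real n * (1 / 8) ^ j * integral {-(2 ^ j / real n)..2 ^ j / real n} w)"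
    by (rule decaying_integral_bound[OF k w _ J]) (simp add: w_def)
  also have "\<dots> \<le> (\<Sum>j\<le>J. 32 * C / real n * (1 / 2) ^ j * avg (2 ^ (j + 1) / real n) G x)"
  proof (rule sum_mono)
    fix j
    define d where "d = 2 ^ j / real n"
    have d: "d > 0" using n by (simp add: d_def)
    define W where "W = integral {x - d..x + d} (\<lambda>s. norm (G s))"
    have W: "W = 2 * d * avg (2 * d) G x" using d by (simp add: W_def avg_def)
    have Gi: "(\<lambda>s. norm (G s)) integrable_on {a..b}" for a b
      by (rule loc_int_integrable[OF loc_int_norm[OF G(1)]])
    have base: "norm (u b - u a) \<le> W" if "a \<le> b" "x - d \<le> a" "b \<le> x + d" for a b
    proof -
      have "(u' has_integral (u b - u a)) {a..b}"
        using that(1) u(1) by (intro fundamental_theorem_of_calculus) (auto intro: has_vector_derivative_at_within)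
      then have "norm (u b - u a) \<le> integral {a..b} (\<lambda>s. norm (G s))"
        using integral_norm_bound_integral[OF _ Gi, of u' a b] G(2) by (auto simp: has_integral_iff)
      also have "\<dots> \<le> W" unfolding W_def using that by (intro integral_subset_le Gi) auto
      finally show ?thesis .
    qed
    have wW: "w t \<le> W" if "t \<in> {-d..d}" for t
      using base[of "x - t" x] base[of x "x - t"] that d
      by (cases "t \<ge> 0") (auto simp: w_def norm_minus_commute)
    have "integral {-d..d} w \<le> integral {-d..d} (\<lambda>_. W)"
      by (intro integral_le loc_int_integrable[OF w] wW) (auto intro: integrable_const_ivl)
    also have "\<dots> = 2 * d * W" using d by simp
    finally have "integral {-d..d} w \<le> (2 * d) * (2 * d) * avg (2 * d) G x" by (simp add: W)
    then have "8 * C * real n * (1 / 8) ^ j * integral {-d..d} w \<le> 8 * C * real n * (1 / 8) ^ j * ((2 * d) * (2 * d) * avg (2 * d) G x)"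
      using C by (intro mult_left_mono) auto
    also have "\<dots> = 32 * C / real n * (1 / 2) ^ j * avg (2 * d) G x"
    proof -
      have "(1 / 8) ^ j * (2 ^ j * 2 ^ j) = (1 / 2 :: real) ^ j" by (simp add: power_mult_distrib[symmetric])
      then show ?thesis using n by (simp add: d_def field_simps)
    qed
    finally show "8 * C * real n * (1 / 8) ^ j * integral {-(2 ^ j / real n)..2 ^ j / real n} w
        \<le> 32 * C / real n * (1 / 2) ^ j * avg (2 ^ (j + 1) / real n) G x"
      by (simp add: d_def)
  qed
  finally show ?thesis .
qed

lemma geometric_le: "0 \<le> q \<Longrightarrow> q \<le> 1 / 2 \<Longrightarrow> (\<Sum>j\<le>J. q ^ j) \<le> (2 :: real)"
proof (induction J)
  case 0 then show ?case by simp
next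
  case (Suc J)
  have "(\<Sum>j\<le>Suc J. q ^ j) = 1 + q * (\<Sum>j\<le>J. q ^ j)"
    by (subst sum.atMost_Suc_shift) (simp add: sum_distrib_left)
  also have "\<dots> \<le> 1 + (1 / 2) * 2" using Suc by (intro add_left_mono mult_mono) (auto intro: sum_nonneg)
  finally show ?case by simp
qed

lemma ex_dyadic: "\<exists>J. pi * real n \<le> 2 ^ J"
  using real_arch_pow[of 2 "pi * real n"] by (auto intro: less_imp_le)

section \<open>The symbol of the Steklov average\<close>

text \<open>The entire function \<open>(exp z - 1 - z) / z\<^sup>2\<close>. As a power series it has no exceptional value at the origin.\<close>

definition exp_rem :: "complex \<Rightarrow> complex" where
  "exp_rem z = (\<Sum>n. z ^ n / fact (n + 2))"

lemma exp_rem_sums: "(\<lambda>n. z ^ n / fact (n + 2)) sums exp_rem z"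
  unfolding exp_rem_def
proof (rule summable_sums, rule summable_comparison_test)
  show "\<exists>N. \<forall>n\<ge>N. norm (z ^ n / fact (n + 2)) \<le> norm (z ^ n /\<^sub>R fact n)"
  proof (intro exI allI impI)
    fix n
    have "(fact n :: real) \<le> fact (n + 2)" by (rule fact_mono) simp
    then have "inverse (fact (n + 2)) \<le> (inverse (fact n) :: real)"
      by (intro le_imp_inverse_le) auto
    then have "cmod z ^ n * inverse (fact (n + 2)) \<le> cmod z ^ n * inverse (fact n)"
      by (intro mult_left_mono) auto
    moreover have "norm (z ^ n / fact (n + 2)) = cmod z ^ n * inverse (fact (n + 2))"
      by (simp only: norm_divide norm_power norm_fact) (simp only: divide_inverse)
    moreover have "norm (z ^ n /\<^sub>R fact n) = cmod z ^ n * inverse (fact n)"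
      by (simp add: norm_power)
    ultimately show "norm (z ^ n / fact (n + 2)) \<le> norm (z ^ n /\<^sub>R fact n)" by (simp only:)
  qed
  show "summable (\<lambda>n. norm (z ^ n /\<^sub>R fact n))"
    by (rule summable_norm_exp)
qed

lemma exp_rem_eq: "exp z = 1 + z + z\<^sup>2 * exp_rem z"
proof -
  have "(\<lambda>n. z ^ n /\<^sub>R fact n) sums exp z" by (rule exp_converges)
  then have "(\<lambda>n. z ^ (n + 2) /\<^sub>R fact (n + 2)) sums (exp z - (\<Sum>i<2. z ^ i /\<^sub>R fact i))"
    by (subst sums_iff_shift) simp
  moreover have "(\<lambda>n. z\<^sup>2 * (z ^ n / fact (n + 2))) sums (z\<^sup>2 * exp_rem z)"
    by (intro sums_mult exp_rem_sums)
  moreover have "z ^ (n + 2) /\<^sub>R fact (n + 2) = z\<^sup>2 * (z ^ n / fact (n + 2))" for n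
    by (simp only: power_add scaleR_conv_of_real of_real_inverse of_real_fact) (simp add: field_simps)
  ultimately have "exp z - (\<Sum>i<2. z ^ i /\<^sub>R fact i) = z\<^sup>2 * exp_rem z"
    by (simp only: sums_unique2)
  moreover have "(\<Sum>i<2. z ^ i /\<^sub>R fact i) = 1 + z" by (simp add: numeral_2_eq_2)
  ultimately show ?thesis by (simp add: algebra_simps)
qed

lemma exp_rem_holomorphic: "exp_rem holomorphic_on UNIV"
proof -
  have "exp_rem field_differentiable at z" for z
  proof -
    have "exp_rem holomorphic_on ball 0 (norm z + 1)"
      by (rule power_series_holomorphic[where a="\<lambda>n. 1 / fact (n + 2)"]) (use exp_rem_sums in \<open>simp add: mult.commute\<close>)
    then show ?thesis by (rule holomorphic_on_imp_differentiable_at) auto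
  qed
  then show ?thesis by (simp add: holomorphic_on_def field_differentiable_at_within)
qed

lemma exp_rem_0: "exp_rem 0 = 1 / 2"
  using exp_rem_sums[of 0] sums_unique2[of _ "exp_rem 0" "1/2"] powser_sums_zero[of "\<lambda>n. 1 / fact (n + 2) :: complex"]
  by (simp add: mult.commute)

text \<open>\<open>exp (\<i> v) = 1 + \<i> v\<close> would force \<open>cos v = 1\<close> and \<open>sin v = v\<close>, hence \<open>v = 0\<close>, where the value is \<open>1 / 2\<close>. So the symbol of
\<open>D\<close> vanishes only at the origin and only to first order, which makes the inverse symbol below smooth.\<close>

lemma exp_rem_nonzero: "exp_rem (\<i> * of_real v) \<noteq> 0"
proof
  assume 0: "exp_rem (\<i> * of_real v) = 0"
  then have v: "v \<noteq> 0" using exp_rem_0 by auto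
  have "exp (\<i> * of_real v) = 1 + \<i> * of_real v" using exp_rem_eq[of "\<i> * of_real v"] 0 by simp
  then have "cos v = 1" "sin v = v" by (auto simp: complex_eq_iff Re_exp Im_exp)
  then show False using v sin_cos_squared_add[of v] by simp
qed

lemma exp_rem_cnj: "exp_rem (cnj z) = cnj (exp_rem z)"
proof -
  have "(\<lambda>n. cnj (z ^ n / fact (n + 2))) sums cnj (exp_rem z)"
    using exp_rem_sums[of z] by (simp only: sums_cnj)
  then have "(\<lambda>n. cnj z ^ n / fact (n + 2)) sums cnj (exp_rem z)" by simp
  with exp_rem_sums[of "cnj z"] show ?thesis by (rule sums_unique2)
qed

text \<open>This is \<open>(exp (\<i> v) - 1) / (\<i> v)\<close>, the mean of \<open>exp (\<i> v s)\<close> over \<open>s \<in> [0, 1]\<close>, written without a division.\<close>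

definition steklov_symbol :: "real \<Rightarrow> complex" where
  "steklov_symbol v = 1 + \<i> * of_real v * exp_rem (\<i> * of_real v)"

lemma cis_eq_steklov_symbol: "cis v = 1 + \<i> * of_real v * steklov_symbol v"
  using exp_rem_eq[of "\<i> * of_real v"]
  by (simp add: cis_conv_exp steklov_symbol_def algebra_simps power2_eq_square)

text \<open>This is \<open>\<i> v / (1 - a v)\<close> for the symbol \<open>a\<close> of the Steklov average: differentiation divided by \<open>D\<close>. Both vanish to first
order at the origin.\<close>

definition inv_symbol :: "real \<Rightarrow> complex" where
  "inv_symbol v = - (1 / exp_rem (\<i> * of_real v))"

lemma inv_symbol_eq: "(1 - steklov_symbol v) * inv_symbol v = \<i> * of_real v"
  using exp_rem_nonzero[of v] by (simp add: inv_symbol_def steklov_symbol_def)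

lemma inv_symbol_smooth: "smooth_upto p inv_symbol"
proof -
  have "smooth_upto p (\<lambda>v. (\<lambda>z. - (1 / exp_rem z)) (\<i> * of_real v))"
  proof (rule smooth_upto_holomorphic)
    show "open {z. exp_rem z \<noteq> 0}"
      by (rule open_Collect_neq[OF holomorphic_on_imp_continuous_on[OF exp_rem_holomorphic] continuous_on_const])
    show "(\<lambda>z. - (1 / exp_rem z)) holomorphic_on {z. exp_rem z \<noteq> 0}"
      by (intro holomorphic_intros holomorphic_on_subset[OF exp_rem_holomorphic]) auto
  qed (use exp_rem_nonzero in auto)
  then show ?thesis by (simp add: inv_symbol_def[abs_def])
qed

lemma inv_symbol_cnj: "inv_symbol (- v) = cnj (inv_symbol v)"
  using exp_rem_cnj[of "\<i> * of_real v"] by (simp add: inv_symbol_def)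

section \<open>Fourier multipliers\<close>

definition fcos :: "(real \<Rightarrow> 'a::euclidean_space) \<Rightarrow> nat \<Rightarrow> 'a" where
  "fcos f k = (if k = 0 then 1 / (2 * pi) else 1 / pi) *\<^sub>R integral {-pi..pi} (\<lambda>t. cos (real k * t) *\<^sub>R f t)"

definition fsin :: "(real \<Rightarrow> 'a::euclidean_space) \<Rightarrow> nat \<Rightarrow> 'a" where
  "fsin f k = (1 / pi) *\<^sub>R integral {-pi..pi} (\<lambda>t. sin (real k * t) *\<^sub>R f t)"

text \<open>The real part of \<open>z (A - \<i> B)\<close>. The values of the functions lie in a real or a complex space, so complex Fourier
coefficients are kept as pairs \<open>(A, B)\<close> of a cosine and a sine coefficient, on which complex numbers act by rotation.\<close>

definition re_prod :: "complex \<Rightarrow> 'a::real_vector \<Rightarrow> 'a \<Rightarrow> 'a" where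
  "re_prod z A B = Re z *\<^sub>R A + Im z *\<^sub>R B"

text \<open>The Fourier multiplier with the sequence \<open>c\<close>, for frequencies \<open>k\<close> and \<open>-k\<close> together: \<open>c (-k)\<close> is understood to be the conjugate of \<open>c k\<close>.
It is only meaningful for finitely many nonzero \<open>c k\<close>.\<close>

definition multiplier :: "(nat \<Rightarrow> complex) \<Rightarrow> (real \<Rightarrow> 'a::euclidean_space) \<Rightarrow> real \<Rightarrow> 'a" where
  "multiplier c f x = (\<Sum>k | c k \<noteq> 0. re_prod (c k * cis (real k * x)) (fcos f k) (fsin f k))"

definition finsupp :: "(nat \<Rightarrow> complex) \<Rightarrow> bool" where
  "finsupp c \<longleftrightarrow> finite {k. c k \<noteq> 0}"

lemma re_prod_zero [simp]: "re_prod 0 A B = 0" by (simp add: re_prod_def)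

lemma re_prod_diff: "re_prod (z - w) A B = re_prod z A B - re_prod w A B"
  by (simp add: re_prod_def algebra_simps)

lemma re_prod_scale: "re_prod (of_real r * z) A B = r *\<^sub>R re_prod z A B"
  by (simp add: re_prod_def algebra_simps)

lemma re_prod_rotate:
  "re_prod z (re_prod a A B) (re_prod (\<i> * a) A B) = re_prod (z * a) A B"
  by (simp add: re_prod_def algebra_simps)

lemma re_prod_cis:
  "re_prod (z * cis t) A B = cos t *\<^sub>R re_prod z A B + sin t *\<^sub>R re_prod (\<i> * z) A B"
  by (simp add: re_prod_def algebra_simps)

lemma multiplier_eq_sum:
  assumes "finite S" "{k. c k \<noteq> 0} \<subseteq> S"
  shows "multiplier c f x = (\<Sum>k\<in>S. re_prod (c k * cis (real k * x)) (fcos f k) (fsin f k))"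
  unfolding multiplier_def using assms by (intro sum.mono_neutral_left) auto

lemma finsuppI: "(\<And>k. k > n \<Longrightarrow> c k = 0) \<Longrightarrow> finsupp c"
  unfolding finsupp_def
  by (rule finite_subset[of _ "{..n}"]) (auto simp: not_less[symmetric])

lemma finsupp_mult: "finsupp c \<Longrightarrow> finsupp (\<lambda>k. a k * c k)"
  unfolding finsupp_def by (erule rev_finite_subset) auto

lemma finsupp_diff: "finsupp c \<Longrightarrow> finsupp d \<Longrightarrow> finsupp (\<lambda>k. c k - d k)"
  unfolding finsupp_def by (rule finite_subset[of _ "{k. c k \<noteq> 0} \<union> {k. d k \<noteq> 0}"]) auto

lemma multiplier_coeff_diff:
  assumes "finsupp c" "finsupp d"
  shows "multiplier (\<lambda>k. c k - d k) f x = multiplier c f x - multiplier d f x"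
proof -
  let ?S = "{k. c k \<noteq> 0} \<union> {k. d k \<noteq> 0}"
  have "finite ?S" using assms by (simp add: finsupp_def)
  then have "multiplier (\<lambda>k. c k - d k) f x = (\<Sum>k\<in>?S. re_prod ((c k - d k) * cis (real k * x)) (fcos f k) (fsin f k))"
    "multiplier c f x = (\<Sum>k\<in>?S. re_prod (c k * cis (real k * x)) (fcos f k) (fsin f k))"
    "multiplier d f x = (\<Sum>k\<in>?S. re_prod (d k * cis (real k * x)) (fcos f k) (fsin f k))"
    by (auto intro!: multiplier_eq_sum)
  then show ?thesis by (simp add: left_diff_distrib re_prod_diff sum_subtractf)
qed

lemma multiplier_coeff_scale:
  assumes "finsupp c"
  shows "multiplier (\<lambda>k. of_real r * c k) f x = r *\<^sub>R multiplier c f x"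
proof -
  have "finite {k. c k \<noteq> 0}" using assms by (simp add: finsupp_def)
  then show ?thesis
    using multiplier_eq_sum[of "{k. c k \<noteq> 0}" "\<lambda>k. of_real r * c k" f x]
    by (auto simp: multiplier_def mult.assoc re_prod_scale scaleR_sum_right)
qed

lemma trig_integrable:
  fixes f :: "real \<Rightarrow> 'a::euclidean_space"
  assumes "loc_int f"
  shows "(\<lambda>t. cos (a * t + b) *\<^sub>R f t) integrable_on {u..v}"
    "(\<lambda>t. sin (a * t + b) *\<^sub>R f t) integrable_on {u..v}"
  by (intro loc_int_integrable loc_int_cont_scale assms continuous_intros)+

lemma integral_lincomb:
  fixes F G :: "real \<Rightarrow> 'a::euclidean_space"
  assumes "F integrable_on S" "G integrable_on S"
  shows "integral S (\<lambda>t. a *\<^sub>R F t + b *\<^sub>R G t) = a *\<^sub>R integral S F + b *\<^sub>R integral S G"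
  by (intro integral_unique has_integral_add has_integral_cmul integrable_integral assms)

lemma fcos_diff: "loc_int f \<Longrightarrow> loc_int g \<Longrightarrow> fcos (\<lambda>x. f x - g x) k = fcos f k - fcos g k"
  using trig_integrable(1)[of f "real k" 0 "-pi" pi] trig_integrable(1)[of g "real k" 0 "-pi" pi]
  by (simp add: fcos_def scaleR_diff_right Henstock_Kurzweil_Integration.integral_diff)

lemma fsin_diff: "loc_int f \<Longrightarrow> loc_int g \<Longrightarrow> fsin (\<lambda>x. f x - g x) k = fsin f k - fsin g k"
  using trig_integrable(2)[of f "real k" 0 "-pi" pi] trig_integrable(2)[of g "real k" 0 "-pi" pi]
  by (simp add: fsin_def scaleR_diff_right Henstock_Kurzweil_Integration.integral_diff)

lemma multiplier_diff:
  assumes "loc_int f" "loc_int g"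
  shows "multiplier c (\<lambda>x. f x - g x) x = multiplier c f x - multiplier c g x"
  by (simp add: multiplier_def fcos_diff[OF assms] fsin_diff[OF assms] re_prod_def algebra_simps sum_subtractf[symmetric])

lemma multiplier_has_vector_derivative:
  assumes "finsupp c"
  shows "(multiplier c f has_vector_derivative multiplier (\<lambda>k. \<i> * real k * c k) f x) (at x)"
proof -
  let ?S = "{k. c k \<noteq> 0}"
  have fin: "finite ?S" using assms by (simp add: finsupp_def)
  have 1: "multiplier c f = (\<lambda>x. \<Sum>k\<in>?S. re_prod (c k * cis (real k * x)) (fcos f k) (fsin f k))"
    by (simp add: multiplier_def fun_eq_iff)
  have 2: "multiplier (\<lambda>k. \<i> * real k * c k) f x
      = (\<Sum>k\<in>?S. re_prod (\<i> * real k * c k * cis (real k * x)) (fcos f k) (fsin f k))"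
    by (rule multiplier_eq_sum[OF fin]) auto
  have t: "((\<lambda>x. re_prod (z * cis (r * x)) A B) has_vector_derivative re_prod (\<i> * of_real r * z * cis (r * x)) A B) (at x)"
    for z r and A B :: 'a
    unfolding re_prod_def
    by (auto intro!: derivative_eq_intros simp: algebra_simps has_real_derivative_iff_has_vector_derivative[symmetric])
  show ?thesis unfolding 1 2 by (intro has_vector_derivative_sum t)
qed

lemma multiplier_continuous: "finsupp c \<Longrightarrow> continuous_on UNIV (multiplier c f)"
  by (intro continuous_at_imp_continuous_on ballI has_vector_derivative_continuous)
     (rule multiplier_has_vector_derivative)

lemma cis_period: "cis (real k * (x + 2 * pi)) = cis (real k * x)"
  using cis_multiple_2pi[of "real k"] by (simp add: algebra_simps cis_mult[symmetric])

lemma multiplier_periodic: "periodic (multiplier c f)"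
  unfolding periodic_def multiplier_def by (simp add: cis_period)

lemma multiplier_trig_poly:
  fixes f :: "real \<Rightarrow> 'a::{real_normed_field, euclidean_space}"
  assumes "\<And>k. k > n \<Longrightarrow> c k = 0" shows "multiplier c f \<in> trig_polys n"
proof -
  have "multiplier c f x = (\<Sum>k\<le>n. re_prod (c k) (fcos f k) (fsin f k) * of_real (cos (real k * x))
      + re_prod (\<i> * c k) (fcos f k) (fsin f k) * of_real (sin (real k * x)))" for x
  proof -
    have "multiplier c f x = (\<Sum>k\<le>n. re_prod (c k * cis (real k * x)) (fcos f k) (fsin f k))"
      by (rule multiplier_eq_sum) (use assms in \<open>auto simp: not_less[symmetric]\<close>)
    then show ?thesis by (simp add: re_prod_cis scaleR_conv_of_real mult.commute)
  qed
  then show ?thesis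
    unfolding trig_polys_def mem_Collect_eq by (intro exI ext)
qed

text \<open>The weight \<open>2\<close> for \<open>k > 0\<close> accounts for the frequency \<open>-k\<close>. By periodicity the variable \<open>x - t\<close> can be moved from the kernel to \<open>f\<close>.\<close>

lemma multiplier_as_convolution:
  fixes f :: "real \<Rightarrow> 'a::euclidean_space"
  assumes c: "finsupp c" and f: "loc_int f" "periodic f"
  shows "multiplier c f x = (1 / (2 * pi)) *\<^sub>R integral {-pi..pi}
     (\<lambda>t. (\<Sum>k | c k \<noteq> 0. (if k = 0 then 1 else 2) * Re (c k * cis (real k * t))) *\<^sub>R f (x - t))"
proof -
  let ?S = "{k. c k \<noteq> 0}"
  define w :: "nat \<Rightarrow> real" where "w k = (if k = 0 then 1 else 2)" for k
  define K where "K t = (\<Sum>k\<in>?S. w k * Re (c k * cis (real k * t)))" for t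
  have fin: "finite ?S" using c by (simp add: finsupp_def)
  have Kc: "continuous_on UNIV K"
    unfolding K_def by (intro continuous_intros) 
  define F where "F t = K t *\<^sub>R f (x - t)" for t
  have F1: "loc_int F" unfolding F_def by (intro loc_int_cont_scale Kc loc_int_reflect f)
  have fp: "f (x - (t + 2 * pi)) = f (x - t)" for t
    using f(2)[unfolded periodic_def, rule_format, of "x - (t + 2 * pi)"] by (simp add: algebra_simps)
  have F2: "periodic F"
    by (simp add: periodic_def F_def K_def cis_period fp)
  have tm: "(w k / (2 * pi)) *\<^sub>R integral {-pi..pi} (\<lambda>t. Re (c k * cis (real k * (x - t))) *\<^sub>R f t)
     = re_prod (c k * cis (real k * x)) (fcos f k) (fsin f k)" (is "?L = ?R") for k
  proof -
    define z where "z = c k * cis (real k * x)"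
    have "Re (c k * cis (real k * (x - t))) = Re z * cos (real k * t) + Im z * sin (real k * t)" for t
      by (simp add: z_def right_diff_distrib cos_diff sin_diff algebra_simps)
    then have "integral {-pi..pi} (\<lambda>t. Re (c k * cis (real k * (x - t))) *\<^sub>R f t)
       = integral {-pi..pi} (\<lambda>t. Re z *\<^sub>R (cos (real k * t) *\<^sub>R f t) + Im z *\<^sub>R (sin (real k * t) *\<^sub>R f t))"
      by (simp add: scaleR_add_left)
    also have "\<dots> = Re z *\<^sub>R integral {-pi..pi} (\<lambda>t. cos (real k * t) *\<^sub>R f t)
        + Im z *\<^sub>R integral {-pi..pi} (\<lambda>t. sin (real k * t) *\<^sub>R f t)"
      using trig_integrable[OF f(1), of "real k" 0 "-pi" pi]
      by (intro integral_lincomb) simp_all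
    finally have e: "integral {-pi..pi} (\<lambda>t. Re (c k * cis (real k * (x - t))) *\<^sub>R f t) = \<dots>" .
    show ?thesis unfolding e z_def[symmetric] re_prod_def fcos_def fsin_def
      by (cases "k = 0") (simp_all add: w_def scaleR_add_right mult.commute)
  qed
  have "integral {-pi..pi} F = integral {-pi..pi} (\<lambda>t. F (x - t))"
    using integral_period_reflect[OF F1 F2, of x] by simp
  also have "\<dots> = integral {-pi..pi} (\<lambda>t. \<Sum>k\<in>?S. w k *\<^sub>R (Re (c k * cis (real k * (x - t))) *\<^sub>R f t))"
    by (simp add: F_def K_def scaleR_sum_left)
  also have "\<dots> = (\<Sum>k\<in>?S. w k *\<^sub>R integral {-pi..pi} (\<lambda>t. Re (c k * cis (real k * (x - t))) *\<^sub>R f t))"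
  proof (subst integral_sum[OF fin])
    show "(\<lambda>t. w k *\<^sub>R Re (c k * cis (real k * (x - t))) *\<^sub>R f t) integrable_on {-pi..pi}" for k
      by (intro integrable_cmul loc_int_integrable loc_int_cont_scale f continuous_intros)
  qed (intro sum.cong refl integral_cmul)
  finally have "(1 / (2 * pi)) *\<^sub>R integral {-pi..pi} F
      = (\<Sum>k\<in>?S. (w k / (2 * pi)) *\<^sub>R integral {-pi..pi} (\<lambda>t. Re (c k * cis (real k * (x - t))) *\<^sub>R f t))"
    by (simp add: scaleR_sum_right)
  also have "\<dots> = multiplier c f x" unfolding multiplier_def by (intro sum.cong refl tm)
  finally show ?thesis unfolding F_def K_def w_def by simp
qed

lemma steklov_symbol_integral:
  assumes h: "h > 0"
  shows "((\<lambda>s. cos (r * s)) has_integral h * Re (steklov_symbol (r * h))) {0..h}"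
    "((\<lambda>s. sin (r * s)) has_integral h * Im (steklov_symbol (r * h))) {0..h}"
proof -
  have *: "cos (r * h) = 1 - r * h * Im (steklov_symbol (r * h))" "sin (r * h) = r * h * Re (steklov_symbol (r * h))"
    using arg_cong[OF cis_eq_steklov_symbol[of "r * h"], of Re] arg_cong[OF cis_eq_steklov_symbol[of "r * h"], of Im]
    by simp_all
  show "((\<lambda>s. cos (r * s)) has_integral h * Re (steklov_symbol (r * h))) {0..h}"
  proof (cases "r = 0")
    case True
    then show ?thesis using has_integral_const_real[of "1::real" 0 h] h by (simp add: steklov_symbol_def)
  next
    case False
    have "((\<lambda>s. cos (r * s)) has_integral (sin (r * h) / r - sin (r * 0) / r)) {0..h}"
      using h False
      by (intro fundamental_theorem_of_calculus)
         (auto intro!: derivative_eq_intros simp: has_real_derivative_iff_has_vector_derivative[symmetric])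
    then show ?thesis using False * by simp
  qed
  show "((\<lambda>s. sin (r * s)) has_integral h * Im (steklov_symbol (r * h))) {0..h}"
  proof (cases "r = 0")
    case True
    then show ?thesis by (simp add: steklov_symbol_def)
  next
    case False
    have "((\<lambda>s. sin (r * s)) has_integral (- cos (r * h) / r - (- cos (r * 0) / r))) {0..h}"
      using h False
      by (intro fundamental_theorem_of_calculus)
         (auto intro!: derivative_eq_intros simp: has_real_derivative_iff_has_vector_derivative[symmetric])
    moreover have "- cos (r * h) / r - (- cos (r * 0) / r) = h * Im (steklov_symbol (r * h))"
      unfolding *(1) using False by (simp add: field_simps)
    ultimately show ?thesis by simp
  qed
qed

lemma steklov_symbol_integral_scaleR:
  fixes A B :: "'a::real_normed_vector"
  assumes h: "h > 0"
  shows "integral {0..h} (\<lambda>s. cos (r * s) *\<^sub>R A + sin (r * s) *\<^sub>R B)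
    = h *\<^sub>R re_prod (steklov_symbol (r * h)) A B"
  using has_integral_add[OF has_integral_scaleR_left[OF steklov_symbol_integral(1)[OF h, of r]]
      has_integral_scaleR_left[OF steklov_symbol_integral(2)[OF h, of r]], of A B]
  by (simp add: integral_unique re_prod_def scaleR_add_right)

lemma steklov_fwd_shift:
  fixes f :: "real \<Rightarrow> 'a::{real_normed_field, euclidean_space}"
  assumes "loc_int f"
  shows "steklov_fwd h f x = (1 / h) *\<^sub>R integral {0..h} (\<lambda>s. f (x + s))"
  using steklov_fwd_eq_integral[OF assms, of h x] integral_shift_real_ivl[where f=f and c=x and a=x and b="x+h"]
  by (simp add: add.commute)

text \<open>After the integrals are interchanged, the shift by \<open>s\<close> moves from \<open>f\<close> to the cosine, and averaging over \<open>s\<close> produces the symbol. The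
phase \<open>b\<close> covers the cosine (\<open>b = 0\<close>) and the sine (\<open>b = -\<pi>/2\<close>) coefficients at once.\<close>

lemma fourier_steklov:
  fixes f :: "real \<Rightarrow> 'a::{real_normed_field, euclidean_space}"
  assumes f: "loc_int f" "periodic f" and h: "h > 0"
  shows "integral {-pi..pi} (\<lambda>t. cos (real k * t + b) *\<^sub>R steklov_fwd h f t)
    = re_prod (steklov_symbol (real k * h)) (integral {-pi..pi} (\<lambda>t. cos (real k * t + b) *\<^sub>R f t))
        (integral {-pi..pi} (\<lambda>t. sin (real k * t + b) *\<^sub>R f t))"
proof -
  let ?C = "integral {-pi..pi} (\<lambda>t. cos (real k * t + b) *\<^sub>R f t)"
  let ?S = "integral {-pi..pi} (\<lambda>t. sin (real k * t + b) *\<^sub>R f t)"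
  have inner: "integral {-pi..pi} (\<lambda>t. cos (real k * t + b) *\<^sub>R f (t + s))
     = cos (real k * s) *\<^sub>R ?C + sin (real k * s) *\<^sub>R ?S" for s
  proof -
    define G where "G t = cos (real k * (t - s) + b) *\<^sub>R f t" for t
    have "cos (real k * (t + 2 * pi - s) + b) = cos (real k * (t - s) + b)" for t
    proof -
      have "cos (real k * (t + 2 * pi - s) + b) = cos ((real k * (t - s) + b) + 2 * pi * real k)"
        by (simp add: algebra_simps)
      moreover have "cos (2 * pi * real k) = 1" "sin (2 * pi * real k) = 0"
        using cos_2npi[of k] sin_2npi[of k] by (simp_all add: mult_ac)
      ultimately show ?thesis by (simp add: cos_add[of "real k * (t - s) + b"])
    qed
    then have "periodic G" using f(2) by (simp add: periodic_def G_def)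
    moreover have "loc_int G" unfolding G_def by (intro loc_int_cont_scale f continuous_intros)
    ultimately have "integral {-pi..pi} (\<lambda>t. cos (real k * t + b) *\<^sub>R f (t + s)) = integral {-pi..pi} G"
      using integral_period_shift[of G s] by (simp add: G_def)
    also have "\<dots> = integral {-pi..pi} (\<lambda>t. cos (real k * s) *\<^sub>R (cos (real k * t + b) *\<^sub>R f t)
         + sin (real k * s) *\<^sub>R (sin (real k * t + b) *\<^sub>R f t))"
    proof -
      have "cos (real k * (t - s) + b) = cos (real k * s) * cos (real k * t + b) + sin (real k * s) * sin (real k * t + b)" for t
        using cos_diff[of "real k * t + b" "real k * s"] by (simp add: algebra_simps)
      then show ?thesis by (simp only: G_def[abs_def] scaleR_add_left scaleR_scaleR)
    qed
    also have "\<dots> = cos (real k * s) *\<^sub>R ?C + sin (real k * s) *\<^sub>R ?S"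
      by (intro integral_lincomb trig_integrable f)
    finally show ?thesis .
  qed
  have "integral {-pi..pi} (\<lambda>t. cos (real k * t + b) *\<^sub>R steklov_fwd h f t)
     = integral {-pi..pi} (\<lambda>t. (1 / h) *\<^sub>R (cos (real k * t + b) *\<^sub>R integral {0..h} (\<lambda>s. f (t + s))))"
    by (simp add: steklov_fwd_shift[OF f(1)] mult.commute)
  also have "\<dots> = (1 / h) *\<^sub>R integral {-pi..pi} (\<lambda>t. cos (real k * t + b) *\<^sub>R integral {0..h} (\<lambda>s. f (t + s)))"
    by (rule integral_cmul)
  also have "\<dots> = (1 / h) *\<^sub>R integral {0..h} (\<lambda>s. integral {-pi..pi} (\<lambda>t. cos (real k * t + b) *\<^sub>R f (t + s)))"
  proof -
    have "continuous_on UNIV (\<lambda>t. cos (real k * t + b))" by (intro continuous_intros)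
    from integral_swap_shift[OF f(1) this] show ?thesis by simp
  qed
  also have "\<dots> = re_prod (steklov_symbol (real k * h)) ?C ?S"
    unfolding inner using h by (subst steklov_symbol_integral_scaleR) auto
  finally show ?thesis .
qed

lemma fcos_steklov:
  fixes f :: "real \<Rightarrow> 'a::{real_normed_field, euclidean_space}"
  assumes "loc_int f" "periodic f" "h > 0"
  shows "fcos (steklov_fwd h f) k = re_prod (steklov_symbol (real k * h)) (fcos f k) (fsin f k)"
  using fourier_steklov[OF assms, of k 0]
  by (cases "k = 0") (simp_all add: fcos_def fsin_def re_prod_def scaleR_add_right mult.commute)

lemma fsin_steklov:
  fixes f :: "real \<Rightarrow> 'a::{real_normed_field, euclidean_space}"
  assumes "loc_int f" "periodic f" "h > 0"
  shows "fsin (steklov_fwd h f) k = re_prod (\<i> * steklov_symbol (real k * h)) (fcos f k) (fsin f k)"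
proof -
  have "cos (real k * t + -(pi/2)) = sin (real k * t)" "sin (real k * t + -(pi/2)) = - cos (real k * t)" for t
    unfolding cos_add sin_add by simp_all
  from fourier_steklov[OF assms, of k "-(pi/2)", unfolded this]
  show ?thesis
    by (cases "k = 0") (simp_all add: fcos_def fsin_def re_prod_def scaleR_add_right scaleR_diff_right
      mult.commute steklov_symbol_def)
qed

lemma multiplier_steklov:
  fixes f :: "real \<Rightarrow> 'a::{real_normed_field, euclidean_space}"
  assumes c: "finsupp c" and f: "loc_int f" "periodic f" and h: "h > 0"
  shows "multiplier c (steklov_fwd h f) = multiplier (\<lambda>k. steklov_symbol (real k * h) * c k) f"
proof
  fix x
  have fin: "finite {k. c k \<noteq> 0}" using c by (simp add: finsupp_def)
  have "multiplier (\<lambda>k. steklov_symbol (real k * h) * c k) f x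
    = (\<Sum>k | c k \<noteq> 0. re_prod (steklov_symbol (real k * h) * c k * cis (real k * x)) (fcos f k) (fsin f k))"
    by (rule multiplier_eq_sum[OF fin]) auto
  then show "multiplier c (steklov_fwd h f) x = multiplier (\<lambda>k. steklov_symbol (real k * h) * c k) f x"
    by (simp add: multiplier_def fcos_steklov[OF f h] fsin_steklov[OF f h] re_prod_rotate mult_ac)
qed

lemma steklov_multiplier:
  fixes f :: "real \<Rightarrow> 'a::{real_normed_field, euclidean_space}"
  assumes c: "finsupp c" and h: "h > 0"
  shows "steklov_fwd h (multiplier c f) = multiplier (\<lambda>k. steklov_symbol (real k * h) * c k) f"
proof
  fix x
  have fin: "finite {k. c k \<noteq> 0}" using c by (simp add: finsupp_def)
  define z where "z k = c k * cis (real k * x)" for k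
  define P where "P k = re_prod (z k) (fcos f k) (fsin f k)" for k
  define Q where "Q k = re_prod (\<i> * z k) (fcos f k) (fsin f k)" for k
  have e: "multiplier c f (x + s) = (\<Sum>k | c k \<noteq> 0. cos (real k * s) *\<^sub>R P k + sin (real k * s) *\<^sub>R Q k)" for s
    by (simp add: multiplier_def P_def Q_def z_def re_prod_cis[symmetric] distrib_left cis_mult[symmetric] mult.assoc)
  have "integral {0..h} (\<lambda>s. multiplier c f (x + s))
     = (\<Sum>k | c k \<noteq> 0. integral {0..h} (\<lambda>s. cos (real k * s) *\<^sub>R P k + sin (real k * s) *\<^sub>R Q k))"
    unfolding e by (rule integral_sum[OF fin]) (intro integrable_continuous_real continuous_intros)
  also have "\<dots> = (\<Sum>k | c k \<noteq> 0. h *\<^sub>R re_prod (steklov_symbol (real k * h)) (P k) (Q k))"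
    by (simp only: steklov_symbol_integral_scaleR[OF h])
  also have "\<dots> = (\<Sum>k | c k \<noteq> 0. h *\<^sub>R re_prod (steklov_symbol (real k * h) * c k * cis (real k * x)) (fcos f k) (fsin f k))"
    by (simp add: P_def Q_def re_prod_rotate z_def mult.assoc)
  also have "\<dots> = h *\<^sub>R (\<Sum>k | c k \<noteq> 0. re_prod (steklov_symbol (real k * h) * c k * cis (real k * x)) (fcos f k) (fsin f k))"
    by (simp add: scaleR_sum_right)
  also have "(\<Sum>k | c k \<noteq> 0. re_prod (steklov_symbol (real k * h) * c k * cis (real k * x)) (fcos f k) (fsin f k))
     = multiplier (\<lambda>k. steklov_symbol (real k * h) * c k) f x"
    by (rule multiplier_eq_sum[OF fin, symmetric]) auto
  finally show "steklov_fwd h (multiplier c f) x = multiplier (\<lambda>k. steklov_symbol (real k * h) * c k) f x"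
    using h by (simp add: steklov_fwd_shift loc_int_continuous multiplier_continuous c)
qed

lemma integral_cos_int:
  fixes m :: int
  shows "((\<lambda>t. cos (of_int m * t)) has_integral (if m = 0 then 2 * pi else 0)) {-pi..pi}"
proof (cases "m = 0")
  case True
  then show ?thesis using has_integral_const_real[of "1::real" "-pi" pi] by simp
next
  case False
  have "((\<lambda>t. cos (of_int m * t)) has_integral (sin (of_int m * pi) / m - sin (of_int m * (-pi)) / m)) {-pi..pi}"
    using False
    by (intro fundamental_theorem_of_calculus)
       (auto intro!: derivative_eq_intros simp: has_real_derivative_iff_has_vector_derivative[symmetric])
  then show ?thesis using False by (simp add: mult.commute)
qed

lemma integral_sin_int:
  fixes m :: int
  shows "((\<lambda>t. sin (of_int m * t)) has_integral 0) {-pi..pi}"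
proof (cases "m = 0")
  case False
  have "((\<lambda>t. sin (of_int m * t)) has_integral (- cos (of_int m * pi) / m - (- cos (of_int m * (-pi)) / m))) {-pi..pi}"
    using False
    by (intro fundamental_theorem_of_calculus)
       (auto intro!: derivative_eq_intros simp: has_real_derivative_iff_has_vector_derivative[symmetric])
  then show ?thesis by simp
qed simp

lemma trig_orthogonality:
  fixes j k :: nat
  shows "((\<lambda>t. cos (real j * t) * cos (real k * t)) has_integral (if j = k then if j = 0 then 2 * pi else pi else 0)) {-pi..pi}"
    "((\<lambda>t. sin (real j * t) * sin (real k * t)) has_integral (if j = k then if j = 0 then 0 else pi else 0)) {-pi..pi}"
    "((\<lambda>t. cos (real j * t) * sin (real k * t)) has_integral 0) {-pi..pi}"
proof -
  let ?m = "int j - int k" and ?p = "int j + int k"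
  have e: "of_int ?m * t = real j * t - real k * t" "of_int ?p * t = real j * t + real k * t" for t
    by (simp_all add: algebra_simps)
  have "((\<lambda>t. (1/2) * (cos (of_int ?m * t) + cos (of_int ?p * t))) has_integral
      (1/2) * ((if ?m = 0 then 2 * pi else 0) + (if ?p = 0 then 2 * pi else 0))) {-pi..pi}"
    by (intro has_integral_mult_right has_integral_add integral_cos_int)
  moreover have "(1/2) * (cos (of_int ?m * t) + cos (of_int ?p * t)) = cos (real j * t) * cos (real k * t)" for t
    unfolding e by (simp add: cos_diff cos_add)
  ultimately show "((\<lambda>t. cos (real j * t) * cos (real k * t)) has_integral (if j = k then if j = 0 then 2 * pi else pi else 0)) {-pi..pi}"
    by (cases "j = k"; cases "j = 0") (auto simp del: of_int_diff of_int_add)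
  have "((\<lambda>t. (1/2) * (cos (of_int ?m * t) - cos (of_int ?p * t))) has_integral
      (1/2) * ((if ?m = 0 then 2 * pi else 0) - (if ?p = 0 then 2 * pi else 0))) {-pi..pi}"
    by (intro has_integral_mult_right has_integral_diff integral_cos_int)
  moreover have "(1/2) * (cos (of_int ?m * t) - cos (of_int ?p * t)) = sin (real j * t) * sin (real k * t)" for t
    unfolding e by (simp add: cos_diff cos_add)
  ultimately show "((\<lambda>t. sin (real j * t) * sin (real k * t)) has_integral (if j = k then if j = 0 then 0 else pi else 0)) {-pi..pi}"
    by (cases "j = k"; cases "j = 0") (auto simp del: of_int_diff of_int_add)
  have "((\<lambda>t. (1/2) * (sin (of_int ?p * t) - sin (of_int ?m * t))) has_integral (1/2) * (0 - 0)) {-pi..pi}"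
    by (intro has_integral_mult_right has_integral_diff integral_sin_int)
  moreover have "(1/2) * (sin (of_int ?p * t) - sin (of_int ?m * t)) = cos (real j * t) * sin (real k * t)" for t
    unfolding e by (simp add: sin_diff sin_add)
  ultimately show "((\<lambda>t. cos (real j * t) * sin (real k * t)) has_integral 0) {-pi..pi}"
    by (simp del: of_int_diff of_int_add)
qed

lemma fourier_multiplier:
  assumes d: "finsupp d"
  shows "fcos (multiplier d f) j = re_prod (d j) (fcos f j) (fsin f j)"
    and "Im (d 0) = 0 \<Longrightarrow> fsin (multiplier d f) j = re_prod (\<i> * d j) (fcos f j) (fsin f j)"
proof -
  define P where "P k = re_prod (d k) (fcos f k) (fsin f k)" for k
  define Q where "Q k = re_prod (\<i> * d k) (fcos f k) (fsin f k)" for k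
  let ?S = "insert j {k. d k \<noteq> 0}"
  have fin: "finite ?S" using d by (simp add: finsupp_def)
  have e: "multiplier d f t = (\<Sum>k\<in>?S. cos (real k * t) *\<^sub>R P k + sin (real k * t) *\<^sub>R Q k)" for t
    unfolding P_def Q_def re_prod_cis[symmetric] by (rule multiplier_eq_sum[OF fin]) auto
  have "((\<lambda>t. \<Sum>k\<in>?S. (cos (real j * t) * cos (real k * t)) *\<^sub>R P k + (cos (real j * t) * sin (real k * t)) *\<^sub>R Q k)
     has_integral (\<Sum>k\<in>?S. (if j = k then if j = 0 then 2 * pi else pi else 0) *\<^sub>R P k + 0 *\<^sub>R Q k)) {-pi..pi}"
    by (intro has_integral_sum fin has_integral_add has_integral_scaleR_left trig_orthogonality)
  moreover have "(\<Sum>k\<in>?S. (if j = k then if j = 0 then 2 * pi else pi else 0) *\<^sub>R P k + 0 *\<^sub>R Q k)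
     = (\<Sum>k\<in>?S. if k = j then (if j = 0 then 2 * pi else pi) *\<^sub>R P j else 0)"
    by (rule sum.cong) auto
  moreover have "\<dots> = (if j = 0 then 2 * pi else pi) *\<^sub>R P j"
    using fin by (subst sum.delta) auto
  ultimately have 1: "integral {-pi..pi} (\<lambda>t. cos (real j * t) *\<^sub>R multiplier d f t) = (if j = 0 then 2 * pi else pi) *\<^sub>R P j"
    by (simp add: e scaleR_sum_right scaleR_add_right integral_unique)
  show "fcos (multiplier d f) j = re_prod (d j) (fcos f j) (fsin f j)"
    unfolding fcos_def[of "multiplier d f"] 1 P_def[symmetric] by simp
  have "((\<lambda>t. \<Sum>k\<in>?S. (cos (real k * t) * sin (real j * t)) *\<^sub>R P k + (sin (real j * t) * sin (real k * t)) *\<^sub>R Q k)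
     has_integral (\<Sum>k\<in>?S. 0 *\<^sub>R P k + (if j = k then if j = 0 then 0 else pi else 0) *\<^sub>R Q k)) {-pi..pi}"
    by (intro has_integral_sum fin has_integral_add has_integral_scaleR_left trig_orthogonality)
  moreover have "(\<Sum>k\<in>?S. 0 *\<^sub>R P k + (if j = k then if j = 0 then 0 else pi else 0) *\<^sub>R Q k)
     = (\<Sum>k\<in>?S. if k = j then (if j = 0 then 0 else pi) *\<^sub>R Q j else 0)"
    by (rule sum.cong) auto
  moreover have "\<dots> = (if j = 0 then 0 else pi) *\<^sub>R Q j"
    using fin by (subst sum.delta) auto
  ultimately have 2: "integral {-pi..pi} (\<lambda>t. sin (real j * t) *\<^sub>R multiplier d f t) = (if j = 0 then 0 else pi) *\<^sub>R Q j"
    by (simp add: e scaleR_sum_right scaleR_add_right integral_unique mult.commute)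
  show "fsin (multiplier d f) j = re_prod (\<i> * d j) (fcos f j) (fsin f j)" if "Im (d 0) = 0"
  proof (cases "j = 0")
    case True
    have "fsin f 0 = 0" by (simp add: fsin_def)
    then show ?thesis using True that unfolding fsin_def[of "multiplier d f"] 2 by (simp add: re_prod_def)
  next
    case False
    then show ?thesis unfolding fsin_def[of "multiplier d f"] 2 Q_def[symmetric] by simp
  qed
qed

text \<open>The coefficient \<open>d 0\<close> has to be real because frequency \<open>0\<close> has no sine part: an imaginary part of \<open>d 0\<close> is lost by the inner operator
but would count in the product \<open>c 0 * d 0\<close>.\<close>

lemma multiplier_multiplier:
  assumes c: "finsupp c" and d: "finsupp d" "Im (d 0) = 0"
  shows "multiplier c (multiplier d f) = multiplier (\<lambda>k. c k * d k) f"
proof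
  fix x
  have fin: "finite {k. c k \<noteq> 0}" using c by (simp add: finsupp_def)
  have "multiplier (\<lambda>k. c k * d k) f x
    = (\<Sum>k | c k \<noteq> 0. re_prod (c k * d k * cis (real k * x)) (fcos f k) (fsin f k))"
    by (rule multiplier_eq_sum[OF fin]) auto
  then show "multiplier c (multiplier d f) x = multiplier (\<lambda>k. c k * d k) f x"
    by (simp add: multiplier_def fourier_multiplier[OF d(1)] d(2) re_prod_rotate mult_ac)
qed

text \<open>The condition \<open>g (- u) = cnj (g u)\<close> says that the multiplier with the two-sided sequence \<open>g (k / n)\<close> has a real kernel.\<close>

definition symbol :: "(real \<Rightarrow> complex) \<Rightarrow> bool" where
  "symbol g \<longleftrightarrow> smooth_upto 3 g \<and> (\<exists>R::nat. \<forall>u. \<bar>u\<bar> > real R \<longrightarrow> g u = 0) \<and> (\<forall>u. g (- u) = cnj (g u))"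

definition sample :: "(real \<Rightarrow> complex) \<Rightarrow> nat \<Rightarrow> nat \<Rightarrow> complex" where
  "sample g n k = g (real k / real n)"

lemma finsupp_sample:
  assumes "symbol g" "n \<ge> 1" shows "finsupp (sample g n)"
proof -
  obtain R :: nat where R: "\<And>u. \<bar>u\<bar> > real R \<Longrightarrow> g u = 0" using assms(1) by (auto simp: symbol_def)
  show ?thesis
  proof (rule finsuppI[of "R * n"])
    fix k assume "k > R * n"
    then have "real k > real R * real n" by (metis of_nat_less_iff of_nat_mult)
    then have "\<bar>real k / real n\<bar> > real R" using assms(2) by (simp add: field_simps)
    then show "sample g n k = 0" using R by (simp add: sample_def)
  qed
qed

definition trig_kernel :: "(nat \<Rightarrow> complex) \<Rightarrow> real \<Rightarrow> real" where
  "trig_kernel c t = (\<Sum>k | c k \<noteq> 0. (if k = 0 then 1 else 2) * Re (c k * cis (real k * t)))"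

lemma trig_kernel_two_sided:
  fixes c :: "int \<Rightarrow> complex"
  assumes "\<And>k. c (- k) = cnj (c k)" and "\<And>k. k > int m \<Longrightarrow> c k = 0"
  shows "trig_kernel (\<lambda>k. c (int k)) t = Re (\<Sum>k=-int m..int m. c k * cis t powi k)"
proof -
  define F where "F k = c k * cis t powi k" for k :: int
  have Fn: "Re (F (- k)) = Re (F k)" for k
  proof -
    have "F (- k) = cnj (F k)"
      by (simp add: F_def assms(1) cis_power_int cis_cnj[symmetric] del: cis_cnj)
    then show ?thesis by simp
  qed
  have set: "{-int m..int m} = {-int m..-1} \<union> ({0} \<union> {1..int m})" by auto
  have "Re (\<Sum>k=-int m..int m. F k) = (\<Sum>k=-int m..-1. Re (F k)) + (Re (F 0) + (\<Sum>k=1..int m. Re (F k)))"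
    unfolding set by (subst sum.union_disjoint; (subst sum.union_disjoint)?; auto)
  also have "(\<Sum>k=-int m..-1. Re (F k)) = (\<Sum>k=1..int m. Re (F k))"
    by (rule sum.reindex_bij_witness[of _ uminus uminus]) (auto simp: Fn)
  also have "(\<Sum>k=1..int m. Re (F k)) = (\<Sum>k=1..m. Re (F (int k)))"
    by (rule sum.reindex_bij_witness[of _ int nat]) auto
  finally have 1: "Re (\<Sum>k=-int m..int m. F k) = Re (F 0) + 2 * (\<Sum>k=1..m. Re (F (int k)))" by simp
  have "trig_kernel (\<lambda>k. c (int k)) t = (\<Sum>k\<le>m. (if k = 0 then 1 else 2) * Re (c (int k) * cis (real k * t)))"
    unfolding trig_kernel_def by (rule sum.mono_neutral_left) (use assms(2) in \<open>auto simp: not_less[symmetric]\<close>)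
  also have "\<dots> = (\<Sum>k\<le>m. (if k = 0 then 1 else 2) * Re (F (int k)))"
    by (simp only: F_def cis_power_int of_int_of_nat_eq)
  also have "\<dots> = Re (F 0) + (\<Sum>k=1..m. 2 * Re (F (int k)))"
  proof -
    have "{..m} = insert 0 {1..m}" by auto
    then show ?thesis by simp
  qed
  finally show ?thesis using 1 by (simp add: F_def sum_distrib_left)
qed

lemma trig_kernel_decaying:
  assumes "symbol g"
  shows "\<exists>C. \<forall>n\<ge>1. decaying C n (trig_kernel (sample g n))"
proof -
  obtain R :: nat where R: "\<And>u. \<bar>u\<bar> > real R \<Longrightarrow> g u = 0" using assms(1) by (auto simp: symbol_def)
  have g: "smooth_upto 3 g" "\<And>u. g (- u) = cnj (g u)" using assms by (auto simp: symbol_def)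
  have "\<exists>C\<ge>0. \<forall>n\<ge>1. \<forall>t. \<bar>t\<bar> \<le> pi \<longrightarrow>
    (let K = norm (\<Sum>k=-int (R * n)..int (R * n). g (of_int k / real n) * cis t powi k)
     in K \<le> C * real n \<and> K * (real n * \<bar>t\<bar>) ^ 3 \<le> C * real n)"
    by (rule multiplier_kernel_decay[OF g(1)]) (rule R)
  then obtain C where C: "C \<ge> 0" and b: "\<forall>n\<ge>1. \<forall>t. \<bar>t\<bar> \<le> pi \<longrightarrow>
    (let K = norm (\<Sum>k=-int (R * n)..int (R * n). g (of_int k / real n) * cis t powi k)
     in K \<le> C * real n \<and> K * (real n * \<bar>t\<bar>) ^ 3 \<le> C * real n)" by (elim exE conjE)
  have "decaying C n (trig_kernel (sample g n))" if n: "n \<ge> 1" for n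
    unfolding decaying_def
  proof (intro conjI allI impI)
    show "continuous_on UNIV (trig_kernel (sample g n))"
      unfolding trig_kernel_def by (intro continuous_intros)
    fix t :: real assume t: "\<bar>t\<bar> \<le> pi"
    define K where "K = norm (\<Sum>k=-int (R * n)..int (R * n). g (of_int k / real n) * cis t powi k)"
    have K: "K \<le> C * real n" "K * (real n * \<bar>t\<bar>) ^ 3 \<le> C * real n"
      using b[rule_format, OF n t] by (simp_all add: Let_def K_def)
    have "trig_kernel (\<lambda>k. g (of_int (int k) / real n)) t = Re (\<Sum>k=-int (R * n)..int (R * n). g (of_int k / real n) * cis t powi k)"
    proof (rule trig_kernel_two_sided)
      show "g (of_int (- k) / real n) = cnj (g (of_int k / real n))" for k
        using g(2)[of "of_int k / real n"] by simp
      fix k assume "k > int (R * n)"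
      then have "real_of_int k > real R * real n" by (metis of_int_less_iff of_int_of_nat_eq of_nat_mult)
      then have "\<bar>of_int k / real n\<bar> > real R" using n by (simp add: field_simps)
      then show "g (of_int k / real n) = 0" by (rule R)
    qed
    then have le: "\<bar>trig_kernel (sample g n) t\<bar> \<le> K"
      unfolding K_def using abs_Re_le_cmod by (simp only: sample_def[abs_def] of_int_of_nat_eq)
    show "\<bar>trig_kernel (sample g n) t\<bar> \<le> C * real n" using le K(1) by linarith
    show "\<bar>trig_kernel (sample g n) t\<bar> * (real n * \<bar>t\<bar>) ^ 3 \<le> C * real n"
      using mult_right_mono[OF le, of "(real n * \<bar>t\<bar>) ^ 3"] K(2) by simp
  qed (use C n in auto)
  then show ?thesis by blast
qed

lemma multiplier_kernel:
  fixes f :: "real \<Rightarrow> 'a::euclidean_space"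
  assumes "finsupp c" "loc_int f" "periodic f"
  shows "multiplier c f x = (1 / (2 * pi)) *\<^sub>R integral {-pi..pi} (\<lambda>t. trig_kernel c t *\<^sub>R f (x - t))"
  using multiplier_as_convolution[OF assms] by (simp add: trig_kernel_def)

text \<open>Apply the convolution formula to the constant function \<open>1\<close>, whose only nonzero coefficient is that of frequency \<open>0\<close>.\<close>

lemma integral_trig_kernel:
  assumes "finsupp c"
  shows "integral {-pi..pi} (trig_kernel c) = 2 * pi * Re (c 0)"
proof -
  have fc: "fcos (\<lambda>_. 1 :: real) k = (if k = 0 then 1 else 0)" for k
    using integral_unique[OF trig_orthogonality(1)[of k 0]] by (simp add: fcos_def)
  have fs: "fsin (\<lambda>_. 1 :: real) k = 0" for k
    using integral_unique[OF trig_orthogonality(3)[of 0 k]] by (simp add: fsin_def)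
  have "multiplier c (\<lambda>_. 1 :: real) 0 = (1 / (2 * pi)) *\<^sub>R integral {-pi..pi} (\<lambda>t. trig_kernel c t *\<^sub>R (1 :: real))"
    by (rule multiplier_kernel[OF assms]) (auto simp: periodic_def intro: loc_int_continuous)
  moreover have "multiplier c (\<lambda>_. 1 :: real) 0 = Re (c 0)"
  proof -
    have fin: "finite (insert 0 {k. c k \<noteq> 0})" using assms by (simp add: finsupp_def)
    have "multiplier c (\<lambda>_. 1 :: real) 0 = (\<Sum>k\<in>insert 0 {k. c k \<noteq> 0}. if k = 0 then Re (c 0) else 0)"
    proof -
      have "multiplier c (\<lambda>_. 1 :: real) 0 = (\<Sum>k\<in>insert 0 {k. c k \<noteq> 0}.
          re_prod (c k * cis (real k * 0)) (fcos (\<lambda>_. 1 :: real) k) (fsin (\<lambda>_. 1 :: real) k))"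
        by (rule multiplier_eq_sum[OF fin]) auto
      also have "\<dots> = (\<Sum>k\<in>insert 0 {k. c k \<noteq> 0}. if k = 0 then Re (c 0) else 0)"
        by (rule sum.cong) (simp_all add: fc fs re_prod_def)
      finally show ?thesis .
    qed
    also have "\<dots> = Re (c 0)" by (subst sum.delta[OF fin]) (rule if_P, rule insertI1)
    finally show ?thesis .
  qed
  ultimately show ?thesis by simp
qed

lemma approximation_error:
  fixes u :: "real \<Rightarrow> 'a::euclidean_space"
  assumes c: "finsupp c" "Re (c 0) = 1" and u: "loc_int u" "periodic u"
  shows "u x - multiplier c u x = (1 / (2 * pi)) *\<^sub>R integral {-pi..pi} (\<lambda>t. trig_kernel c t *\<^sub>R (u x - u (x - t)))"
proof -
  have kc: "continuous_on UNIV (trig_kernel c)"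
    unfolding trig_kernel_def by (intro continuous_intros)
  have "integral {-pi..pi} (\<lambda>t. trig_kernel c t *\<^sub>R (u x - u (x - t)))
      = integral {-pi..pi} (\<lambda>t. trig_kernel c t *\<^sub>R u x) - integral {-pi..pi} (\<lambda>t. trig_kernel c t *\<^sub>R u (x - t))"
    unfolding scaleR_diff_right
    by (rule Henstock_Kurzweil_Integration.integral_diff[OF
          loc_int_integrable[OF loc_int_cont_scale[OF kc loc_int_continuous[OF continuous_on_const]]]
          loc_int_integrable[OF loc_int_cont_scale[OF kc loc_int_reflect[OF u(1)]]]])
  also have "integral {-pi..pi} (\<lambda>t. trig_kernel c t *\<^sub>R u x) = (2 * pi) *\<^sub>R u x"
    using has_integral_scaleR_left[OF integrable_integral, of "trig_kernel c" "{-pi..pi}" "u x"]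
      loc_int_integrable[OF loc_int_continuous[OF kc]] integral_trig_kernel[OF c(1)] c(2)
    by (auto intro: integral_unique)
  finally show ?thesis by (simp add: multiplier_kernel[OF c(1) u] scaleR_diff_right)
qed

section \<open>Banach lattices on which the averages are bounded\<close>

lemma periodic_int:
  assumes "periodic f" shows "f (x + 2 * pi * of_int m) = f x"
proof -
  have nat: "f (y + 2 * pi * real k) = f y" for y k
  proof (induction k)
    case (Suc k)
    then show ?case
      using assms[unfolded periodic_def, rule_format, of "y + 2 * pi * real k"]
      by (simp add: algebra_simps)
  qed simp
  show ?thesis
  proof (cases "m \<ge> 0")
    case True
    then show ?thesis using nat[of x "nat m"] by simp
  next
    case False
    then have "real (nat (- m)) = - real_of_int m" by simp
    then show ?thesis using nat[of "x + 2 * pi * of_int m" "nat (- m)"] by simp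
  qed
qed

lemma reduce_to_period: "x - 2 * pi * of_int \<lfloor>(x + pi) / (2 * pi)\<rfloor> \<in> {-pi..<pi}"
proof -
  let ?m = "\<lfloor>(x + pi) / (2 * pi)\<rfloor>"
  have "of_int ?m \<le> (x + pi) / (2 * pi)" "(x + pi) / (2 * pi) < of_int ?m + 1" by linarith+
  then have "of_int ?m * (2 * pi) \<le> x + pi" "x + pi < (of_int ?m + 1) * (2 * pi)"
    by (simp_all only: le_divide_eq divide_less_eq) simp_all
  then show ?thesis by (simp add: algebra_simps)
qed

lemma circle_functions_periodic: "f \<in> circle_functions \<Longrightarrow> periodic f"
  by (simp add: circle_functions_def periodic_def)

lemma continuous_periodic_circle:
  fixes f :: "real \<Rightarrow> 'a::{real_normed_field, euclidean_space}"
  assumes "continuous_on UNIV f" "periodic f" shows "f \<in> circle_functions"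
  using assms by (simp add: circle_functions_def periodic_def measurable_completion borel_measurable_continuous_onI)

text \<open>Translates by multiples of \<open>2\<pi>\<close> of the given interval are glued together symmetrically until they cover \<open>[a, b]\<close>.\<close>

lemma loc_int_from_period:
  fixes f :: "real \<Rightarrow> 'a::euclidean_space"
  assumes p: "periodic f" and f: "f absolutely_integrable_on {-pi..pi}"
  shows "loc_int f"
proof -
  have sh: "f absolutely_integrable_on {2 * pi * of_int m - pi..2 * pi * of_int m + pi}" for m :: int
  proof -
    have "integrable lebesgue (\<lambda>x. indicator {-pi..pi} (- (2 * pi * of_int m) + 1 * x) *\<^sub>R f (- (2 * pi * of_int m) + 1 * x))"
      using f unfolding set_integrable_def by (intro lebesgue_integrable_real_affine[where c=1]) auto
    moreover have "f (- (2 * pi * of_int m) + 1 * x) = f x" for x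
      using periodic_int[OF p, of x "-m"] by (simp add: algebra_simps)
    moreover have "indicator {-pi..pi} (- (2 * pi * of_int m) + 1 * x) = (indicator {2 * pi * of_int m - pi..2 * pi * of_int m + pi} x :: real)" for x
      by (auto simp: indicator_def)
    ultimately show ?thesis unfolding set_integrable_def by simp
  qed
  have big: "f absolutely_integrable_on {-(2 * pi * real k + pi)..2 * pi * real k + pi}" for k
  proof (induction k)
    case 0 then show ?case using f by simp
  next
    case (Suc k)
    have "f absolutely_integrable_on {-(2 * pi * real k + pi)..2 * pi * real (Suc k) + pi}"
      by (rule absolutely_integrable_on_combine[OF Suc]) (use sh[of "int (Suc k)"] in \<open>auto simp: algebra_simps\<close>)
    then show ?case
      by (rule absolutely_integrable_on_combine[rotated]) (use sh[of "- int (Suc k)"] in \<open>auto simp: algebra_simps\<close>)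
  qed
  show ?thesis unfolding loc_int_def
  proof (intro allI)
    fix a b :: real
    obtain k :: nat where k: "max \<bar>a\<bar> \<bar>b\<bar> \<le> real k" using real_arch_simple by blast
    have "real k \<le> 2 * pi * real k + pi"
      using mult_right_mono[of 1 "2 * pi" "real k"] pi_gt3 by linarith
    then have "\<bar>a\<bar> \<le> 2 * pi * real k + pi" "\<bar>b\<bar> \<le> 2 * pi * real k + pi" using k by linarith+
    then have "{a..b} \<subseteq> {-(2 * pi * real k + pi)..2 * pi * real k + pi}" by (auto simp: abs_le_iff)
    then show "f absolutely_integrable_on {a..b}"
      by (intro set_integrable_subset[OF big[of k]]) auto
  qed
qed

text \<open>With the base point \<open>x - 2\<close>, moving averages near \<open>x\<close> become differences of one indefinite integral, whose continuity and
differentiability are known.\<close>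

lemma moving_integral_local:
  fixes f :: "real \<Rightarrow> 'a::euclidean_space"
  assumes f: "loc_int f" and h: "h > 0" and y: "y > x - 1"
  shows "integral {y..y + h} f = integral {x - 2..y + h} f - integral {x - 2..y} f"
proof -
  have "integral {x - 2..y} f + integral {y..y + h} f = integral {x - 2..y + h} f"
    using h y by (intro Henstock_Kurzweil_Integration.integral_combine loc_int_integrable f) auto
  then show ?thesis by (simp add: algebra_simps)
qed

lemma steklov_fwd_continuous:
  fixes f :: "real \<Rightarrow> 'a::{real_normed_field, euclidean_space}"
  assumes f: "loc_int f" and h: "h > 0"
  shows "continuous_on UNIV (steklov_fwd h f)"
proof (intro continuous_at_imp_continuous_on ballI)
  fix x
  have c: "continuous_on {x - 2..x + h + 2} (\<lambda>y. integral {x - 2..y} f)"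
    by (rule indefinite_integral_continuous_1[OF loc_int_integrable[OF f]])
  have c1: "continuous_on {x - 1<..<x + 1} (\<lambda>y. integral {x - 2..y + h} f)"
    using h by (intro continuous_on_compose2[OF c] continuous_intros) auto
  have c2: "continuous_on {x - 1<..<x + 1} (\<lambda>y. integral {x - 2..y} f)"
    using h by (intro continuous_on_subset[OF c]) auto
  have "continuous_on {x - 1<..<x + 1} (\<lambda>y. (1 / h) *\<^sub>R (integral {x - 2..y + h} f - integral {x - 2..y} f))"
    by (intro continuous_intros c1 c2)
  then have "continuous_on {x - 1<..<x + 1} (steklov_fwd h f)"
    by (rule continuous_on_eq) (simp add: steklov_fwd_eq_integral[OF f] moving_integral_local[OF f h, of x])
  then show "isCont (steklov_fwd h f) x"
    by (rule continuous_on_interior) (simp add: interior_open)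
qed

lemma steklov_fwd_has_derivative:
  fixes f :: "real \<Rightarrow> 'a::{real_normed_field, euclidean_space}"
  assumes f: "continuous_on UNIV f" and h: "h > 0"
  shows "(steklov_fwd h f has_vector_derivative (1 / h) *\<^sub>R (f (x + h) - f x)) (at x)"
proof -
  have fl: "loc_int f" using f by (rule loc_int_continuous)
  have d: "((\<lambda>y. integral {x - 2..y} f) has_vector_derivative f y) (at y)" if "x - 2 < y" "y < x + h + 2" for y
  proof -
    have "((\<lambda>y. integral {x - 2..y} f) has_vector_derivative f y) (at y within {x - 2..x + h + 2})"
      using that by (intro integral_has_vector_derivative continuous_on_subset[OF f]) auto
    then show ?thesis using that by (simp add: at_within_Icc_at)
  qed
  have "((\<lambda>y. y + h) has_vector_derivative 1) (at x)"
    by (auto intro!: derivative_eq_intros simp: has_real_derivative_iff_has_vector_derivative[symmetric])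
  then have d1: "((\<lambda>y. integral {x - 2..y + h} f) has_vector_derivative f (x + h)) (at x)"
    using vector_diff_chain_at[of "\<lambda>y. y + h" 1 x "\<lambda>y. integral {x - 2..y} f" "f (x + h)"] d[of "x + h"] h
    by (simp add: o_def)
  have "((\<lambda>y. (1 / h) *\<^sub>R (integral {x - 2..y + h} f - integral {x - 2..y} f)) has_vector_derivative (1 / h) *\<^sub>R (f (x + h) - f x)) (at x)"
    using h by (intro has_vector_derivative_diff d1 d bounded_linear.has_vector_derivative[OF bounded_linear_scaleR_right]) auto
  then show ?thesis
    by (rule has_vector_derivative_transform_within_open[where S="{x - 1<..<x + 1}"])
       (auto simp: steklov_fwd_eq_integral[OF fl] moving_integral_local[OF fl h, of x])
qed

lemma steklov_fwd_periodic:
  fixes f :: "real \<Rightarrow> 'a::{real_normed_field, euclidean_space}"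
  assumes "loc_int f" "periodic f" shows "periodic (steklov_fwd h f)"
  unfolding periodic_def
proof
  fix x
  have "f (x + 2 * pi + s) = f (x + s)" for s
    using assms(2)[unfolded periodic_def, rule_format, of "x + s"] by (simp add: ac_simps)
  then show "steklov_fwd h f (x + 2 * pi) = steklov_fwd h f x"
    by (simp add: steklov_fwd_shift[OF assms(1)])
qed

text \<open>A one-sided interval lies in a symmetric one of twice the length; this is why the forward average is bounded on \<open>X\<close> too.\<close>

lemma norm_moving_integral_le_avg:
  fixes f :: "real \<Rightarrow> 'a::euclidean_space"
  assumes f: "loc_int f" and d: "d > 0"
  shows "integral {x..x + d} (\<lambda>t. norm (f t)) \<le> 2 * d * avg (2 * d) f x"
proof -
  have "integral {x..x + d} (\<lambda>t. norm (f t)) \<le> integral {x - d..x + d} (\<lambda>t. norm (f t))"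
    using d by (intro integral_subset_le loc_int_integrable loc_int_norm f) auto
  then show ?thesis using d by (simp add: avg_def)
qed

lemma norm_steklov_fwd_le:
  fixes f :: "real \<Rightarrow> 'a::{real_normed_field, euclidean_space}"
  assumes f: "loc_int f" and h: "h > 0"
  shows "norm (steklov_fwd h f x) \<le> (1 / h) * integral {x..x + h} (\<lambda>t. norm (f t))"
  unfolding steklov_fwd_eq_integral[OF f] norm_scaleR
  using h by (auto intro!: divide_right_mono integral_norm_bound_integral loc_int_integrable loc_int_norm f)

lemma steklov_fwd_diff:
  fixes f g :: "real \<Rightarrow> 'a::{real_normed_field, euclidean_space}"
  assumes "loc_int f" "loc_int g"
  shows "steklov_fwd h (\<lambda>x. f x - g x) x = steklov_fwd h f x - steklov_fwd h g x"
  by (simp add: steklov_fwd_eq_integral assms loc_int_diff loc_int_integrable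
      Henstock_Kurzweil_Integration.integral_diff scaleR_diff_right)

lemma multiplier_in_circle_functions:
  "finsupp c \<Longrightarrow> multiplier c (f :: real \<Rightarrow> 'a::{real_normed_field, euclidean_space}) \<in> circle_functions"
  by (intro continuous_periodic_circle multiplier_continuous multiplier_periodic)

context banach_lattice begin

lemma X_circle: "f \<in> X \<Longrightarrow> f \<in> circle_functions" using X_subset by blast

lemma X_periodic: "f \<in> X \<Longrightarrow> periodic f" by (intro circle_functions_periodic X_circle)

lemma X_uminus: "f \<in> X \<Longrightarrow> (\<lambda>x. - f x) \<in> X" using X_scale[of f "-1"] by simp

lemma X_diff: "f \<in> X \<Longrightarrow> g \<in> X \<Longrightarrow> (\<lambda>x. f x - g x) \<in> X"
  using X_add[OF _ X_uminus, of f g] by simp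

lemma X_scaleR: "f \<in> X \<Longrightarrow> (\<lambda>x. r *\<^sub>R f x) \<in> X"
  using X_scale[of f "of_real r"] by (simp add: scaleR_conv_of_real)

lemma N_scaleR: "f \<in> X \<Longrightarrow> N (\<lambda>x. r *\<^sub>R f x) = \<bar>r\<bar> * N f"
  using N_scale[of f "of_real r"] by (simp add: scaleR_conv_of_real)

lemma N_uminus: "f \<in> X \<Longrightarrow> N (\<lambda>x. - f x) = N f" using N_scale[of f "-1"] by simp

lemma N_zero: "f \<in> X \<Longrightarrow> N (\<lambda>_. 0) = 0" using N_scale[of f 0] by simp

lemma N_nonneg: "f \<in> X \<Longrightarrow> 0 \<le> N f"
  using N_triangle[OF _ X_uminus, of f f] N_zero[of f] N_uminus[of f] by simp

lemma N_diff: "f \<in> X \<Longrightarrow> g \<in> X \<Longrightarrow> N (\<lambda>x. f x - g x) \<le> N f + N g"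
  using N_triangle[OF _ X_uminus, of f g] N_uminus[of g] by simp

lemma X_majorized:
  assumes "f \<in> circle_functions" "g \<in> X" "\<And>x. norm (f x) \<le> norm (g x)"
  shows "f \<in> X" "N f \<le> N g"
  using lattice_ideal[OF assms(1,2)] assms(3) by auto

lemma one_in_X: "(\<lambda>_. 1) \<in> X"
proof -
  have "emeasure circle {-pi..<pi} = 1"
    unfolding circle_def by (rule emeasure_uniform_measure_1) auto
  then have "periodize (indicator {-pi..<pi}) \<in> X" by (intro indicator_in_X) auto
  moreover have "periodize (indicator {-pi..<pi}) = (\<lambda>_. 1 :: 'a)"
    using reduce_to_period by (auto simp: periodize_def fun_eq_iff)
  ultimately show ?thesis by simp
qed

lemma zero_in_X: "(\<lambda>_. 0) \<in> X" using X_scale[OF one_in_X, of 0] by simp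

lemma continuous_in_X:
  assumes "continuous_on UNIV f" "periodic f" shows "f \<in> X"
proof -
  have "compact (f ` {-pi..pi})" by (intro compact_continuous_image continuous_on_subset[OF assms(1)]) auto
  then obtain B where B: "B > 0" "\<And>x. x \<in> {-pi..pi} \<Longrightarrow> norm (f x) \<le> B"
    using compact_imp_bounded bounded_pos by (metis imageI)
  have "norm (f x) \<le> norm (of_real B * (1 :: 'a))" for x
  proof -
    have "f (x - 2 * pi * of_int \<lfloor>(x + pi) / (2 * pi)\<rfloor>) = f x"
      using periodic_int[OF assms(2), of x "- \<lfloor>(x + pi) / (2 * pi)\<rfloor>"] by simp
    moreover have "norm (f (x - 2 * pi * of_int \<lfloor>(x + pi) / (2 * pi)\<rfloor>)) \<le> B"
      using reduce_to_period[of x] by (intro B(2)) auto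
    ultimately show ?thesis using B(1) by simp
  qed
  then show ?thesis
    using X_majorized(1)[OF continuous_periodic_circle[OF assms] X_scale[OF one_in_X, of "of_real B"]] by simp
qed

text \<open>The weight bound for a whole period says that elements of \<open>X\<close> are integrable over it.\<close>

lemma X_loc_int: assumes "f \<in> X" shows "loc_int f"
proof (rule loc_int_from_period[OF X_periodic[OF assms]])
  let ?E = "{-pi..<pi}"
  have fm [measurable]: "f \<in> borel_measurable lebesgue" using X_circle[OF assms] by (simp add: circle_functions_def)
  have "emeasure circle ?E = 1"
    unfolding circle_def by (rule emeasure_uniform_measure_1) auto
  then obtain c where c: "\<forall>f\<in>X. (\<integral>\<^sup>+x\<in>?E. ennreal (norm (f x)) \<partial>circle) \<le> ennreal (c * N f)"
    using weight_bound[of ?E] by auto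
  have "(\<integral>\<^sup>+x\<in>?E. ennreal (norm (f x)) \<partial>circle)
     = (\<integral>\<^sup>+x. ennreal (norm (f x)) * indicator ?E x * indicator ?E x \<partial>lebesgue) / emeasure lebesgue ?E"
    unfolding circle_def
  proof (rule nn_integral_uniform_measure)
    have [measurable]: "?E \<in> sets lebesgue" by simp
    show "(\<lambda>x. ennreal (norm (f x)) * indicator ?E x) \<in> borel_measurable lebesgue" by measurable
  qed auto
  also have "(\<integral>\<^sup>+x. ennreal (norm (f x)) * indicator ?E x * indicator ?E x \<partial>lebesgue)
     = (\<integral>\<^sup>+x. ennreal (norm (indicator ?E x *\<^sub>R f x)) \<partial>lebesgue)" (is "_ = ?I")
    by (rule nn_integral_cong) (auto simp: indicator_def)
  finally have e: "(\<integral>\<^sup>+x\<in>?E. ennreal (norm (f x)) \<partial>circle) = ?I / emeasure lebesgue ?E" .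
  have "?I / emeasure lebesgue ?E \<le> ennreal (c * N f)" using bspec[OF c assms] by (simp only: e)
  then have "?I / emeasure lebesgue ?E < \<infinity>" by (auto intro: le_less_trans)
  moreover have "a < \<infinity>" if "a / b < \<infinity>" "b \<noteq> \<infinity>" for a b :: ennreal
    using that by (cases "a = top"; cases "b = top") (auto simp: ennreal_top_divide less_top)
  moreover have "emeasure lebesgue ?E \<noteq> \<infinity>" by simp
  ultimately have "?I < \<infinity>" by blast
  moreover have "(\<lambda>x. indicator ?E x *\<^sub>R f x) \<in> borel_measurable lebesgue"
    by (intro borel_measurable_scaleR borel_measurable_indicator fm) simp
  ultimately have "f absolutely_integrable_on ?E" unfolding set_integrable_def by (intro integrableI_bounded)
  then have "f absolutely_integrable_on {-pi<..<pi}" by (rule set_integrable_subset) auto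
  then show "f absolutely_integrable_on {-pi..pi}" by (simp add: absolutely_integrable_on_Icc_iff_Ioo)
qed

end

locale steklov_lattice = banach_lattice X N
  for X :: "(real \<Rightarrow> 'a::{real_normed_field, euclidean_space}) set" and N :: "(real \<Rightarrow> 'a) \<Rightarrow> real" +
  assumes averages_bounded: "steklov_bounded X N"
begin

lemma steklov_in_X: "f \<in> X \<Longrightarrow> h > 0 \<Longrightarrow> steklov h f \<in> X"
  using averages_bounded by (simp add: steklov_bounded_def)

text \<open>The supremum over the unit ball gives the bound by homogeneity. If \<open>N f = 0\<close>, all multiples of \<open>f\<close> are in the unit ball, which
forces \<open>N (steklov h f) = 0\<close>.\<close>

lemma ex_steklov_bound: "\<exists>A\<ge>0. \<forall>f\<in>X. \<forall>h>0. N (steklov h f) \<le> A * N f"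
proof -
  obtain A where A: "\<And>f h. f \<in> X \<Longrightarrow> h > 0 \<Longrightarrow> N f \<le> 1 \<Longrightarrow> N (steklov h f) \<le> A"
  proof -
    from averages_bounded obtain M where M: "\<forall>y\<in>{N (steklov h f) | h f. h > 0 \<and> f \<in> X \<and> N f \<le> 1}. y \<le> M"
      unfolding steklov_bounded_def bdd_above_def by blast
    show thesis by (rule that[of M]) (use M in blast)
  qed
  have A0: "A \<ge> 0"
    using A[OF zero_in_X, of 1] N_zero[OF zero_in_X] N_nonneg[OF steklov_in_X[OF zero_in_X, of 1]] by simp
  have sc: "N (steklov h (\<lambda>x. r *\<^sub>R f x)) = \<bar>r\<bar> * N (steklov h f)" if "f \<in> X" "h > 0" for f h r
  proof -
    have "steklov h (\<lambda>x. r *\<^sub>R f x) = (\<lambda>x. r *\<^sub>R steklov h f x)"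
      by (rule ext) (simp add: steklov_def mult.commute)
    then show ?thesis using N_scaleR[OF steklov_in_X[OF that]] by simp
  qed
  have "N (steklov h f) \<le> A * N f" if f: "f \<in> X" and h: "h > 0" for f h
  proof (cases "N f = 0")
    case True
    have le: "r * N (steklov h f) \<le> A" if "r > 0" for r
      using A[OF X_scaleR[OF f] h, of r] sc[OF f h, of r] N_scaleR[OF f, of r] True that by simp
    have "N (steklov h f) \<le> 0"
    proof (rule ccontr)
      assume "\<not> N (steklov h f) \<le> 0"
      then show False using le[of "(A + 1) / N (steklov h f)"] A0 by simp
    qed
    then show ?thesis using True by simp
  next
    case False
    then have p: "N f > 0" using N_nonneg[OF f] by simp
    have "(1 / N f) * N (steklov h f) \<le> A"
      using A[OF X_scaleR[OF f] h, of "1 / N f"] sc[OF f h, of "1 / N f"] N_scaleR[OF f, of "1 / N f"] p by simp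
    then show ?thesis using p by (simp add: field_simps)
  qed
  then show ?thesis using A0 by blast
qed

definition steklov_const :: real where
  "steklov_const = (SOME A. A \<ge> 0 \<and> (\<forall>f\<in>X. \<forall>h>0. N (steklov h f) \<le> A * N f))"

lemma steklov_const: "steklov_const \<ge> 0" "f \<in> X \<Longrightarrow> h > 0 \<Longrightarrow> N (steklov h f) \<le> steklov_const * N f"
  using someI_ex[OF ex_steklov_bound] unfolding steklov_const_def by blast+

lemma X_norm: assumes "f \<in> X"
  shows "(\<lambda>x. of_real (norm (f x)) :: 'a) \<in> X" "N (\<lambda>x. of_real (norm (f x)) :: 'a) \<le> N f"
proof -
  have "(\<lambda>x. of_real (norm (f x)) :: 'a) \<in> circle_functions"
    using X_circle[OF assms] unfolding circle_functions_def by auto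
  from X_majorized[OF this assms] show "(\<lambda>x. of_real (norm (f x)) :: 'a) \<in> X" "N (\<lambda>x. of_real (norm (f x)) :: 'a) \<le> N f"
    by auto
qed

lemma steklov_norm_eq_avg:
  assumes "f \<in> X"
  shows "steklov h (\<lambda>x. of_real (norm (f x)) :: 'a) = (\<lambda>x. of_real (avg h f x))"
proof
  fix x
  have "integral {x - h/2..x + h/2} (\<lambda>t. of_real (norm (f t)) :: 'a) = of_real (integral {x - h/2..x + h/2} (\<lambda>t. norm (f t)))"
    using integral_linear[OF loc_int_integrable[OF loc_int_norm[OF X_loc_int[OF assms]]] bounded_linear_of_real]
    by (simp add: o_def)
  then show "steklov h (\<lambda>x. of_real (norm (f x)) :: 'a) x = of_real (avg h f x)"
    by (simp add: steklov_eq_integral[OF X_loc_int[OF X_norm(1)[OF assms]]] avg_def scaleR_conv_of_real)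
qed

lemma avg_in_X:
  assumes "f \<in> X" "h > 0"
  shows "(\<lambda>x. of_real (avg h f x) :: 'a) \<in> X" "N (\<lambda>x. of_real (avg h f x) :: 'a) \<le> steklov_const * N f"
proof -
  show "(\<lambda>x. of_real (avg h f x) :: 'a) \<in> X"
    using steklov_in_X[OF X_norm(1)[OF assms(1)] assms(2)] by (simp add: steklov_norm_eq_avg assms)
  have "N (\<lambda>x. of_real (avg h f x) :: 'a) \<le> steklov_const * N (\<lambda>x. of_real (norm (f x)) :: 'a)"
    using steklov_const(2)[OF X_norm(1)[OF assms(1)] assms(2)] by (simp add: steklov_norm_eq_avg assms)
  also have "\<dots> \<le> steklov_const * N f" by (intro mult_left_mono X_norm assms steklov_const)
  finally show "N (\<lambda>x. of_real (avg h f x) :: 'a) \<le> steklov_const * N f" .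
qed

lemma sum_avg_in_X:
  fixes J :: nat
  assumes F: "F \<in> X" and w: "\<And>j. w j \<ge> 0" and h: "\<And>j. h j > 0"
  shows "(\<lambda>x. of_real (\<Sum>j\<le>J. w j * avg (h j) F x) :: 'a) \<in> X
    \<and> N (\<lambda>x. of_real (\<Sum>j\<le>J. w j * avg (h j) F x) :: 'a) \<le> (\<Sum>j\<le>J. w j) * (steklov_const * N F)"
proof (induction J)
  case 0
  have "N (\<lambda>x. w 0 *\<^sub>R (of_real (avg (h 0) F x) :: 'a)) \<le> w 0 * (steklov_const * N F)"
    using N_scaleR[OF avg_in_X(1)[OF F h], of "w 0" 0] w[of 0] avg_in_X(2)[OF F h, of 0] by (simp add: mult_left_mono)
  then show ?case using X_scaleR[OF avg_in_X(1)[OF F h], of "w 0" 0] by (simp add: scaleR_conv_of_real)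
next
  case (Suc J)
  let ?f = "\<lambda>x. of_real (\<Sum>j\<le>J. w j * avg (h j) F x) :: 'a"
  let ?g = "\<lambda>x. w (Suc J) *\<^sub>R (of_real (avg (h (Suc J)) F x) :: 'a)"
  have g: "?g \<in> X" by (intro X_scaleR avg_in_X F h)
  have "N ?g \<le> w (Suc J) * (steklov_const * N F)"
    using N_scaleR[OF avg_in_X(1)[OF F h], of "w (Suc J)" "Suc J"] w[of "Suc J"] avg_in_X(2)[OF F h, of "Suc J"]
    by (simp add: mult_left_mono)
  then have "N (\<lambda>x. ?f x + ?g x) \<le> (\<Sum>j\<le>Suc J. w j) * (steklov_const * N F)"
    using N_triangle[of ?f ?g] g Suc by (simp add: distrib_right)
  moreover have "(\<lambda>x. ?f x + ?g x) \<in> X" using Suc g by (intro X_add) auto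
  ultimately show ?case by (simp add: scaleR_conv_of_real)
qed

text \<open>The link between kernels and the lattice: pointwise domination passes to norms, and each average costs the same constant.\<close>

lemma dominated_by_averages:
  fixes J :: nat
  assumes f: "f \<in> circle_functions" and F: "F \<in> X" and w: "\<And>j. w j \<ge> 0" and h: "\<And>j. h j > 0"
    and le: "\<And>x. norm (f x) \<le> (\<Sum>j\<le>J. w j * avg (h j) F x)"
  shows "f \<in> X" "N f \<le> (\<Sum>j\<le>J. w j) * (steklov_const * N F)"
proof -
  note S = sum_avg_in_X[where w=w and h=h and J=J, OF F w h]
  have "norm (f x) \<le> norm (of_real (\<Sum>j\<le>J. w j * avg (h j) F x) :: 'a)" for x
    unfolding norm_of_real by (rule order_trans[OF le abs_ge_self])
  from X_majorized[OF f conjunct1[OF S] this] S show "f \<in> X" "N f \<le> (\<Sum>j\<le>J. w j) * (steklov_const * N F)"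
    by auto
qed

lemma multiplier_bounded:
  assumes g: "symbol g"
  shows "\<exists>C\<ge>0. \<forall>n\<ge>1. \<forall>f\<in>X. multiplier (sample g n) f \<in> X \<and> N (multiplier (sample g n) f) \<le> C * N f"
proof -
  obtain C where C: "\<And>n. n \<ge> 1 \<Longrightarrow> decaying C n (trig_kernel (sample g n))"
    using trig_kernel_decaying[OF g] by blast
  have C0: "C \<ge> 0" using C[of 1] by (simp add: decaying_def)
  have "multiplier (sample g n) f \<in> X \<and> N (multiplier (sample g n) f) \<le> 32 * C * steklov_const * N f"
    if n: "n \<ge> 1" and f: "f \<in> X" for n f
  proof -
    obtain J where J: "pi * real n \<le> 2 ^ J" using ex_dyadic by blast
    have fl: "loc_int f" "periodic f" using f by (simp_all add: X_loc_int X_periodic)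
    have fs: "finsupp (sample g n)" by (rule finsupp_sample[OF g n])
    have le: "norm (multiplier (sample g n) f x) \<le> (\<Sum>j\<le>J. 16 * C * (1 / 4) ^ j * avg (2 ^ (j + 1) / real n) f x)" for x
    proof -
      have "norm (multiplier (sample g n) f x) = (1 / (2 * pi)) * norm (integral {-pi..pi} (\<lambda>t. trig_kernel (sample g n) t *\<^sub>R f (x - t)))"
        by (simp add: multiplier_kernel[OF fs fl])
      also have "\<dots> \<le> 1 * norm (integral {-pi..pi} (\<lambda>t. trig_kernel (sample g n) t *\<^sub>R f (x - t)))"
        using pi_gt3 by (intro mult_right_mono) auto
      also have "\<dots> \<le> (\<Sum>j\<le>J. 16 * C * (1 / 4) ^ j * avg (2 ^ (j + 1) / real n) f x)"
        using decaying_convolution_bound[OF C[OF n] fl(1) J] by simp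
      finally show ?thesis .
    qed
    note d = dominated_by_averages[OF multiplier_in_circle_functions[OF fs] f _ _ le]
    have "(\<Sum>j\<le>J. 16 * C * (1 / 4) ^ j) = 16 * C * (\<Sum>j\<le>J. (1 / 4) ^ j)" by (simp add: sum_distrib_left)
    also have "\<dots> \<le> 16 * C * 2" using C0 by (intro mult_left_mono geometric_le) auto
    finally have "(\<Sum>j\<le>J. 16 * C * (1 / 4) ^ j) * (steklov_const * N f) \<le> 16 * C * 2 * (steklov_const * N f)"
      by (intro mult_right_mono mult_nonneg_nonneg steklov_const N_nonneg f)
    moreover have "multiplier (sample g n) f \<in> X" by (rule d(1)) (use C0 n in auto)
    moreover have "N (multiplier (sample g n) f) \<le> (\<Sum>j\<le>J. 16 * C * (1 / 4) ^ j) * (steklov_const * N f)"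
      by (rule d(2)) (use C0 n in auto)
    ultimately show ?thesis by (simp add: mult_ac)
  qed
  moreover have "32 * C * steklov_const \<ge> 0" using C0 steklov_const by simp
  ultimately show ?thesis by blast
qed

text \<open>As \<open>Re (g 0) = 1\<close>, the kernel has mean \<open>1\<close>, so the error is an average of differences \<open>u x - u (x - t)\<close>. The majorant \<open>G\<close> of the derivative is
kept separate from \<open>u'\<close>, since for functions smoothed by averages the natural bound on the derivative is again an average.\<close>

lemma multiplier_approximation:
  assumes g: "symbol g" "Re (g 0) = 1"
  shows "\<exists>C\<ge>0. \<forall>n\<ge>1. \<forall>u u' G. (\<forall>y. (u has_vector_derivative u' y) (at y)) \<longrightarrow> continuous_on UNIV u' \<longrightarrow>
     periodic u \<longrightarrow> G \<in> X \<longrightarrow> (\<forall>y. norm (u' y) \<le> norm (G y)) \<longrightarrow>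
     N (\<lambda>x. u x - multiplier (sample g n) u x) \<le> C / real n * N G"
proof -
  obtain C where C: "\<And>n. n \<ge> 1 \<Longrightarrow> decaying C n (trig_kernel (sample g n))"
    using trig_kernel_decaying[OF g(1)] by blast
  have C0: "C \<ge> 0" using C[of 1] by (simp add: decaying_def)
  have "N (\<lambda>x. u x - multiplier (sample g n) u x) \<le> 64 * C * steklov_const / real n * N G"
    if n: "n \<ge> 1" and u: "\<And>y. (u has_vector_derivative u' y) (at y)" "continuous_on UNIV u'" "periodic u"
      and G: "G \<in> X" "\<And>y. norm (u' y) \<le> norm (G y)" for n u u' G
  proof -
    obtain J where J: "pi * real n \<le> 2 ^ J" using ex_dyadic by blast
    have uc: "continuous_on UNIV u"
      using u(1) has_vector_derivative_continuous by (intro continuous_at_imp_continuous_on) blast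
    have fs: "finsupp (sample g n)" by (rule finsupp_sample[OF g(1) n])
    have g0: "Re (sample g n 0) = 1" using g(2) by (simp add: sample_def)
    have le: "norm (u x - multiplier (sample g n) u x) \<le> (\<Sum>j\<le>J. 32 * C / real n * (1 / 2) ^ j * avg (2 ^ (j + 1) / real n) G x)" for x
    proof -
      have "norm (u x - multiplier (sample g n) u x) = (1 / (2 * pi)) * norm (integral {-pi..pi} (\<lambda>t. trig_kernel (sample g n) t *\<^sub>R (u x - u (x - t))))"
        by (simp add: approximation_error[OF fs g0 loc_int_continuous[OF uc] u(3)])
      also have "\<dots> \<le> 1 * norm (integral {-pi..pi} (\<lambda>t. trig_kernel (sample g n) t *\<^sub>R (u x - u (x - t))))"
        using pi_gt3 by (intro mult_right_mono) auto
      also have "\<dots> \<le> (\<Sum>j\<le>J. 32 * C / real n * (1 / 2) ^ j * avg (2 ^ (j + 1) / real n) G x)"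
        using decaying_approximation_bound[OF C[OF n] J u(1,2) X_loc_int[OF G(1)] G(2)] by simp
      finally show ?thesis .
    qed
    have circ: "(\<lambda>x. u x - multiplier (sample g n) u x) \<in> circle_functions"
      using multiplier_periodic[of "sample g n" u] u(3)
      by (intro continuous_periodic_circle continuous_intros uc multiplier_continuous fs) (simp add: periodic_def)
    note d = dominated_by_averages(2)[OF circ G(1) _ _ le]
    have "(\<Sum>j\<le>J. 32 * C / real n * (1 / 2) ^ j) = 32 * C / real n * (\<Sum>j\<le>J. (1 / 2) ^ j)" by (simp add: sum_distrib_left)
    also have "\<dots> \<le> 32 * C / real n * 2" using C0 by (intro mult_left_mono geometric_le) auto
    finally have "(\<Sum>j\<le>J. 32 * C / real n * (1 / 2) ^ j) * (steklov_const * N G) \<le> 32 * C / real n * 2 * (steklov_const * N G)"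
      by (intro mult_right_mono mult_nonneg_nonneg steklov_const N_nonneg G)
    moreover have "N (\<lambda>x. u x - multiplier (sample g n) u x) \<le> (\<Sum>j\<le>J. 32 * C / real n * (1 / 2) ^ j) * (steklov_const * N G)"
      by (rule d) (use C0 n in auto)
    ultimately show ?thesis by (simp add: mult_ac)
  qed
  moreover have "64 * C * steklov_const \<ge> 0" using C0 steklov_const by simp
  ultimately show ?thesis by blast
qed

lemma steklov_fwd_in_X:
  assumes "f \<in> X" "h > 0"
  shows "steklov_fwd h f \<in> X" "N (steklov_fwd h f) \<le> 2 * steklov_const * N f"
proof -
  have fl: "loc_int f" "periodic f" using assms by (simp_all add: X_loc_int X_periodic)
  have circ: "steklov_fwd h f \<in> circle_functions"
    by (intro continuous_periodic_circle steklov_fwd_continuous steklov_fwd_periodic fl assms)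
  have le: "norm (steklov_fwd h f x) \<le> (\<Sum>j\<le>(0::nat). 2 * avg (2 * h) f x)" for x
  proof -
    have "norm (steklov_fwd h f x) \<le> (1 / h) * integral {x..x + h} (\<lambda>t. norm (f t))"
      by (rule norm_steklov_fwd_le[OF fl(1) assms(2)])
    also have "\<dots> \<le> (1 / h) * (2 * h * avg (2 * h) f x)"
      using assms(2) by (intro mult_left_mono norm_moving_integral_le_avg fl) auto
    finally show ?thesis using assms(2) by simp
  qed
  from dominated_by_averages[where w="\<lambda>_. 2" and h="\<lambda>_::nat. 2 * h" and J=0, OF circ assms(1) _ _ le] assms(2)
  show "steklov_fwd h f \<in> X" "N (steklov_fwd h f) \<le> 2 * steklov_const * N f" by auto
qed

text \<open>The derivative of \<open>U\<^sup>2 f\<close> is a difference of two values of \<open>U f\<close> at distance \<open>h\<close>. Both are averages over intervals of length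
comparable to their distance from \<open>x\<close>, so a symmetric average of \<open>\<bar>f\<bar>\<close> dominates them. For \<open>U f\<close> itself the derivative
contains a translate of \<open>f\<close>, which the norm of \<open>X\<close> does not control.\<close>

lemma second_steklov_derivative_bound:
  assumes f: "f \<in> X" and h: "h > 0"
  shows "norm ((1 / h) *\<^sub>R (steklov_fwd h f (x + h) - steklov_fwd h f x)) \<le> norm (of_real (4 / h * avg (4 * h) f x) :: 'a)"
proof -
  have fl: "loc_int f" using f by (simp add: X_loc_int)
  have "norm (steklov_fwd h f (x + h) - steklov_fwd h f x)
     \<le> (1 / h) * integral {x + h..x + h + h} (\<lambda>t. norm (f t)) + (1 / h) * integral {x..x + h} (\<lambda>t. norm (f t))"
    by (intro norm_triangle_le_diff add_mono norm_steklov_fwd_le fl h)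
  also have "\<dots> = (1 / h) * integral {x..x + 2 * h} (\<lambda>t. norm (f t))"
  proof -
    have "integral {x..x + h} (\<lambda>t. norm (f t)) + integral {x + h..x + 2 * h} (\<lambda>t. norm (f t)) = integral {x..x + 2 * h} (\<lambda>t. norm (f t))"
      using h by (intro Henstock_Kurzweil_Integration.integral_combine loc_int_integrable loc_int_norm fl) auto
    moreover have "x + h + h = x + 2 * h" by simp
    ultimately show ?thesis by (simp only: distrib_left[symmetric] add.commute)
  qed
  also have "\<dots> \<le> (1 / h) * (2 * (2 * h) * avg (2 * (2 * h)) f x)"
    using h by (intro mult_left_mono norm_moving_integral_le_avg fl) auto
  also have "\<dots> = 4 * avg (4 * h) f x" using h by simp
  finally have "(1 / h) * norm (steklov_fwd h f (x + h) - steklov_fwd h f x) \<le> (1 / h) * (4 * avg (4 * h) f x)"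
    using h by (intro mult_left_mono) auto
  also have "\<dots> \<le> norm (of_real (4 / h * avg (4 * h) f x) :: 'a)"
    unfolding norm_of_real by (rule order_trans[OF _ abs_ge_self]) simp
  finally show ?thesis using h by simp
qed

end

section \<open>Low, middle and high frequencies\<close>

definition steklov_diff :: "real \<Rightarrow> (real \<Rightarrow> 'a::{real_normed_field, euclidean_space}) \<Rightarrow> real \<Rightarrow> 'a" where
  "steklov_diff h f = (\<lambda>x. f x - steklov_fwd h f x)"

lemma multiplier_steklov_diff:
  fixes f :: "real \<Rightarrow> 'a::{real_normed_field, euclidean_space}"
  assumes c: "finsupp c" and f: "loc_int f" "periodic f" and h: "h > 0"
  shows "multiplier c (steklov_diff h f) = multiplier (\<lambda>k. (1 - steklov_symbol (real k * h)) * c k) f"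
proof
  fix x
  have "multiplier c (steklov_diff h f) x = multiplier c f x - multiplier c (steklov_fwd h f) x"
    unfolding steklov_diff_def
    by (intro multiplier_diff f loc_int_continuous steklov_fwd_continuous h)
  also have "\<dots> = multiplier (\<lambda>k. c k - steklov_symbol (real k * h) * c k) f x"
    unfolding multiplier_steklov[OF c f h] by (rule multiplier_coeff_diff[symmetric, OF c finsupp_mult[OF c]])
  finally show "multiplier c (steklov_diff h f) x = multiplier (\<lambda>k. (1 - steklov_symbol (real k * h)) * c k) f x"
    by (simp add: left_diff_distrib)
qed

lemma vderiv_multiplier:
  fixes f :: "real \<Rightarrow> 'a::{real_normed_field, euclidean_space}"
  assumes "finsupp c"
  shows "(vderiv ^^ s) (multiplier c f) = multiplier (\<lambda>k. (\<i> * of_nat k) ^ s * c k) f"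
proof (induction s)
  case (Suc s)
  have "vderiv (multiplier (\<lambda>k. (\<i> * of_nat k) ^ s * c k) f) x = multiplier (\<lambda>k. \<i> * real k * ((\<i> * of_nat k) ^ s * c k)) f x" for x
    unfolding vderiv_def by (intro vector_derivative_at multiplier_has_vector_derivative finsupp_mult assms)
  then show ?case by (simp add: Suc.IH fun_eq_iff mult_ac)
qed simp

lemma symbol_cutoff:
  assumes "c > 0" and \<psi>: "smooth_upto 3 \<psi>" "\<And>u. \<psi> (- u) = cnj (\<psi> u)"
  shows "symbol (\<lambda>u. of_real (cutoff (c * u)) * \<psi> u)"
  unfolding symbol_def
proof (intro conjI)
  show "smooth_upto 3 (\<lambda>u. of_real (cutoff (c * u)) * \<psi> u)"
    by (intro smooth_upto_mult \<psi> smooth_upto_of_real smooth_upto_scale cutoff_smooth)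
  obtain R :: nat where R: "1 / c \<le> real R" using real_arch_simple by blast
  have "cutoff (c * u) = 0" if "\<bar>u\<bar> > real R" for u
  proof (rule cutoff_eq_0)
    have "1 / c \<le> \<bar>u\<bar>" using R that by linarith
    then show "1 \<le> \<bar>c * u\<bar>" using assms(1) by (simp add: abs_mult field_simps)
  qed
  then show "\<exists>R. \<forall>u. real R < \<bar>u\<bar> \<longrightarrow> of_real (cutoff (c * u)) * \<psi> u = 0" by (auto intro!: exI[of _ R])
  show "\<forall>u. of_real (cutoff (c * - u)) * \<psi> (- u) = cnj (of_real (cutoff (c * u)) * \<psi> u)"
    using cutoff_even[of "c * u" for u] by (simp add: \<psi>(2))
qed

abbreviation cut :: "nat \<Rightarrow> nat \<Rightarrow> complex" where
  "cut n \<equiv> sample (\<lambda>u. of_real (cutoff u)) n"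

lemma symbol_cut: "symbol (\<lambda>u. of_real (cutoff u))"
  using symbol_cutoff[of 1 "\<lambda>_. 1"] by (simp add: smooth_upto_const)

lemma symbol_half_cut: "symbol (\<lambda>u. of_real (cutoff (2 * u)))"
  using symbol_cutoff[of 2 "\<lambda>_. 1"] by (simp add: smooth_upto_const)

text \<open>The cutoff at half the scale is supported where the full one equals \<open>1\<close>: \<open>V\<^sub>m\<close> reproduces every function with frequencies up to \<open>m / 2\<close>.\<close>

lemma half_cut_absorbs: "of_real (cutoff (2 * u)) * of_real (cutoff u) = (of_real (cutoff (2 * u)) :: complex)"
proof (cases "\<bar>u\<bar> \<le> 1 / 2")
  case True then show ?thesis by (simp add: cutoff_eq_1)
next
  case False then show ?thesis by (simp add: cutoff_eq_0 abs_mult)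
qed

context steklov_lattice begin

lemma steklov_diff_in_X: "f \<in> X \<Longrightarrow> h > 0 \<Longrightarrow> steklov_diff h f \<in> X"
  unfolding steklov_diff_def by (intro X_diff steklov_fwd_in_X)

lemma steklov_diff_pow_in_X: "f \<in> X \<Longrightarrow> h > 0 \<Longrightarrow> (steklov_diff h ^^ s) f \<in> X"
  by (induction s) (auto intro: steklov_diff_in_X)

lemma multiplier_in_X: "finsupp c \<Longrightarrow> multiplier c f \<in> X"
  by (intro continuous_in_X multiplier_continuous multiplier_periodic)

lemma multiplier_steklov_diff_pow:
  assumes c: "finsupp c" and f: "f \<in> X" and h: "h > 0"
  shows "multiplier c ((steklov_diff h ^^ s) f) = multiplier (\<lambda>k. (1 - steklov_symbol (real k * h)) ^ s * c k) f"
  using c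
proof (induction s arbitrary: c)
  case (Suc s)
  have X: "(steklov_diff h ^^ s) f \<in> X" by (rule steklov_diff_pow_in_X[OF f h])
  have "multiplier c ((steklov_diff h ^^ Suc s) f)
     = multiplier (\<lambda>k. (1 - steklov_symbol (real k * h)) * c k) ((steklov_diff h ^^ s) f)"
    using multiplier_steklov_diff[OF Suc.prems X_loc_int[OF X] X_periodic[OF X] h] by simp
  also have "\<dots> = multiplier (\<lambda>k. (1 - steklov_symbol (real k * h)) ^ s * ((1 - steklov_symbol (real k * h)) * c k)) f"
    by (rule Suc.IH[OF finsupp_mult[OF Suc.prems]])
  finally show ?case by (simp add: mult_ac)
qed simp

text \<open>On frequency \<open>k\<close> one has \<open>\<i> k = h\<^sup>-\<^sup>1 (1 - a (k h)) \<phi> (k h)\<close> with the smooth function \<open>\<phi> = inv_symbol\<close>. Since \<open>k h = \<gamma> (k / n)\<close>, the cutoff at \<open>L n\<close> times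
\<open>\<phi> (k h)\<^sup>s\<close> is one fixed symbol sampled at \<open>k / n\<close>, so the bound is uniform in \<open>n\<close>; the factors \<open>1 - a (k h)\<close> are transferred to \<open>f\<close>
as \<open>D\<^sup>s\<close>.\<close>

lemma low_frequency_estimate:
  assumes \<gamma>: "\<gamma> > 0" and L: "L \<ge> (1 :: nat)"
  shows "\<exists>C\<ge>0. \<forall>n\<ge>1. \<forall>f\<in>X. N (multiplier (\<lambda>k. (\<i> * of_nat k) ^ s * cut (L * n) k) f)
     \<le> C * real n ^ s * N ((steklov_diff (\<gamma> / real n) ^^ s) f)"
proof -
  \<comment> \<open>differentiation divided by \<open>D\<close>, to the power \<open>s\<close>, cut off at \<open>L * n\<close> after sampling at \<open>k / n\<close>\<close>
  define g where "g u = of_real (cutoff (1 / real L * u)) * inv_symbol (\<gamma> * u) ^ s" for u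
  have sg: "symbol g"
    unfolding g_def
  proof (rule symbol_cutoff)
    show "inv_symbol (\<gamma> * - u) ^ s = cnj (inv_symbol (\<gamma> * u) ^ s)" for u
      using inv_symbol_cnj[of "\<gamma> * u"] by simp
    show "smooth_upto 3 (\<lambda>u. inv_symbol (\<gamma> * u) ^ s)"
      by (rule smooth_upto_power[OF smooth_upto_scale[OF inv_symbol_smooth]])
  qed (use L in auto)
  obtain C where C: "C \<ge> 0" "\<And>n f. n \<ge> 1 \<Longrightarrow> f \<in> X \<Longrightarrow> N (multiplier (sample g n) f) \<le> C * N f"
    using multiplier_bounded[OF sg] by blast
  have "N (multiplier (\<lambda>k. (\<i> * of_nat k) ^ s * cut (L * n) k) f)
     \<le> (1 / \<gamma>) ^ s * C * real n ^ s * N ((steklov_diff (\<gamma> / real n) ^^ s) f)" if n: "n \<ge> 1" and f: "f \<in> X" for n f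
  proof -
    define h where "h = \<gamma> / real n"
    have h: "h > 0" using \<gamma> n by (simp add: h_def)
    have fs: "finsupp (sample g n)" by (rule finsupp_sample[OF sg n])
    have X: "(steklov_diff h ^^ s) f \<in> X" by (rule steklov_diff_pow_in_X[OF f h])
    have id: "(\<i> * of_nat k) ^ s * cut (L * n) k
       = of_real ((1 / h) ^ s) * ((1 - steklov_symbol (real k * h)) ^ s * sample g n k)" for k
    proof -
      have "(1 - steklov_symbol (real k * h)) * inv_symbol (real k * h) = \<i> * of_real (real k * h)"
        by (rule inv_symbol_eq)
      then have "of_real (1 / h) * ((1 - steklov_symbol (real k * h)) * inv_symbol (real k * h)) = \<i> * of_nat k"
        using h by simp
      then have "(\<i> * of_nat k) ^ s = of_real ((1 / h) ^ s) * ((1 - steklov_symbol (real k * h)) ^ s * inv_symbol (real k * h) ^ s)"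
        by (metis power_mult_distrib of_real_power)
      moreover have "sample g n k = cut (L * n) k * inv_symbol (real k * h) ^ s"
        by (simp add: sample_def g_def h_def mult.commute)
      ultimately show ?thesis by simp
    qed
    have "multiplier (\<lambda>k. (\<i> * of_nat k) ^ s * cut (L * n) k) f
       = (\<lambda>x. (1 / h) ^ s *\<^sub>R multiplier (sample g n) ((steklov_diff h ^^ s) f) x)"
      unfolding id multiplier_steklov_diff_pow[OF fs f h]
      by (rule ext) (rule multiplier_coeff_scale[OF finsupp_mult[OF fs]])
    then have "N (multiplier (\<lambda>k. (\<i> * of_nat k) ^ s * cut (L * n) k) f)
       = (1 / h) ^ s * N (multiplier (sample g n) ((steklov_diff h ^^ s) f))"
      using h N_scaleR[OF multiplier_in_X[OF fs], of "(1 / h) ^ s"] by simp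
    also have "\<dots> \<le> (1 / h) ^ s * (C * N ((steklov_diff h ^^ s) f))"
      using h by (intro mult_left_mono C n X) auto
    also have "\<dots> = (1 / \<gamma>) ^ s * C * real n ^ s * N ((steklov_diff h ^^ s) f)"
      by (simp add: h_def power_divide)
    finally show ?thesis by (simp add: h_def)
  qed
  moreover have "(1 / \<gamma>) ^ s * C \<ge> 0" using C(1) \<gamma> by simp
  ultimately show ?thesis by blast
qed

text \<open>All derivatives of \<open>w = V\<^sub>m f - V\<^sub>n f\<close>, \<open>m = L n\<close>, have no frequencies up to \<open>n / 2\<close>, so each equals its own approximation error for the
cutoff at \<open>n / 2\<close>, which is at most \<open>A / n\<close> times the next derivative. After \<open>s\<close> steps the low frequency estimate applies to both parts.\<close>

lemma middle_frequency_estimate: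
  assumes \<gamma>: "\<gamma> > 0" and L: "L \<ge> (1 :: nat)"
  shows "\<exists>C\<ge>0. \<forall>n\<ge>1. \<forall>f\<in>X. N (multiplier (\<lambda>k. cut (L * n) k - cut n k) f)
     \<le> C * N ((steklov_diff (\<gamma> / real n) ^^ s) f)"
proof -
  obtain A where A: "A \<ge> 0" "\<forall>n\<ge>1. \<forall>u u' G. (\<forall>y. (u has_vector_derivative u' y) (at y)) \<longrightarrow> continuous_on UNIV u' \<longrightarrow>
     periodic u \<longrightarrow> G \<in> X \<longrightarrow> (\<forall>y. norm (u' y) \<le> norm (G y)) \<longrightarrow>
     N (\<lambda>x. u x - multiplier (sample (\<lambda>u. of_real (cutoff (2 * u))) n) u x) \<le> A / real n * N G"
    using multiplier_approximation[OF symbol_half_cut] by (auto simp: cutoff_eq_1)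
  obtain C1 where C1: "C1 \<ge> 0" "\<And>n f. n \<ge> 1 \<Longrightarrow> f \<in> X \<Longrightarrow> N (multiplier (\<lambda>k. (\<i> * of_nat k) ^ s * cut (L * n) k) f)
     \<le> C1 * real n ^ s * N ((steklov_diff (\<gamma> / real n) ^^ s) f)"
    using low_frequency_estimate[OF \<gamma> L] by blast
  obtain C2 where C2: "C2 \<ge> 0" "\<And>n f. n \<ge> 1 \<Longrightarrow> f \<in> X \<Longrightarrow> N (multiplier (\<lambda>k. (\<i> * of_nat k) ^ s * cut (1 * n) k) f)
     \<le> C2 * real n ^ s * N ((steklov_diff (\<gamma> / real n) ^^ s) f)"
    using low_frequency_estimate[OF \<gamma>, of 1] by blast
  have "N (multiplier (\<lambda>k. cut (L * n) k - cut n k) f) \<le> A ^ s * (C1 + C2) * N ((steklov_diff (\<gamma> / real n) ^^ s) f)"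
    if n: "n \<ge> 1" and f: "f \<in> X" for n f
  proof -
    have Ln: "L * n \<ge> 1" using L n by simp
    have fs: "finsupp (cut (L * n))" "finsupp (cut n)" by (intro finsupp_sample symbol_cut Ln n)+
    have fd: "finsupp (\<lambda>k. cut (L * n) k - cut n k)" by (intro finsupp_diff fs)
    define w where "w i = multiplier (\<lambda>k. (\<i> * of_nat k) ^ i * (cut (L * n) k - cut n k)) f" for i
    have wfs: "finsupp (\<lambda>k. (\<i> * of_nat k) ^ i * (cut (L * n) k - cut n k))" for i by (intro finsupp_mult fd)
    have step: "N (w i) \<le> A / real n * N (w (Suc i))" for i
    proof -
      let ?G = "sample (\<lambda>u. of_real (cutoff (2 * u)) :: complex) n"
      have Gfs: "finsupp ?G" by (intro finsupp_sample symbol_half_cut n)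
      have z: "?G k * ((\<i> * of_nat k) ^ i * (cut (L * n) k - cut n k)) = 0" for k
      proof (cases "\<bar>real k / real n\<bar> \<le> 1 / 2")
        case True
        have a: "real k / real (L * n) \<le> real k / real n"
          using L n by (intro divide_left_mono) auto
        have b: "real k / real n \<le> 1 / 2"
          using True by (simp only: abs_of_nonneg divide_nonneg_nonneg of_nat_0_le_iff)
        have "\<bar>real k / real (L * n)\<bar> \<le> 1 / 2"
          using order_trans[OF a b] by (simp only: abs_of_nonneg divide_nonneg_nonneg of_nat_0_le_iff)
        then show ?thesis using True by (simp add: sample_def cutoff_eq_1)
      next
        case False
        then have "\<bar>2 * (real k / real n)\<bar> \<ge> 1" by (simp only: abs_mult abs_numeral)
        then have "cutoff (2 * (real k / real n)) = 0" by (rule cutoff_eq_0)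
        then show ?thesis by (simp add: sample_def)
      qed
      have "multiplier ?G (w i) = multiplier (\<lambda>k. ?G k * ((\<i> * of_nat k) ^ i * (cut (L * n) k - cut n k))) f"
        unfolding w_def by (rule multiplier_multiplier[OF Gfs wfs]) (simp add: sample_def cutoff_eq_1)
      also have "\<dots> = (\<lambda>_. 0)" unfolding z by (simp add: multiplier_def fun_eq_iff)
      finally have zero: "multiplier ?G (w i) = (\<lambda>_. 0)" .
      have "(w i has_vector_derivative w (Suc i) y) (at y)" for y
        using multiplier_has_vector_derivative[OF wfs, of i f y] by (simp add: w_def mult_ac)
      moreover have "continuous_on UNIV (w (Suc i))" unfolding w_def by (intro multiplier_continuous wfs)
      moreover have "periodic (w i)" unfolding w_def by (rule multiplier_periodic)
      moreover have "w (Suc i) \<in> X" unfolding w_def by (intro multiplier_in_X wfs)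
      ultimately have "N (\<lambda>x. w i x - multiplier ?G (w i) x) \<le> A / real n * N (w (Suc i))"
        using A(2)[rule_format, OF n] by blast
      then show ?thesis by (simp add: zero)
    qed
    have iter: "N (w 0) \<le> (A / real n) ^ i * N (w i)" for i
    proof (induction i)
      case (Suc i)
      have "(A / real n) ^ i * N (w i) \<le> (A / real n) ^ i * (A / real n * N (w (Suc i)))"
        using A(1) by (intro mult_left_mono step) auto
      with Suc show ?case by (simp add: mult_ac)
    qed simp
    have "N (w s) \<le> N (multiplier (\<lambda>k. (\<i> * of_nat k) ^ s * cut (L * n) k) f) + N (multiplier (\<lambda>k. (\<i> * of_nat k) ^ s * cut n k) f)"
    proof -
      have "w s = (\<lambda>x. multiplier (\<lambda>k. (\<i> * of_nat k) ^ s * cut (L * n) k) f x - multiplier (\<lambda>k. (\<i> * of_nat k) ^ s * cut n k) f x)"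
        unfolding w_def right_diff_distrib
        by (rule ext) (intro multiplier_coeff_diff finsupp_mult fs)
      then show ?thesis by (simp only:) (intro N_diff multiplier_in_X finsupp_mult fs)
    qed
    also have "\<dots> \<le> (C1 + C2) * real n ^ s * N ((steklov_diff (\<gamma> / real n) ^^ s) f)"
      using C1(2)[OF n f] C2(2)[OF n f] by (simp add: distrib_right)
    finally have "(A / real n) ^ s * N (w s) \<le> (A / real n) ^ s * ((C1 + C2) * real n ^ s * N ((steklov_diff (\<gamma> / real n) ^^ s) f))"
      using A(1) by (intro mult_left_mono) auto
    also have "\<dots> = A ^ s * (C1 + C2) * N ((steklov_diff (\<gamma> / real n) ^^ s) f)"
      using n by (simp add: power_divide)
    finally show ?thesis using iter[of s] by (simp add: w_def)
  qed
  moreover have "A ^ s * (C1 + C2) \<ge> 0" using A(1) C1(1) C2(1) by simp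
  ultimately show ?thesis by blast
qed

text \<open>With \<open>e = f - V\<^sub>m f\<close>, \<open>m = L n\<close>, write \<open>e = D e + U D e + U\<^sup>2 e\<close>. The last term has no frequencies up to \<open>m / 2\<close>, so it is its own
approximation error at scale \<open>m\<close>: at most \<open>A / m\<close> times the bound \<open>4 / h\<close> on its derivative, that is, a multiple of \<open>N e / (L \<gamma>)\<close>. For
large \<open>L\<close> this is absorbed into the left-hand side. Finally \<open>D e\<close> is the same expression formed with \<open>D f\<close> instead of \<open>f\<close>,
since multipliers commute with \<open>U\<close>.\<close>

lemma high_frequency_step:
  assumes \<gamma>: "\<gamma> > 0"
  shows "\<exists>L\<ge>1. \<exists>C\<ge>0. \<forall>n\<ge>1. \<forall>f\<in>X. N (\<lambda>x. f x - multiplier (cut (L * n)) f x)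
     \<le> C * N (\<lambda>x. steklov_diff (\<gamma> / real n) f x - multiplier (cut (L * n)) (steklov_diff (\<gamma> / real n) f) x)"
proof -
  let ?g = "\<lambda>u. of_real (cutoff (2 * u)) :: complex"
  obtain A where A: "A \<ge> 0" "\<forall>n\<ge>1. \<forall>u u' G. (\<forall>y. (u has_vector_derivative u' y) (at y)) \<longrightarrow> continuous_on UNIV u' \<longrightarrow>
     periodic u \<longrightarrow> G \<in> X \<longrightarrow> (\<forall>y. norm (u' y) \<le> norm (G y)) \<longrightarrow>
     N (\<lambda>x. u x - multiplier (sample ?g n) u x) \<le> A / real n * N G"
    using multiplier_approximation[OF symbol_half_cut] by (auto simp: cutoff_eq_1)
  \<comment> \<open>chosen so that \<open>4 * A * steklov_const / (\<gamma> * L) \<le> 1 / 2\<close>, the factor that is absorbed at the end\<close>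
  obtain L0 :: nat where L0: "8 * A * steklov_const / \<gamma> \<le> real L0" using real_arch_simple by blast
  define L where "L = L0 + 1"
  have L: "L \<ge> 1" "8 * A * steklov_const \<le> \<gamma> * real L"
    using L0 \<gamma> by (auto simp: L_def field_simps)
  define C where "C = 2 * (1 + 2 * steklov_const)"
  have "N (\<lambda>x. f x - multiplier (cut (L * n)) f x)
     \<le> C * N (\<lambda>x. steklov_diff (\<gamma> / real n) f x - multiplier (cut (L * n)) (steklov_diff (\<gamma> / real n) f) x)"
    if n: "n \<ge> 1" and f: "f \<in> X" for n f
  proof -
    define h where "h = \<gamma> / real n"
    have h: "h > 0" using \<gamma> n by (simp add: h_def)
    have Ln: "L * n \<ge> 1" using L n by simp
    define d where "d = cut (L * n)"
    define c where "c = sample ?g (L * n)"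
    have fd: "finsupp d" unfolding d_def by (intro finsupp_sample symbol_cut Ln)
    have fc: "finsupp c" unfolding c_def by (intro finsupp_sample symbol_half_cut Ln)
    have d0: "Im (d 0) = 0" by (simp add: d_def sample_def)
    have cd: "c k * d k = c k" for k unfolding c_def d_def sample_def by (rule half_cut_absorbs)
    have fl: "loc_int f" "periodic f" using f by (simp_all add: X_loc_int X_periodic)
    have Vl: "loc_int (multiplier d f)" by (intro loc_int_continuous multiplier_continuous fd)
    define e where "e = (\<lambda>x. f x - multiplier d f x)"
    have eX: "e \<in> X" unfolding e_def by (intro X_diff f multiplier_in_X fd)
    have el: "loc_int e" "periodic e" using eX by (simp_all add: X_loc_int X_periodic)
    let ?U = "steklov_fwd h"
    have UX: "?U e \<in> X" by (intro steklov_fwd_in_X eX h)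
    have UUX: "?U (?U e) \<in> X" by (intro steklov_fwd_in_X UX h)
    have DX: "steklov_diff h e \<in> X" by (intro steklov_diff_in_X eX h)
    have comm: "steklov_diff h e = (\<lambda>x. steklov_diff h f x - multiplier d (steklov_diff h f) x)"
    proof
      fix x
      have "multiplier d (steklov_diff h f) x = multiplier d f x - multiplier d (?U f) x"
        unfolding steklov_diff_def by (intro multiplier_diff fl loc_int_continuous steklov_fwd_continuous h)
      moreover have "multiplier d (?U f) = ?U (multiplier d f)"
        by (simp only: multiplier_steklov[OF fd fl h] steklov_multiplier[OF fd h])
      moreover have "?U e x = ?U f x - ?U (multiplier d f) x"
        unfolding e_def by (rule steklov_fwd_diff[OF fl(1) Vl])
      ultimately show "steklov_diff h e x = steklov_diff h f x - multiplier d (steklov_diff h f) x"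
        by (simp add: steklov_diff_def e_def)
    qed
    have zero: "multiplier c (?U (?U e)) = (\<lambda>_. 0)"
    proof
      fix x
      define c' where "c' k = steklov_symbol (real k * h) * (steklov_symbol (real k * h) * c k)" for k
      have fc': "finsupp c'" unfolding c'_def by (intro finsupp_mult fc)
      have "multiplier c (?U (?U e)) = multiplier c' e"
        unfolding c'_def
        by (simp only: multiplier_steklov[OF fc X_loc_int[OF UX] X_periodic[OF UX] h] multiplier_steklov[OF finsupp_mult[OF fc] el h])
      moreover have "multiplier c' e x = multiplier c' f x - multiplier c' (multiplier d f) x"
        unfolding e_def by (rule multiplier_diff[OF fl(1) Vl])
      moreover have "multiplier c' (multiplier d f) = multiplier c' f"
      proof -
        have "(\<lambda>k. c' k * d k) = c'" by (rule ext) (simp add: c'_def mult.assoc cd)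
        then show ?thesis by (simp only: multiplier_multiplier[OF fc' fd d0])
      qed
      ultimately show "multiplier c (?U (?U e)) x = 0" by simp
    qed
    define G where "G = (\<lambda>x. of_real (4 / h * avg (4 * h) e x) :: 'a)"
    have h4: "4 * h > 0" using h by simp
    have Geq: "G = (\<lambda>x. (4 / h) *\<^sub>R (of_real (avg (4 * h) e x) :: 'a))"
      by (simp add: G_def scaleR_conv_of_real)
    have GX: "G \<in> X" unfolding Geq by (intro X_scaleR avg_in_X eX h4)
    have GN: "N G \<le> 4 / h * (steklov_const * N e)"
      unfolding Geq N_scaleR[OF avg_in_X(1)[OF eX h4]] using h avg_in_X(2)[OF eX h4]
      by (simp add: divide_right_mono)
    have Uc: "continuous_on UNIV (?U e)" by (rule steklov_fwd_continuous[OF el(1) h])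
    have "N (\<lambda>x. ?U (?U e) x - multiplier c (?U (?U e)) x) \<le> A / real (L * n) * N G"
    proof -
      have 1: "(?U (?U e) has_vector_derivative (1 / h) *\<^sub>R (?U e (y + h) - ?U e y)) (at y)" for y
        by (rule steklov_fwd_has_derivative[OF Uc h])
      have 2: "continuous_on UNIV (\<lambda>y. (1 / h) *\<^sub>R (?U e (y + h) - ?U e y))"
        by (intro continuous_intros Uc continuous_on_compose2[OF Uc]) auto
      have 3: "norm ((1 / h) *\<^sub>R (?U e (y + h) - ?U e y)) \<le> norm (G y)" for y
        unfolding G_def by (rule second_steklov_derivative_bound[OF eX h])
      show ?thesis unfolding c_def by (rule A(2)[rule_format, OF Ln 1 2 X_periodic[OF UUX] GX 3])
    qed
    then have "N (?U (?U e)) \<le> A / real (L * n) * N G" by (simp add: zero)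
    also have "\<dots> \<le> A / real (L * n) * (4 / h * (steklov_const * N e))"
      using A(1) by (intro mult_left_mono GN) auto
    also have "\<dots> = (4 * A * steklov_const) / (\<gamma> * real L) * N e"
      using n by (simp add: h_def mult_ac)
    also have "\<dots> \<le> 1 / 2 * N e"
      using L \<gamma> by (intro mult_right_mono N_nonneg eX) (simp add: field_simps)
    finally have UU: "N (?U (?U e)) \<le> 1 / 2 * N e" .
    have split: "e = (\<lambda>x. (steklov_diff h e x + ?U (steklov_diff h e) x) + ?U (?U e) x)"
    proof
      fix x
      have "?U (steklov_diff h e) x = ?U e x - ?U (?U e) x"
        unfolding steklov_diff_def by (rule steklov_fwd_diff[OF el(1) X_loc_int[OF UX]])
      then show "e x = (steklov_diff h e x + ?U (steklov_diff h e) x) + ?U (?U e) x"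
        by (simp add: steklov_diff_def)
    qed
    have UDX: "?U (steklov_diff h e) \<in> X" by (intro steklov_fwd_in_X DX h)
    have "N e \<le> N (\<lambda>x. steklov_diff h e x + ?U (steklov_diff h e) x) + N (?U (?U e))"
      by (subst split, rule N_triangle[OF X_add[OF DX UDX] UUX])
    also have "N (\<lambda>x. steklov_diff h e x + ?U (steklov_diff h e) x) \<le> N (steklov_diff h e) + N (?U (steklov_diff h e))"
      by (rule N_triangle[OF DX UDX])
    also have "N (?U (steklov_diff h e)) \<le> 2 * steklov_const * N (steklov_diff h e)"
      by (rule steklov_fwd_in_X(2)[OF DX h])
    also note UU
    finally have "N e \<le> C * N (steklov_diff h e)" by (simp add: C_def algebra_simps)
    then show ?thesis unfolding comm by (simp add: e_def d_def h_def)
  qed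
  moreover have "C \<ge> 0" using steklov_const(1) by (simp add: C_def)
  ultimately show ?thesis using L(1) by blast
qed

text \<open>The previous estimate has the same shape on both sides, so it can be iterated \<open>s\<close> times.\<close>

lemma high_frequency_estimate:
  assumes \<gamma>: "\<gamma> > 0"
  shows "\<exists>L\<ge>1. \<exists>C\<ge>0. \<forall>n\<ge>1. \<forall>f\<in>X. N (\<lambda>x. f x - multiplier (cut (L * n)) f x)
     \<le> C * N ((steklov_diff (\<gamma> / real n) ^^ s) f)"
proof -
  obtain L C where L: "L \<ge> 1" and C: "C \<ge> 0" and step: "\<And>n f. n \<ge> 1 \<Longrightarrow> f \<in> X \<Longrightarrow>
     N (\<lambda>x. f x - multiplier (cut (L * n)) f x)
     \<le> C * N (\<lambda>x. steklov_diff (\<gamma> / real n) f x - multiplier (cut (L * n)) (steklov_diff (\<gamma> / real n) f) x)"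
    using high_frequency_step[OF \<gamma>] by blast
  obtain B where B: "B \<ge> 0" "\<And>n f. n \<ge> 1 \<Longrightarrow> f \<in> X \<Longrightarrow> N (multiplier (cut n) f) \<le> B * N f"
    using multiplier_bounded[OF symbol_cut] by blast
  have "N (\<lambda>x. f x - multiplier (cut (L * n)) f x) \<le> C ^ s * (1 + B) * N ((steklov_diff (\<gamma> / real n) ^^ s) f)"
    if n: "n \<ge> 1" and f: "f \<in> X" for n f
    using f
  proof (induction s arbitrary: f)
    case 0
    have Ln: "L * n \<ge> 1" using L n by simp
    have "N (\<lambda>x. f x - multiplier (cut (L * n)) f x) \<le> N f + N (multiplier (cut (L * n)) f)"
      by (intro N_diff 0 multiplier_in_X finsupp_sample symbol_cut Ln)
    then show ?case using B(2)[OF Ln 0] by (simp add: distrib_right)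
  next
    case (Suc s)
    have h: "\<gamma> / real n > 0" using \<gamma> n by simp
    have D: "steklov_diff (\<gamma> / real n) f \<in> X" by (rule steklov_diff_in_X[OF Suc.prems h])
    have "C * N (\<lambda>x. steklov_diff (\<gamma> / real n) f x - multiplier (cut (L * n)) (steklov_diff (\<gamma> / real n) f) x)
       \<le> C * (C ^ s * (1 + B) * N ((steklov_diff (\<gamma> / real n) ^^ s) (steklov_diff (\<gamma> / real n) f)))"
      by (intro mult_left_mono Suc.IH D C)
    with step[OF n Suc.prems] show ?case by (simp add: funpow_swap1 mult_ac)
  qed
  moreover have "C ^ s * (1 + B) \<ge> 0" using C B by simp
  ultimately show ?thesis using L by blast
qed

text \<open>The difference \<open>f - V\<^sub>n f\<close> is the sum of the high part \<open>f - V\<^sub>m f\<close> and the middle part \<open>V\<^sub>m f - V\<^sub>n f\<close>, where \<open>m = L n\<close> and \<open>L\<close> is the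
factor that the high frequency estimate requires.\<close>

lemma near_best_trig_approximation:
  assumes \<gamma>: "\<gamma> > 0"
  shows "\<exists>C\<ge>0. \<forall>n\<ge>1. \<forall>f\<in>X. \<exists>T\<in>trig_polys n. T \<in> X \<and>
     N (\<lambda>x. f x - T x) \<le> C * N ((steklov_diff (\<gamma> / real n) ^^ s) f) \<and>
     N ((vderiv ^^ s) T) \<le> C * real n ^ s * N ((steklov_diff (\<gamma> / real n) ^^ s) f)"
proof -
  obtain L C1 where L: "L \<ge> 1" and C1: "C1 \<ge> 0" and high: "\<And>n f. n \<ge> 1 \<Longrightarrow> f \<in> X \<Longrightarrow>
     N (\<lambda>x. f x - multiplier (cut (L * n)) f x) \<le> C1 * N ((steklov_diff (\<gamma> / real n) ^^ s) f)"
    using high_frequency_estimate[OF \<gamma>] by blast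
  obtain C2 where C2: "C2 \<ge> 0" and mid: "\<And>n f. n \<ge> 1 \<Longrightarrow> f \<in> X \<Longrightarrow>
     N (multiplier (\<lambda>k. cut (L * n) k - cut n k) f) \<le> C2 * N ((steklov_diff (\<gamma> / real n) ^^ s) f)"
    using middle_frequency_estimate[OF \<gamma> L] by blast
  obtain C3 where C3: "C3 \<ge> 0" and low: "\<And>n f. n \<ge> 1 \<Longrightarrow> f \<in> X \<Longrightarrow> N (multiplier (\<lambda>k. (\<i> * of_nat k) ^ s * cut (1 * n) k) f)
     \<le> C3 * real n ^ s * N ((steklov_diff (\<gamma> / real n) ^^ s) f)"
    using low_frequency_estimate[OF \<gamma>, of 1] by blast
  define C where "C = C1 + C2 + C3"
  have "\<exists>T\<in>trig_polys n. T \<in> X \<and>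
     N (\<lambda>x. f x - T x) \<le> C * N ((steklov_diff (\<gamma> / real n) ^^ s) f) \<and>
     N ((vderiv ^^ s) T) \<le> C * real n ^ s * N ((steklov_diff (\<gamma> / real n) ^^ s) f)"
    if n: "n \<ge> 1" and f: "f \<in> X" for n f
  proof (intro bexI conjI)
    have Ln: "L * n \<ge> 1" using L n by simp
    have fs: "finsupp (cut (L * n))" "finsupp (cut n)" by (intro finsupp_sample symbol_cut Ln n)+
    have h: "\<gamma> / real n > 0" using \<gamma> n by simp
    have D0: "0 \<le> N ((steklov_diff (\<gamma> / real n) ^^ s) f)"
      by (intro N_nonneg steklov_diff_pow_in_X f h)
    show "multiplier (cut n) f \<in> trig_polys n"
    proof (rule multiplier_trig_poly)
      fix k assume "k > n"
      then have "1 \<le> \<bar>real k / real n\<bar>" using n by simp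
      then show "cut n k = 0" by (simp add: sample_def cutoff_eq_0)
    qed
    show "multiplier (cut n) f \<in> X" by (intro multiplier_in_X fs)
    have "(\<lambda>x. f x - multiplier (cut n) f x)
       = (\<lambda>x. (f x - multiplier (cut (L * n)) f x) + multiplier (\<lambda>k. cut (L * n) k - cut n k) f x)"
      by (simp add: multiplier_coeff_diff[OF fs])
    then have "N (\<lambda>x. f x - multiplier (cut n) f x)
       \<le> N (\<lambda>x. f x - multiplier (cut (L * n)) f x) + N (multiplier (\<lambda>k. cut (L * n) k - cut n k) f)"
      by (simp only:) (intro N_triangle X_diff f multiplier_in_X finsupp_diff fs)
    also have "\<dots> \<le> (C1 + C2) * N ((steklov_diff (\<gamma> / real n) ^^ s) f)"
      using high[OF n f] mid[OF n f] by (simp add: distrib_right)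
    also have "\<dots> \<le> C * N ((steklov_diff (\<gamma> / real n) ^^ s) f)"
      using C3 D0 by (intro mult_right_mono) (auto simp: C_def)
    finally show "N (\<lambda>x. f x - multiplier (cut n) f x) \<le> C * N ((steklov_diff (\<gamma> / real n) ^^ s) f)" .
    have "N ((vderiv ^^ s) (multiplier (cut n) f)) \<le> C3 * real n ^ s * N ((steklov_diff (\<gamma> / real n) ^^ s) f)"
      using low[OF n f] by (simp add: vderiv_multiplier[OF fs(2)])
    also have "\<dots> \<le> C * real n ^ s * N ((steklov_diff (\<gamma> / real n) ^^ s) f)"
      using C1 C2 D0 by (intro mult_right_mono) (auto simp: C_def)
    finally show "N ((vderiv ^^ s) (multiplier (cut n) f)) \<le> C * real n ^ s * N ((steklov_diff (\<gamma> / real n) ^^ s) f)" .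
  qed
  moreover have "C \<ge> 0" using C1 C2 C3 by (simp add: C_def)
  ultimately show ?thesis by blast
qed

end

section \<open>Kantorovich-type operators\<close>

context steklov_lattice begin

lemma steklov_pow_in_X: "f \<in> X \<Longrightarrow> h > 0 \<Longrightarrow> (steklov h ^^ k) f \<in> X"
  by (induction k) (auto intro: steklov_in_X)

lemma steklov_pow_diff:
  assumes "f \<in> X" "g \<in> X" "h > 0"
  shows "(steklov h ^^ k) (\<lambda>x. f x - g x) = (\<lambda>x. (steklov h ^^ k) f x - (steklov h ^^ k) g x)"
proof (induction k)
  case (Suc k)
  have l: "loc_int ((steklov h ^^ k) f)" "loc_int ((steklov h ^^ k) g)"
    using assms by (auto intro: X_loc_int steklov_pow_in_X)
  show ?case
    by (rule ext) (simp add: Suc.IH steklov_eq_integral l loc_int_diff loc_int_integrable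
        Henstock_Kurzweil_Integration.integral_diff scaleR_diff_right)
qed simp

lemma kantorovich_op_diff:
  assumes "f \<in> X" "g \<in> X" "\<gamma> / real n > 0"
  shows "kantorovich_op m x \<phi> \<gamma> n r (\<lambda>t. f t - g t) t = kantorovich_op m x \<phi> \<gamma> n r f t - kantorovich_op m x \<phi> \<gamma> n r g t"
proof -
  have "steklov_comb (\<gamma> / real n) r (\<lambda>t. f t - g t) p
     = steklov_comb (\<gamma> / real n) r f p - steklov_comb (\<gamma> / real n) r g p" for p
    by (simp only: steklov_comb_def steklov_pow_diff[OF assms] right_diff_distrib sum_subtractf)
  then show ?thesis by (simp only: kantorovich_op_def left_diff_distrib sum_subtractf)
qed

lemma X_sum: "(\<And>i. i \<in> I \<Longrightarrow> F i \<in> X) \<Longrightarrow> finite I \<Longrightarrow> (\<lambda>t. \<Sum>i\<in>I. F i t) \<in> X"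
proof (induction I rule: infinite_finite_induct)
  case (insert i I)
  then have "(\<lambda>t. F i t + (\<Sum>i\<in>I. F i t)) \<in> X" by (intro X_add) auto
  with insert show ?case by simp
qed (simp_all add: zero_in_X)

lemma kantorovich_op_in_X:
  assumes "\<And>k. k \<in> {1..m n} \<Longrightarrow> \<phi> n k \<in> X"
  shows "kantorovich_op m x \<phi> \<gamma> n r f \<in> X"
  unfolding kantorovich_op_def[abs_def] by (intro X_sum X_scale assms) auto

end

theorem theorem3p1:
  fixes X :: "(real \<Rightarrow> 'a::{real_normed_field, euclidean_space}) set"
    and N :: "(real \<Rightarrow> 'a) \<Rightarrow> real"
    and \<Phi> :: "nat \<Rightarrow> (real \<Rightarrow> 'a) set"
    and m :: "nat \<Rightarrow> nat"
    and x :: "nat \<Rightarrow> nat \<Rightarrow> real"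
    and \<phi> :: "nat \<Rightarrow> nat \<Rightarrow> real \<Rightarrow> 'a"
    and \<gamma> \<gamma>' C1 C2 :: real
    and r s :: nat
  assumes "banach_lattice X N"
    and "steklov_bounded X N"
    and "r \<ge> 1" and "s \<ge> 1"
    and "bernstein_family X N \<Phi>"
    and "quasi_uniform_nodes m x \<gamma> \<gamma>'"
    and "\<And>n k. n \<ge> 1 \<Longrightarrow> k \<in> {1..m n} \<Longrightarrow> \<phi> n k \<in> \<Phi> n"
    and "C1 > 0" and "C2 > 0"
    and "\<And>f n. f \<in> X \<Longrightarrow> n \<ge> 1 \<Longrightarrow> N (kantorovich_op m x \<phi> \<gamma> n r f) \<le> C1 * N f"
    and "\<And>T n. n \<ge> 1 \<Longrightarrow> T \<in> trig_polys n \<Longrightarrow>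
           N (\<lambda>t. T t - kantorovich_op m x \<phi> \<gamma> n r T t) \<le> C2 / real n ^ s * N ((vderiv ^^ s) T)"
  shows "\<exists>C>0. \<forall>f\<in>X. \<forall>n\<ge>1.
           N (\<lambda>t. f t - kantorovich_op m x \<phi> \<gamma> n r f t)
             \<le> C * N (((\<lambda>g t. g t - steklov_fwd (\<gamma> / real n) g t) ^^ s) f)"
proof -
  interpret steklov_lattice X N
    using assms(1,2) by (simp add: steklov_lattice_def steklov_lattice_axioms_def)
  have \<gamma>: "\<gamma> > 0" using assms(6) by (simp add: quasi_uniform_nodes_def)
  let ?K = "\<lambda>n. kantorovich_op m x \<phi> \<gamma> n r"
  from near_best_trig_approximation[OF \<gamma>, of s]
  obtain A where A: "A \<ge> 0" "\<forall>n\<ge>1. \<forall>f\<in>X. \<exists>T\<in>trig_polys n. T \<in> X \<and>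
     N (\<lambda>x. f x - T x) \<le> A * N ((steklov_diff (\<gamma> / real n) ^^ s) f) \<and>
     N ((vderiv ^^ s) T) \<le> A * real n ^ s * N ((steklov_diff (\<gamma> / real n) ^^ s) f)"
    by (elim exE conjE)
  have \<Phi>: "\<phi> n k \<in> X" if "n \<ge> 1" "k \<in> {1..m n}" for n k
  proof -
    from assms(5) have "\<forall>n. \<Phi> n \<subseteq> X" unfolding bernstein_family_def by (elim conjE)
    then show ?thesis using assms(7)[OF that] by blast
  qed
  \<comment> \<open>the summand \<open>1\<close> makes the constant positive even if \<open>A = 0\<close>\<close>
  define C where "C = (1 + C1) * A + C2 * A + 1"
  have "N (\<lambda>t. f t - ?K n f t) \<le> C * N ((steklov_diff (\<gamma> / real n) ^^ s) f)" if f: "f \<in> X" and n: "n \<ge> 1" for f n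
  proof -
    define \<delta> where "\<delta> = N ((steklov_diff (\<gamma> / real n) ^^ s) f)"
    have h: "\<gamma> / real n > 0" using \<gamma> n by simp
    have \<delta>: "\<delta> \<ge> 0" unfolding \<delta>_def by (intro N_nonneg steklov_diff_pow_in_X f h)
    from A(2)[rule_format, OF n f]
    obtain T where T: "T \<in> trig_polys n" "T \<in> X" "N (\<lambda>x. f x - T x) \<le> A * \<delta>"
      "N ((vderiv ^^ s) T) \<le> A * real n ^ s * \<delta>"
      unfolding \<delta>_def by (elim bexE conjE)
    have fT: "(\<lambda>x. f x - T x) \<in> X" by (intro X_diff f T)
    have KX: "?K n g \<in> X" for g by (intro kantorovich_op_in_X \<Phi> n)
    have TK: "(\<lambda>t. T t - ?K n T t) \<in> X" by (intro X_diff T KX)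
    have "(\<lambda>t. f t - ?K n f t) = (\<lambda>t. ((f t - T t) + (T t - ?K n T t)) - ?K n (\<lambda>t. f t - T t) t)"
      by (simp add: kantorovich_op_diff[OF f T(2) h])
    then have "N (\<lambda>t. f t - ?K n f t) \<le> N (\<lambda>t. (f t - T t) + (T t - ?K n T t)) + N (?K n (\<lambda>t. f t - T t))"
      by (simp only:) (intro N_diff X_add fT TK KX)
    also have "N (\<lambda>t. (f t - T t) + (T t - ?K n T t)) \<le> N (\<lambda>t. f t - T t) + N (\<lambda>t. T t - ?K n T t)"
      by (rule N_triangle[OF fT TK])
    also have "N (\<lambda>t. T t - ?K n T t) \<le> C2 / real n ^ s * N ((vderiv ^^ s) T)" by (rule assms(11)[OF n T(1)])
    also have "\<dots> \<le> C2 / real n ^ s * (A * real n ^ s * \<delta>)"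
      using assms(9) by (intro mult_left_mono T) auto
    also have "\<dots> = C2 * A * \<delta>" using n by simp
    also have "N (?K n (\<lambda>t. f t - T t)) \<le> C1 * N (\<lambda>t. f t - T t)" by (rule assms(10)[OF fT n])
    finally have "N (\<lambda>t. f t - ?K n f t) \<le> (1 + C1) * N (\<lambda>t. f t - T t) + C2 * A * \<delta>" by (simp add: algebra_simps)
    also have "\<dots> \<le> (1 + C1) * (A * \<delta>) + C2 * A * \<delta>"
      using assms(8) by (intro add_right_mono mult_left_mono T) auto
    also have "\<dots> \<le> C * \<delta>" using \<delta> by (simp add: C_def algebra_simps)
    finally show ?thesis by (simp add: \<delta>_def)
  qed
  note bound = this
  have "C > 0" using A(1) assms(8,9) by (simp add: C_def add_nonneg_pos)
  have "(\<lambda>(g :: real \<Rightarrow> 'a) t. g t - steklov_fwd (\<gamma> / real n) g t) = steklov_diff (\<gamma> / real n)" for n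
    by (rule ext)+ (simp add: steklov_diff_def)
  note fold = this
  show ?thesis
    unfolding fold by (intro exI[of _ C] conjI ballI allI impI bound \<open>C > 0\<close>)
qed

end
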